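(* Let $n,r\ge1$. Let $X=X(r,n)$ be the set of set partitions of $\{1,\dots,r\}$ into at most $n$ blocks and let $\rho$ be the rotation map acting on $X$. Let $$P(q)=\mathrm{fd}\,\mathrm{ch}\,(H_n\circ H_+)_r .$$ Then the triple $(X,\rho,P(q))$ exhibits the cyclic sieving phenomenon (for the cyclic group of order $r$).
   Context: $\rho$ acts through the permutation $i\mapsto(i\bmod r)+1$ of $\{1,\dots,r\}$. $H_n=\sum_{k=0}^nh_k$ is the species of sets of cardinality at most $n$, $H_+=\sum_{k\ge1}h_k$ the species of non-empty sets, $\circ$ is composition of species, and $(H_n\circ H_+)_r$ is the homogeneous part of degree $r$: the permutation representation of $\mathfrak S_r$ on set partitions of $\{1,\dots,r\}$ into at most $n$ blocks. Its Frobenius character $\mathrm{ch}$ is the degree $r$ part of the plethysm $\sum_{k=0}^nh_k[\sum_{j\ge1}h_j]$, where $h_j$ are the complete homogeneous symmetric functions. Fake degree: $\mathrm{fd}$ is the linear map from homogeneous symmetric functions to $\mathbb Z[q]$ with $\mathrm{fd}(s_\lambda)=\sum_Tq^{\mathrm{maj}(T)}$, the sum over standard Young tableaux $T$ of shape $\lambda$, where $\mathrm{maj}(T)$ is the sum of those $i$ such that $i+1$ is in a strictly lower row (English notation) than $i$. Cyclic sieving: for a finite set $X$, a bijection $c$ of $X$ with $c^N=\mathrm{id}$ and $P\in\mathbb Z[q]$, the triple $(X,c,P)$ exhibits the cyclic sieving phenomenon if $P(\omega^j)=\#\{x\in X:c^j(x)=x\}$ for $0\le j\le N-1$, $\omega=\exp(2\pi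 i/N)$. Here $N=r$. *)

theory Defs
  imports
    Complex_Main
    "HOL-Library.Poly_Mapping"
    "HOL-Library.Disjoint_Sets"
    "HOL-Library.FuncSet"
    "HOL-Library.Multiset"
    "HOL-Computational_Algebra.Polynomial"
    "HOL-Combinatorics.Permutations"
    "HOL-Combinatorics.Orbits"
begin

section \<open>Species\<close>

text \<open>
  A species assigns to each finite label set its set of structures, and to each bijection
  \<open>\<sigma>\<close> from \<open>U\<close> to \<open>V\<close> a map from structures on \<open>U\<close> to structures on \<open>V\<close>.
  The arguments of \<open>transport\<close> are \<open>U\<close>, \<open>\<sigma>\<close> and the structure.
\<close>

record ('u, 's) species =
  structures :: "'u set \<Rightarrow> 's set"
  transport :: "'u set \<Rightarrow> ('u \<Rightarrow> 'u) \<Rightarrow> 's \<Rightarrow> 's"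

definition set_species :: "(nat \<Rightarrow> bool) \<Rightarrow> ('u, 'u set) species" where
  "set_species Q =
     \<lparr>structures = (\<lambda>U. if finite U \<and> Q (card U) then {U} else {}),
      transport = (\<lambda>U \<sigma> S. \<sigma> ` S)\<rparr>"

definition sets_le :: "nat \<Rightarrow> ('u, 'u set) species" where
  "sets_le n = set_species (\<lambda>k. k \<le> n)"

definition sets_nonempty :: "('u, 'u set) species" where
  "sets_nonempty = set_species (\<lambda>k. k \<ge> 1)"

text \<open>
  An \<open>F \<circ> G\<close>-structure on \<open>U\<close> is a set partition \<open>\<pi>\<close> of \<open>U\<close>, an \<open>F\<close>-structure on the set
  of blocks \<open>\<pi>\<close>, and a \<open>G\<close>-structure on each block.
\<close>

definition species_comp ::
  "('u set, 's) species \<Rightarrow> ('u, 't) species \<Rightarrow> ('u, 'u set set \<times> 's \<times> ('u set \<Rightarrow> 't)) species"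
where
  "species_comp F G =
     \<lparr>structures = (\<lambda>U. {(\<pi>, s, g). partition_on U \<pi> \<and> s \<in> structures F \<pi> \<and>
                                     g \<in> (\<Pi>\<^sub>E B\<in>\<pi>. structures G B)}),
      transport = (\<lambda>U \<sigma> (\<pi>, s, g).
        ((`) \<sigma> ` \<pi>,
         transport F \<pi> ((`) \<sigma>) s,
         (\<lambda>C\<in>(`) \<sigma> ` \<pi>. let B = \<sigma> -` C \<inter> U in transport G B \<sigma> (g B))))\<rparr>"


section \<open>Symmetric functions\<close>

text \<open>
  Symmetric functions are formal power series in the variables \<open>x\<^sub>0, x\<^sub>1, x\<^sub>2, \<dots>\<close>, given by
  their coefficient functions on monomials (finitely supported exponent vectors).  Coefficients
  are rational because the Frobenius character involves division by \<open>r!\<close>.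
\<close>

type_synonym series = "(nat \<Rightarrow>\<^sub>0 nat) \<Rightarrow> rat"

definition series_one :: series where
  "series_one m = (if m = 0 then 1 else 0)"

definition series_mult :: "series \<Rightarrow> series \<Rightarrow> series" where
  "series_mult f g m = (\<Sum>(a, b)\<in>{(a, b). a + b = m}. f a * g b)"

definition power_sum :: "nat \<Rightarrow> series" where
  "power_sum k m = (if \<exists>i. m = Poly_Mapping.single i k then 1 else 0)"

definition power_sum_partition :: "nat list \<Rightarrow> series" where
  "power_sum_partition \<mu> = foldr series_mult (map power_sum \<mu>) series_one"

definition partitions :: "nat list set" where
  "partitions = {\<mu>. sorted_wrt (\<ge>) \<mu> \<and> (\<forall>k\<in>set \<mu>. k > 0)}"

text \<open>Cells are (row, column) pairs, with rows numbered from top to bottom.\<close>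

definition cells :: "nat list \<Rightarrow> (nat \<times> nat) set" where
  "cells \<mu> = {(i, j). i < length \<mu> \<and> j < \<mu> ! i}"

definition semistandard_tableaux :: "nat list \<Rightarrow> (nat \<times> nat \<Rightarrow> nat) set" where
  "semistandard_tableaux \<mu> = {T \<in> extensional (cells \<mu>).
     (\<forall>i j j'. (i, j) \<in> cells \<mu> \<and> (i, j') \<in> cells \<mu> \<and> j < j' \<longrightarrow> T (i, j) \<le> T (i, j')) \<and>
     (\<forall>i i' j. (i, j) \<in> cells \<mu> \<and> (i', j) \<in> cells \<mu> \<and> i < i' \<longrightarrow> T (i, j) < T (i', j))}"

definition schur :: "nat list \<Rightarrow> series" where
  "schur \<mu> m = of_nat (card {T \<in> semistandard_tableaux \<mu>.
     \<forall>k. Poly_Mapping.lookup m k = card {c \<in> cells \<mu>. T c = k}})"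

definition schur_coeffs :: "series \<Rightarrow> nat list \<Rightarrow> rat" where
  "schur_coeffs f = (THE c. finite {\<mu>. c \<mu> \<noteq> 0} \<and> {\<mu>. c \<mu> \<noteq> 0} \<subseteq> partitions \<and>
     (\<forall>m. f m = (\<Sum>\<mu> | c \<mu> \<noteq> 0. c \<mu> * schur \<mu> m)))"


section \<open>Fake degree\<close>

definition standard_tableaux :: "nat list \<Rightarrow> (nat \<times> nat \<Rightarrow> nat) set" where
  "standard_tableaux \<mu> = {T \<in> extensional (cells \<mu>).
     bij_betw T (cells \<mu>) {1..sum_list \<mu>} \<and>
     (\<forall>i j j'. (i, j) \<in> cells \<mu> \<and> (i, j') \<in> cells \<mu> \<and> j < j' \<longrightarrow> T (i, j) < T (i, j')) \<and>
     (\<forall>i i' j. (i, j) \<in> cells \<mu> \<and> (i', j) \<in> cells \<mu> \<and> i < i' \<longrightarrow> T (i, j) < T (i', j))}"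

definition tableau_descents :: "nat list \<Rightarrow> (nat \<times> nat \<Rightarrow> nat) \<Rightarrow> nat set" where
  "tableau_descents \<mu> T = {k. \<exists>i j i' j'. (i, j) \<in> cells \<mu> \<and> (i', j') \<in> cells \<mu> \<and>
     T (i, j) = k \<and> T (i', j') = k + 1 \<and> i < i'}"

definition maj :: "nat list \<Rightarrow> (nat \<times> nat \<Rightarrow> nat) \<Rightarrow> nat" where
  "maj \<mu> T = \<Sum> (tableau_descents \<mu> T)"

definition fake_degree_schur :: "nat list \<Rightarrow> rat poly" where
  "fake_degree_schur \<mu> = (\<Sum>T\<in>standard_tableaux \<mu>. monom 1 (maj \<mu> T))"

text \<open>The linear extension from the Schur basis.\<close>

definition fake_degree :: "series \<Rightarrow> rat poly" where
  "fake_degree f =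
     (\<Sum>\<mu> | schur_coeffs f \<mu> \<noteq> 0. smult (schur_coeffs f \<mu>) (fake_degree_schur \<mu>))"


section \<open>Frobenius character\<close>

definition cycle_type :: "nat \<Rightarrow> (nat \<Rightarrow> nat) \<Rightarrow> nat list" where
  "cycle_type r \<sigma> =
     rev (sorted_list_of_multiset (image_mset card (mset_set (orbit \<sigma> ` {1..r}))))"

text \<open>
  The value at \<open>\<sigma>\<close> of the character of a permutation representation, i.e. the trace of a
  permutation matrix, is the number of fixed points of \<open>\<sigma>\<close>.
\<close>

definition species_character :: "nat \<Rightarrow> (nat, 's) species \<Rightarrow> (nat \<Rightarrow> nat) \<Rightarrow> nat" where
  "species_character r F \<sigma> =
     card {s \<in> structures F {1..r}. transport F {1..r} \<sigma> s = s}"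

definition frobenius_character :: "nat \<Rightarrow> (nat, 's) species \<Rightarrow> series" where
  "frobenius_character r F m =
     (1 / fact r) * (\<Sum>\<sigma> | \<sigma> permutes {1..r}.
        of_nat (species_character r F \<sigma>) * power_sum_partition (cycle_type r \<sigma>) m)"


section \<open>Rotation of set partitions and cyclic sieving\<close>

definition set_partitions :: "nat \<Rightarrow> nat \<Rightarrow> nat set set set" where
  "set_partitions r n = {\<pi>. partition_on {1..r} \<pi> \<and> card \<pi> \<le> n}"

definition rotation :: "nat \<Rightarrow> nat set set \<Rightarrow> nat set set" where
  "rotation r \<pi> = (`) (\<lambda>i. i mod r + 1) ` \<pi>"

text \<open>The condition that the polynomial has integer coefficients is part of the definition.\<close>

definition cyclic_sieving :: "'x set \<Rightarrow> ('x \<Rightarrow> 'x) \<Rightarrow> nat \<Rightarrow> rat poly \<Rightarrow> bool" where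
  "cyclic_sieving X c N P \<longleftrightarrow>
     finite X \<and> bij_betw c X X \<and> (\<forall>x\<in>X. (c ^^ N) x = x) \<and>
     (\<forall>i. coeff P i \<in> \<int>) \<and>
     (\<forall>j<N. poly (map_poly of_rat P) (exp (2 * of_real pi * \<i> / of_nat N) ^ j) =
             (of_nat (card {x \<in> X. (c ^^ j) x = x}) :: complex))"

end

theory Submission
  imports
    Defs
    "HOL-Computational_Algebra.Polynomial_FPS"
    "HOL-Combinatorics.Cycles"
    "HOL-Analysis.Complex_Transcendental"
begin

text \<open>
  The stable principal specialization \<open>x\<^sub>i = q\<^sup>i\<close>, multiplied by \<open>(1 - q) \<dots> (1 - q\<^sup>r)\<close>, is a linear map
  on symmetric functions of degree \<open>r\<close>.  By standardization it sends \<open>s\<^sub>\<mu>\<close> to the generating polynomial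
  of the statistic comaj, the sum of \<open>r - k\<close> over the descents \<open>k\<close>, over standard tableaux; at an
  \<open>r\<close>-th root of unity this is the complex conjugate of the fake degree.  It sends \<open>p\<^sub>\<mu>\<close> to
  \<open>(1 - q) \<dots> (1 - q\<^sup>r) / \<Prod>i. (1 - q ^ \<mu>\<^sub>i)\<close>, which vanishes at a root of unity of order \<open>d\<close> unless
  all parts of \<open>\<mu>\<close> are equal to \<open>d\<close>.  Hence, in the Frobenius character, only the permutations conjugate
  to the relevant power of the rotation contribute, with a total weight that does not depend on the
  representation; for the trivial one the value is 1, so the weight is 1.
\<close>

section \<open>Monomials and power sums\<close>

text \<open>\<open>schur_coeffs\<close> is a definite description, so nothing about the fake degree
  can be computed before the Schur functions are known to be a basis of the homogeneous symmetric
  functions. Uniqueness and existence of the expansion both rest on the unitriangular Kostka matrix,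
  existence also on the symmetry of Schur functions. Unitriangularity over the integers moreover
  turns integral coefficients of the Frobenius character into integral Schur coefficients, which the
  integrality clause of \<open>cyclic_sieving\<close> asks for. The quotient attached to a power sum
  takes the form 0/0 at the roots of unity where it could be nonzero. It is therefore treated as a
  polynomial with a multiplied-out identity, and only orders of vanishing are compared; its value is
  never computed. The trivial representation enters as \<open>schur [r]\<close>, whose
  specialization is the constant 1. Conjugation does no harm in the end, since a number of fixed
  points is real.\<close>

definition mweight :: "(nat \<Rightarrow> nat) \<Rightarrow> (nat \<Rightarrow>\<^sub>0 nat) \<Rightarrow> nat" where
  "mweight \<phi> m = (\<Sum>i\<in>Poly_Mapping.keys m. \<phi> i * Poly_Mapping.lookup m i)"

text \<open>\<open>mwt\<close> is the exponent of q that a monomial receives under x_i = q^i. It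
  also serves as the rank function of all triangularity arguments.\<close>

abbreviation mdeg :: "(nat \<Rightarrow>\<^sub>0 nat) \<Rightarrow> nat" where "mdeg \<equiv> mweight (\<lambda>_. 1)"
abbreviation mwt :: "(nat \<Rightarrow>\<^sub>0 nat) \<Rightarrow> nat" where "mwt \<equiv> mweight (\<lambda>i. i)"

lemma mweight_superset:
  assumes "finite A" "Poly_Mapping.keys m \<subseteq> A"
  shows "mweight \<phi> m = (\<Sum>i\<in>A. \<phi> i * Poly_Mapping.lookup m i)"
  unfolding mweight_def
  by (rule sum.mono_neutral_left) (use assms in \<open>auto simp: in_keys_iff\<close>)

lemma mweight_0 [simp]: "mweight \<phi> 0 = 0"
  by (simp add: mweight_def)

lemma mweight_single [simp]: "mweight \<phi> (Poly_Mapping.single i k) = \<phi> i * k"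
  by (subst mweight_superset[of "{i}"]) (auto simp: lookup_single)

lemma mweight_add [simp]: "mweight \<phi> (a + b) = mweight \<phi> a + mweight \<phi> b"
proof -
  let ?A = "Poly_Mapping.keys a \<union> Poly_Mapping.keys b"
  have "Poly_Mapping.keys (a + b) \<subseteq> ?A" by (rule keys_add)
  then show ?thesis
    by (simp add: mweight_superset[of ?A] lookup_add algebra_simps sum.distrib)
qed

lemma mweight_sum: "mweight \<phi> (\<Sum>a\<in>A. g a) = (\<Sum>a\<in>A. mweight \<phi> (g a))"
  by (induction A rule: infinite_finite_induct) auto

text \<open>The element \<open>a\<close> contributes the variable with index \<open>w a\<close> to
  the power \<open>k a\<close>. With \<open>k\<close> constantly 1 this is the content of a word or
  a tableau; with cycle lengths for \<open>k\<close> it is a monomial of a product of power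
  sums.\<close>

definition content_of :: "'a set \<Rightarrow> ('a \<Rightarrow> nat) \<Rightarrow> ('a \<Rightarrow> nat) \<Rightarrow> (nat \<Rightarrow>\<^sub>0 nat)" where
  "content_of A k w = (\<Sum>a\<in>A. Poly_Mapping.single (w a) (k a))"

lemma lookup_content:
  assumes "finite A"
  shows "Poly_Mapping.lookup (content_of A (\<lambda>_. 1) w) i = card {a \<in> A. w a = i}"
  using assms unfolding content_of_def
  by (simp add: lookup_sum lookup_single when_def sum.If_cases Int_def)

lemma mweight_content: "mweight \<phi> (content_of A k w) = (\<Sum>a\<in>A. \<phi> (w a) * k a)"
  by (simp add: content_of_def mweight_sum)

lemma content_cong:
  "(\<And>a. a \<in> A \<Longrightarrow> w a = w' a) \<Longrightarrow> (\<And>a. a \<in> A \<Longrightarrow> k a = k' a) \<Longrightarrow> content_of A k w = content_of A k' w'"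
  by (simp add: content_of_def)

lemma finite_below: "finite {a :: nat \<Rightarrow>\<^sub>0 nat. \<forall>i. Poly_Mapping.lookup a i \<le> Poly_Mapping.lookup m i}"
  (is "finite ?S")
proof -
  have "Poly_Mapping.lookup ` ?S \<subseteq>
      {f. (\<forall>i\<in>Poly_Mapping.keys m. f i \<in> {..mdeg m}) \<and> (\<forall>i. i \<notin> Poly_Mapping.keys m \<longrightarrow> f i = 0)}"
  proof clarify
    fix a :: "nat \<Rightarrow>\<^sub>0 nat" assume a: "\<forall>i. Poly_Mapping.lookup a i \<le> Poly_Mapping.lookup m i"
    have "Poly_Mapping.lookup m i \<le> mdeg m" if "i \<in> Poly_Mapping.keys m" for i
      unfolding mweight_def using member_le_sum[of i "Poly_Mapping.keys m" "\<lambda>i. 1 * Poly_Mapping.lookup m i"] that by simp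
    with a show "(\<forall>i\<in>Poly_Mapping.keys m. Poly_Mapping.lookup a i \<in> {..mdeg m}) \<and>
      (\<forall>i. i \<notin> Poly_Mapping.keys m \<longrightarrow> Poly_Mapping.lookup a i = 0)"
      by (auto simp: in_keys_iff) (meson le_trans a, metis le_zero_eq)
  qed
  moreover have "finite {f. (\<forall>i\<in>Poly_Mapping.keys m. f i \<in> {..mdeg m}) \<and> (\<forall>i. i \<notin> Poly_Mapping.keys m \<longrightarrow> f i = (0::nat))}"
    by (rule finite_subset[OF _ finite_set_of_finite_funs[of "Poly_Mapping.keys m" "{..mdeg m}" 0]]) auto
  ultimately have "finite (Poly_Mapping.lookup ` ?S)" by (rule finite_subset)
  then show ?thesis by (rule finite_imageD) (auto intro: inj_onI simp: lookup_inject)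
qed

text \<open>The first summand determines the second. Finiteness matters because the sum in
  \<open>series_mult\<close> would be 0 over an infinite set.\<close>

lemma finite_splittings: "finite {(a, b :: nat \<Rightarrow>\<^sub>0 nat). a + b = m}"
proof -
  have "{(a, b). a + b = m} \<subseteq> (\<lambda>a. (a, m - a)) ` {a. \<forall>i. Poly_Mapping.lookup a i \<le> Poly_Mapping.lookup m i}"
    by (auto simp: lookup_add image_iff)
  then show ?thesis using finite_below finite_subset by blast
qed

text \<open>A word records which variable is chosen from each factor when a product of power sums,
  indexed by \<open>A\<close>, is expanded.\<close>

definition words :: "'a set \<Rightarrow> ('a \<Rightarrow> nat) \<Rightarrow> (nat \<Rightarrow>\<^sub>0 nat) \<Rightarrow> ('a \<Rightarrow> nat) set" where
  "words A k m = {w \<in> A \<rightarrow>\<^sub>E UNIV. content_of A k w = m}"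

lemma finite_words:
  assumes "finite A" "\<And>a. a \<in> A \<Longrightarrow> k a > 0"
  shows "finite (words A k m)"
proof -
  have "words A k m \<subseteq> A \<rightarrow>\<^sub>E Poly_Mapping.keys m"
  proof
    fix w assume w: "w \<in> words A k m"
    have "w a \<in> Poly_Mapping.keys m" if "a \<in> A" for a
    proof -
      have "k a \<le> (\<Sum>b\<in>A. Poly_Mapping.lookup (Poly_Mapping.single (w b) (k b)) (w a))"
        using member_le_sum[of a A "\<lambda>b. Poly_Mapping.lookup (Poly_Mapping.single (w b) (k b)) (w a)"] that assms
        by simp
      also have "\<dots> = Poly_Mapping.lookup m (w a)"
        using w by (auto simp: words_def content_of_def lookup_sum)
      finally show ?thesis using assms(2)[OF that] by (simp add: in_keys_iff)
    qed
    with w show "w \<in> A \<rightarrow>\<^sub>E Poly_Mapping.keys m" by (auto simp: words_def PiE_def)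
  qed
  then show ?thesis using assms(1) by (meson finite_PiE finite_keys finite_subset)
qed

text \<open>Expanding the product means choosing one variable from each factor. The distinct labels
  \<open>xs\<close> keep factors with equal exponents apart.\<close>

lemma power_sum_partition_eq_card_words:
  assumes "distinct xs" "\<And>x. x \<in> set xs \<Longrightarrow> k x > 0"
  shows "power_sum_partition (map k xs) m = of_nat (card (words (set xs) k m))"
  using assms
proof (induction xs arbitrary: m)
  case Nil
  have "words {} k m = (if m = 0 then {\<lambda>_. undefined} else {})"
    by (auto simp: words_def content_of_def)
  then show ?case by (simp add: power_sum_partition_def series_one_def)
next
  case (Cons x xs)
  let ?D = "{(a, b). a + b = m}"
  let ?D' = "{(a, b). a + b = m \<and> (\<exists>i. a = Poly_Mapping.single i (k x))}"
  have fin: "finite ?D'" by (rule finite_subset[OF _ finite_splittings[of m]]) auto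
  have kx: "k x > 0" using Cons.prems by simp
  have "power_sum_partition (map k (x # xs)) m =
      (\<Sum>(a, b)\<in>?D. power_sum (k x) a * power_sum_partition (map k xs) b)"
    by (simp add: power_sum_partition_def series_mult_def)
  also have "\<dots> = (\<Sum>(a, b)\<in>?D. power_sum (k x) a * of_nat (card (words (set xs) k b)))"
    using Cons by (intro sum.cong) auto
  also have "\<dots> = (\<Sum>(a, b)\<in>?D'. of_nat (card (words (set xs) k b)))"
    by (rule sum.mono_neutral_cong_right[OF finite_splittings]) (auto simp: power_sum_def split: if_splits)
  also have "\<dots> = of_nat (\<Sum>p\<in>?D'. card (words (set xs) k (snd p)))"
    by (simp add: case_prod_unfold)
  also have "(\<Sum>p\<in>?D'. card (words (set xs) k (snd p))) = card (SIGMA p:?D'. words (set xs) k (snd p))"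
    using fin Cons.prems by (subst card_SigmaI) (auto intro!: finite_words)
  also have "card (SIGMA p:?D'. words (set xs) k (snd p)) = card (words (set (x # xs)) k m)"
  proof (rule sym, rule bij_betw_same_card)
    let ?f = "\<lambda>w. ((Poly_Mapping.single (w x) (k x), content_of (set xs) k w), restrict w (set xs))"
    have x: "x \<notin> set xs" using Cons.prems by simp
    show "bij_betw ?f (words (set (x # xs)) k m) (SIGMA p:?D'. words (set xs) k (snd p))"
    proof (intro bij_betwI')
      fix w w' assume w: "w \<in> words (set (x # xs)) k m" and w': "w' \<in> words (set (x # xs)) k m"
      show "(?f w = ?f w') = (w = w')"
      proof
        assume eq: "?f w = ?f w'"
        \<comment> \<open>\<open>Poly_Mapping.single i 0\<close> is 0 for every \<open>i\<close>, so
          the index can be read off only because \<open>k x > 0\<close>.\<close>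
        then have "w x = w' x" using kx
          by (metis fst_conv lookup_single_eq lookup_single_not_eq nat_neq_iff)
        moreover have "w a = w' a" if "a \<in> set xs" for a
          using eq that by (metis restrict_apply' snd_conv)
        ultimately show "w = w'" using w w'
          by (intro PiE_ext[of w "set (x # xs)" "\<lambda>_. UNIV"]) (auto simp: words_def)
      qed simp
    next
      fix w assume "w \<in> words (set (x # xs)) k m"
      then show "?f w \<in> (SIGMA p:?D'. words (set xs) k (snd p))"
        using x by (auto simp: words_def content_of_def)
    next
      fix y assume "y \<in> (SIGMA p:?D'. words (set xs) k (snd p))"
      then obtain i b v where y: "y = ((Poly_Mapping.single i (k x), b), v)"
        "Poly_Mapping.single i (k x) + b = m" "v \<in> words (set xs) k b" by auto
      let ?w = "v(x := i)"
      have c: "content_of (set xs) k ?w = b"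
        using y(3) x unfolding words_def by (auto simp: content_of_def intro!: sum.cong)
      moreover have "restrict ?w (set xs) = v" using y(3) x by (auto simp: words_def restrict_def fun_eq_iff PiE_iff extensional_def)
      moreover have "?w \<in> words (set (x # xs)) k m"
        using y c x unfolding words_def by (auto simp: content_of_def PiE_iff extensional_def)
      ultimately show "\<exists>w\<in>words (set (x # xs)) k m. y = ?f w" using y by (intro bexI[of _ ?w]) auto
    qed
  qed
  finally show ?case .
qed

section \<open>Weighted sums and geometric series\<close>

definition sum_words :: "'a set \<Rightarrow> ('a \<Rightarrow> nat) \<Rightarrow> nat \<Rightarrow> ('a \<Rightarrow> nat) set" where
  "sum_words A k n = {w \<in> A \<rightarrow>\<^sub>E UNIV. (\<Sum>a\<in>A. w a * k a) = n}"

lemma finite_sum_words: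
  assumes "finite A" "\<And>a. a \<in> A \<Longrightarrow> k a > 0"
  shows "finite (sum_words A k n)"
proof -
  have "sum_words A k n \<subseteq> A \<rightarrow>\<^sub>E {..n}"
  proof
    fix w assume w: "w \<in> sum_words A k n"
    have "w a \<le> n" if "a \<in> A" for a
    proof -
      have "w a \<le> w a * k a" using assms(2)[OF that] by (cases "k a") auto
      also have "\<dots> \<le> n" using w member_le_sum[of a A "\<lambda>a. w a * k a"] that assms(1)
        by (auto simp: sum_words_def)
      finally show ?thesis .
    qed
    with w show "w \<in> A \<rightarrow>\<^sub>E {..n}" by (auto simp: sum_words_def PiE_def)
  qed
  then show ?thesis using assms(1) by (meson finite_PiE finite_atMost finite_subset)
qed

text \<open>A product of geometric series, written without division. Multiplying by the factor of
  the new letter \<open>x\<close> removes it: words with \<open>w x > 0\<close> correspond, by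
  lowering \<open>w x\<close> by one, to words of total \<open>n - k x\<close>.\<close>

lemma fps_sum_words:
  assumes "finite A" "\<And>a. a \<in> A \<Longrightarrow> k a > 0"
  shows "Abs_fps (\<lambda>n. of_nat (card (sum_words A k n))) * (\<Prod>a\<in>A. 1 - fps_X ^ k a) = (1 :: rat fps)"
  using assms
proof (induction A rule: finite_induct)
  case empty
  have "sum_words {} k n = (if n = 0 then {\<lambda>_. undefined} else {})" for n
    by (auto simp: sum_words_def)
  then show ?case by (simp add: fps_eq_iff)
next
  case (insert x A)
  have kx: "k x > 0" using insert by simp
  have "card (sum_words (insert x A) k n) =
      card (sum_words A k n) + (if n < k x then 0 else card (sum_words (insert x A) k (n - k x)))" for n
  proof -
    let ?W = "sum_words (insert x A) k"
    have f: "finite (?W n)" for n using insert by (intro finite_sum_words) auto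
    have split: "?W n = {w \<in> ?W n. w x = 0} \<union> {w \<in> ?W n. w x > 0}" by auto
    have "card (?W n) = card {w \<in> ?W n. w x = 0} + card {w \<in> ?W n. w x > 0}"
      by (subst split, subst card_Un_disjoint) (use f in auto)
    moreover have "card {w \<in> ?W n. w x = 0} = card (sum_words A k n)"
    proof (rule bij_betw_same_card)
      show "bij_betw (\<lambda>w. restrict w A) {w \<in> ?W n. w x = 0} (sum_words A k n)"
      proof (rule bij_betw_byWitness[where f' = "\<lambda>w. w(x := 0)"])
        show "\<forall>w\<in>{w \<in> ?W n. w x = 0}. (restrict w A)(x := 0) = w"
          using insert by (auto simp: sum_words_def fun_eq_iff PiE_iff extensional_def)
        show "\<forall>w\<in>sum_words A k n. restrict (w(x := 0)) A = w"
          using insert by (auto simp: sum_words_def fun_eq_iff PiE_iff extensional_def)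
        show "(\<lambda>w. restrict w A) ` {w \<in> ?W n. w x = 0} \<subseteq> sum_words A k n"
          using insert by (auto simp: sum_words_def)
        show "(\<lambda>w. w(x := 0)) ` sum_words A k n \<subseteq> {w \<in> ?W n. w x = 0}"
        proof clarify
          fix w assume w: "w \<in> sum_words A k n"
          have "(\<Sum>a\<in>A. (if a = x then 0 else w a) * k a) = (\<Sum>a\<in>A. w a * k a)"
            using insert by (intro sum.cong) auto
          then show "w(x := 0) \<in> ?W n \<and> (w(x := 0)) x = 0"
            using w insert by (auto simp: sum_words_def PiE_iff extensional_def)
        qed
      qed
    qed
    moreover have "card {w \<in> ?W n. w x > 0} = (if n < k x then 0 else card (?W (n - k x)))"
    proof (cases "n < k x")
      case True
      have False if "w \<in> ?W n" "w x > 0" for w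
      proof -
        have "k x \<le> w x * k x" using that by (cases "w x") auto
        also have "\<dots> \<le> n" using that insert by (auto simp: sum_words_def)
        finally show False using True by simp
      qed
      then have "{w \<in> ?W n. w x > 0} = {}" by auto
      then show ?thesis using True by (metis card.empty)
    next
      case False
      have "bij_betw (\<lambda>w. w(x := w x - 1)) {w \<in> ?W n. w x > 0} (?W (n - k x))"
      proof (rule bij_betw_byWitness[where f' = "\<lambda>w. w(x := w x + 1)"])
        have e: "(\<Sum>a\<in>A. (w(x := y)) a * k a) = (\<Sum>a\<in>A. w a * k a)" for w :: "'a \<Rightarrow> nat" and y
          using insert by (intro sum.cong) auto
        have e': "w x * k x = k x + (w x - 1) * k x" if "w x > 0" for w :: "'a \<Rightarrow> nat"
          using that by (cases "w x") auto
        show "(\<lambda>w. w(x := w x - 1)) ` {w \<in> ?W n. w x > 0} \<subseteq> ?W (n - k x)"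
        proof clarify
          fix w assume w: "w \<in> ?W n" "w x > 0"
          then show "w(x := w x - 1) \<in> ?W (n - k x)"
            using insert e[of w] e'[of w] by (auto simp: sum_words_def PiE_iff extensional_def simp del: fun_upd_apply) auto
        qed
        show "(\<lambda>w. w(x := w x + 1)) ` ?W (n - k x) \<subseteq> {w \<in> ?W n. w x > 0}"
        proof clarify
          fix w assume w: "w \<in> ?W (n - k x)"
          then show "w(x := w x + 1) \<in> ?W n \<and> 0 < (w(x := w x + 1)) x"
            using insert e[of w] False by (auto simp: sum_words_def PiE_iff extensional_def simp del: fun_upd_apply) auto
        qed
      qed auto
      with False show ?thesis by (simp add: bij_betw_same_card)
    qed
    ultimately show ?thesis by simp
  qed
  then have "Abs_fps (\<lambda>n. of_nat (card (sum_words (insert x A) k n))) * (1 - fps_X ^ k x) =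
      (Abs_fps (\<lambda>n. of_nat (card (sum_words A k n))) :: rat fps)"
    by (auto simp: fps_eq_iff algebra_simps fps_X_power_mult_nth)
  then show ?case using insert by (simp add: mult.assoc[symmetric])
qed

section \<open>The stable principal specialization\<close>

definition graded :: "nat \<Rightarrow> nat \<Rightarrow> (nat \<Rightarrow>\<^sub>0 nat) set" where
  "graded r n = {m. mdeg m = r \<and> mwt m = n}"

lemma finite_graded: "finite (graded r n)"
proof -
  have "Poly_Mapping.lookup ` graded r n \<subseteq> {f. (\<forall>i\<in>{..n}. f i \<in> {..r}) \<and> (\<forall>i. i \<notin> {..n} \<longrightarrow> f i = 0)}"
  proof clarify
    fix m assume m: "m \<in> graded r n"
    have 1: "Poly_Mapping.lookup m i \<le> r" for i
      using m member_le_sum[of i "Poly_Mapping.keys m" "\<lambda>i. 1 * Poly_Mapping.lookup m i"]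
      by (cases "i \<in> Poly_Mapping.keys m") (auto simp: graded_def mweight_def in_keys_iff)
    have "i * Poly_Mapping.lookup m i \<le> n" for i
      using m member_le_sum[of i "Poly_Mapping.keys m" "\<lambda>i. i * Poly_Mapping.lookup m i"]
      by (cases "i \<in> Poly_Mapping.keys m") (auto simp: graded_def mweight_def in_keys_iff)
    then have "Poly_Mapping.lookup m i = 0" if "i > n" for i
      using that by (metis (no_types, lifting) mult.commute mult_le_mono1 nat_mult_1 not_le
          One_nat_def Suc_leI le_trans neq0_conv)
    with 1 show "(\<forall>i\<in>{..n}. Poly_Mapping.lookup m i \<in> {..r}) \<and>
        (\<forall>i. i \<notin> {..n} \<longrightarrow> Poly_Mapping.lookup m i = 0)" by auto
  qed
  moreover have "finite {f. (\<forall>i\<in>{..n}. f i \<in> {..r}) \<and> (\<forall>i. i \<notin> {..n} \<longrightarrow> f i = (0::nat))}"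
    by (rule finite_subset[OF _ finite_set_of_finite_funs[of "{..n}" "{..r}" 0]]) auto
  ultimately have "finite (Poly_Mapping.lookup ` graded r n)" by (rule finite_subset)
  then show ?thesis by (rule finite_imageD) (auto intro: inj_onI simp: lookup_inject)
qed

text \<open>For \<open>f\<close> homogeneous of degree \<open>r\<close> this is f(1, q, q^2, ...).
  Fixing the degree keeps the sums finite: x_0 has weight 0, so infinitely many monomials share a
  weight.\<close>

definition principal_spec :: "nat \<Rightarrow> series \<Rightarrow> rat fps" where
  "principal_spec r f = Abs_fps (\<lambda>n. \<Sum>m\<in>graded r n. f m)"

lemma sum_card_fibres:
  assumes "finite M" "\<And>m. m \<in> M \<Longrightarrow> finite {w \<in> W. g w = m}"
  shows "(\<Sum>m\<in>M. card {w \<in> W. g w = m}) = card {w \<in> W. g w \<in> M}"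
proof -
  have "{w \<in> W. g w \<in> M} = (\<Union>m\<in>M. {w \<in> W. g w = m})" by auto
  then show ?thesis using assms by (auto simp: card_UN_disjoint intro!: card_UN_disjoint[symmetric])
qed

lemma principal_spec_words:
  assumes "finite A" "\<And>a. a \<in> A \<Longrightarrow> k a > 0" "(\<Sum>a\<in>A. k a) = r"
  shows "principal_spec r (\<lambda>m. of_nat (card (words A k m))) * (\<Prod>a\<in>A. 1 - fps_X ^ k a) = 1"
proof -
  have "(\<Sum>m\<in>graded r n. card (words A k m)) = card (sum_words A k n)" for n
  proof -
    have "(\<Sum>m\<in>graded r n. card (words A k m)) = card {w \<in> A \<rightarrow>\<^sub>E UNIV. content_of A k w \<in> graded r n}"
      unfolding words_def
      by (rule sum_card_fibres) (use finite_graded finite_words[OF assms(1,2)] in \<open>auto simp: words_def\<close>)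
    also have "{w \<in> A \<rightarrow>\<^sub>E UNIV. content_of A k w \<in> graded r n} = sum_words A k n"
      using assms by (auto simp: graded_def mweight_content sum_words_def)
    finally show ?thesis .
  qed
  then have "principal_spec r (\<lambda>m. of_nat (card (words A k m))) =
      Abs_fps (\<lambda>n. of_nat (card (sum_words A k n)))"
    by (simp add: principal_spec_def flip: of_nat_sum)
  with fps_sum_words[OF assms(1,2)] show ?thesis by simp
qed


section \<open>Schur functions\<close>

lemma cells_iff [simp]: "(i, j) \<in> cells \<mu> \<longleftrightarrow> i < length \<mu> \<and> j < \<mu> ! i"
  by (simp add: cells_def)

lemma cells_eq: "cells \<mu> = (SIGMA i:{..<length \<mu>}. {..<\<mu> ! i})"
  by auto

lemma finite_cells [simp]: "finite (cells \<mu>)"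
  unfolding cells_eq by auto

lemma card_cells: "card (cells \<mu>) = sum_list \<mu>"
  unfolding cells_eq by (simp add: sum_list_sum_nth atLeast0LessThan)

lemma partitions_nth_mono:
  assumes "\<mu> \<in> partitions" "i \<le> i'" "i' < length \<mu>"
  shows "\<mu> ! i' \<le> \<mu> ! i"
  using assms by (cases "i = i'") (auto simp: partitions_def sorted_wrt_iff_nth_less)

lemma partitions_nth_pos: "\<mu> \<in> partitions \<Longrightarrow> i < length \<mu> \<Longrightarrow> \<mu> ! i > 0"
  by (auto simp: partitions_def)

lemma semistandardD_row:
  "T \<in> semistandard_tableaux \<mu> \<Longrightarrow> (i, j') \<in> cells \<mu> \<Longrightarrow> j \<le> j' \<Longrightarrow> T (i, j) \<le> T (i, j')"
  by (cases "j = j'") (auto simp: semistandard_tableaux_def)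

lemma semistandardD_col:
  assumes "\<mu> \<in> partitions" "T \<in> semistandard_tableaux \<mu>" "(i', j) \<in> cells \<mu>" "i < i'"
  shows "T (i, j) < T (i', j)"
proof -
  have "(i, j) \<in> cells \<mu>" using assms partitions_nth_mono[of \<mu> i i'] by auto
  then show ?thesis using assms unfolding semistandard_tableaux_def by blast
qed

text \<open>Strictness between adjacent rows suffices, because a partition shape contains every cell
  above one of its cells.\<close>

lemma semistandardI:
  assumes "\<mu> \<in> partitions" "T \<in> extensional (cells \<mu>)"
    and row: "\<And>i j j'. (i, j') \<in> cells \<mu> \<Longrightarrow> j < j' \<Longrightarrow> T (i, j) \<le> T (i, j')"
    and col: "\<And>i j. (Suc i, j) \<in> cells \<mu> \<Longrightarrow> T (i, j) < T (Suc i, j)"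
  shows "T \<in> semistandard_tableaux \<mu>"
proof -
  have "T (i, j) < T (i', j)" if "(i', j) \<in> cells \<mu>" "i < i'" for i i' j
    using that
  proof (induction i')
    case (Suc i')
    have "(i', j) \<in> cells \<mu>" using Suc.prems partitions_nth_mono[OF assms(1), of i' "Suc i'"] by auto
    then have "i = i' \<or> T (i, j) < T (i', j)" using Suc by (cases "i = i'") auto
    then show ?case using col[OF Suc.prems(1)] by auto
  qed simp
  then show ?thesis using assms unfolding semistandard_tableaux_def by blast
qed

text \<open>For fixed \<open>v\<close> these are the row lengths of the subtableau of entries below
  \<open>v\<close>. As \<open>v\<close> varies they form the Gelfand--Tsetlin pattern of
  \<open>T\<close>, which determines \<open>T\<close>.\<close>

definition row_count :: "nat list \<Rightarrow> (nat \<times> nat \<Rightarrow> nat) \<Rightarrow> nat \<Rightarrow> nat \<Rightarrow> nat" where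
  "row_count \<mu> T v i = card {j. (i, j) \<in> cells \<mu> \<and> T (i, j) < v}"

lemma finite_row: "finite {j. (i, j) \<in> cells \<mu> \<and> P j}"
  by (rule finite_subset[of _ "{..<\<mu> ! i}"]) auto

lemma row_count_eq_0: "i \<ge> length \<mu> \<Longrightarrow> row_count \<mu> T v i = 0"
  by (simp add: row_count_def)

lemma row_count_le: "row_count \<mu> T v i \<le> \<mu> ! i"
proof -
  have "row_count \<mu> T v i \<le> card {..<\<mu> ! i}"
    unfolding row_count_def by (rule card_mono) auto
  then show ?thesis by simp
qed

lemma row_count_mono: "v \<le> v' \<Longrightarrow> row_count \<mu> T v i \<le> row_count \<mu> T v' i"
  unfolding row_count_def by (rule card_mono[OF finite_row]) auto

lemma downclosed_eq_lessThan_card: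
  fixes S :: "nat set"
  assumes "finite S" "\<And>j j'. j' \<in> S \<Longrightarrow> j \<le> j' \<Longrightarrow> j \<in> S"
  shows "S = {..<card S}"
proof (cases "S = {}")
  case False
  have "S = {..Max S}" using assms False Max_in by auto
  then have "S = {..<Suc (Max S)}" by (simp add: lessThan_Suc_atMost)
  then show ?thesis by (metis card_lessThan)
qed simp

lemma row_eq_lessThan:
  assumes "T \<in> semistandard_tableaux \<mu>"
  shows "{j. (i, j) \<in> cells \<mu> \<and> T (i, j) < v} = {..<row_count \<mu> T v i}"
  unfolding row_count_def
  by (rule downclosed_eq_lessThan_card[OF finite_row])
    (use semistandardD_row[OF assms] in \<open>fastforce dest: le_less_trans\<close>)

lemma less_iff_row_count:
  assumes "T \<in> semistandard_tableaux \<mu>" "(i, j) \<in> cells \<mu>"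
  shows "T (i, j) < v \<longleftrightarrow> j < row_count \<mu> T v i"
  using row_eq_lessThan[OF assms(1), of i v] assms(2) by blast

text \<open>The cell directly above an entry smaller than \<open>Suc v\<close> holds an entry
  smaller than \<open>v\<close>.\<close>

lemma row_count_interlace:
  assumes "\<mu> \<in> partitions" "T \<in> semistandard_tableaux \<mu>"
  shows "row_count \<mu> T (Suc v) (Suc i) \<le> row_count \<mu> T v i"
  unfolding row_count_def
proof (rule card_mono[OF finite_row], safe)
  fix j assume *: "(Suc i, j) \<in> cells \<mu>" "T (Suc i, j) < Suc v"
  show "(i, j) \<in> cells \<mu>" using * partitions_nth_mono[OF assms(1), of i "Suc i"] by auto
  show "T (i, j) < v" using semistandardD_col[OF assms *(1), of i] * by simp
qed

lemma card_less_eq_sum_row_count: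
  "card {c \<in> cells \<mu>. T c < v} = (\<Sum>i<length \<mu>. row_count \<mu> T v i)"
proof -
  have "{c \<in> cells \<mu>. T c < v} = (SIGMA i:{..<length \<mu>}. {j. (i, j) \<in> cells \<mu> \<and> T (i, j) < v})"
    by auto
  also have "card \<dots> = (\<Sum>i<length \<mu>. row_count \<mu> T v i)"
    unfolding row_count_def using finite_row by (subst card_SigmaI) auto
  finally show ?thesis .
qed

lemma card_eq_diff_row_count:
  "card {c \<in> cells \<mu>. T c = v} = (\<Sum>i<length \<mu>. row_count \<mu> T (Suc v) i) - (\<Sum>i<length \<mu>. row_count \<mu> T v i)"
proof -
  have "{c \<in> cells \<mu>. T c < Suc v} = {c \<in> cells \<mu>. T c < v} \<union> {c \<in> cells \<mu>. T c = v}" by auto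
  then have "card {c \<in> cells \<mu>. T c < Suc v} = card {c \<in> cells \<mu>. T c < v} + card {c \<in> cells \<mu>. T c = v}"
    by (simp add: card_Un_disjoint disjoint_iff)
  then show ?thesis by (simp add: card_less_eq_sum_row_count)
qed

text \<open>
  The Bender--Knuth involution in terms of Gelfand--Tsetlin patterns: the entries of the middle row
  range over independent intervals \<open>[bk_lo, bk_hi]\<close> determined by the two adjacent rows, and each
  is reflected in its interval.
\<close>

definition bk_lo :: "nat list \<Rightarrow> nat \<Rightarrow> (nat \<times> nat \<Rightarrow> nat) \<Rightarrow> nat \<Rightarrow> nat" where
  "bk_lo \<mu> k T i = max (row_count \<mu> T k i) (row_count \<mu> T (Suc (Suc k)) (Suc i))"

definition bk_hi :: "nat list \<Rightarrow> nat \<Rightarrow> (nat \<times> nat \<Rightarrow> nat) \<Rightarrow> nat \<Rightarrow> nat" where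
  "bk_hi \<mu> k T i = (if i = 0 then row_count \<mu> T (Suc (Suc k)) 0
     else min (row_count \<mu> T (Suc (Suc k)) i) (row_count \<mu> T k (i - 1)))"

definition bk_row :: "nat list \<Rightarrow> nat \<Rightarrow> (nat \<times> nat \<Rightarrow> nat) \<Rightarrow> nat \<Rightarrow> nat" where
  "bk_row \<mu> k T i = bk_lo \<mu> k T i + bk_hi \<mu> k T i - row_count \<mu> T (Suc k) i"

text \<open>The tableau whose pattern is that of \<open>T\<close> with row \<open>Suc k\<close>
  replaced by \<open>bk_row\<close>: in each row of the tableau only the border between the entries
  \<open>k\<close> and the entries \<open>Suc k\<close> moves.\<close>

definition bender_knuth :: "nat list \<Rightarrow> nat \<Rightarrow> (nat \<times> nat \<Rightarrow> nat) \<Rightarrow> nat \<times> nat \<Rightarrow> nat" where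
  "bender_knuth \<mu> k T = (\<lambda>c\<in>cells \<mu>.
     if snd c < row_count \<mu> T k (fst c) then T c
     else if snd c < bk_row \<mu> k T (fst c) then k
     else if snd c < row_count \<mu> T (Suc (Suc k)) (fst c) then Suc k
     else T c)"

context
  fixes \<mu> T and k :: nat
  assumes \<mu>: "\<mu> \<in> partitions" and T: "T \<in> semistandard_tableaux \<mu>"
begin

lemma bk_bounds:
  "bk_lo \<mu> k T i \<le> row_count \<mu> T (Suc k) i" "row_count \<mu> T (Suc k) i \<le> bk_hi \<mu> k T i"
  using row_count_interlace[OF \<mu> T, of "Suc k" i] row_count_interlace[OF \<mu> T, of k "i - 1"]
  by (auto simp: bk_lo_def bk_hi_def row_count_mono)

lemma bk_row_bounds: "bk_lo \<mu> k T i \<le> bk_row \<mu> k T i" "bk_row \<mu> k T i \<le> bk_hi \<mu> k T i"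
  using bk_bounds[of i] by (auto simp: bk_row_def)

text \<open>The interlacing conditions between the reflected row and its two unchanged neighbours;
  they are what makes the new filling column strict.\<close>

lemma bk_row_between:
  "row_count \<mu> T k i \<le> bk_row \<mu> k T i" "row_count \<mu> T (Suc (Suc k)) (Suc i) \<le> bk_row \<mu> k T i"
  "bk_row \<mu> k T i \<le> row_count \<mu> T (Suc (Suc k)) i" "bk_row \<mu> k T (Suc i) \<le> row_count \<mu> T k i"
  using bk_row_bounds[of i] bk_row_bounds[of "Suc i"] by (auto simp: bk_lo_def bk_hi_def split: if_splits)

lemma bender_knuth_eq:
  assumes "(i, j) \<in> cells \<mu>"
  shows "bender_knuth \<mu> k T (i, j) = (if j < row_count \<mu> T k i then T (i, j)
     else if j < bk_row \<mu> k T i then k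
     else if j < row_count \<mu> T (Suc (Suc k)) i then Suc k
     else T (i, j))"
  using assms by (simp add: bender_knuth_def)

lemma bender_knuth_cases:
  assumes "(i, j) \<in> cells \<mu>"
  obtains "j < row_count \<mu> T k i" "T (i, j) < k" "bender_knuth \<mu> k T (i, j) = T (i, j)"
  | "row_count \<mu> T k i \<le> j" "j < bk_row \<mu> k T i" "j < row_count \<mu> T (Suc (Suc k)) i"
      "bender_knuth \<mu> k T (i, j) = k" "k \<le> T (i, j)" "T (i, j) < Suc (Suc k)"
  | "row_count \<mu> T k i \<le> j" "bk_row \<mu> k T i \<le> j" "j < row_count \<mu> T (Suc (Suc k)) i"
      "bender_knuth \<mu> k T (i, j) = Suc k" "k \<le> T (i, j)" "T (i, j) < Suc (Suc k)"
  | "row_count \<mu> T (Suc (Suc k)) i \<le> j" "bk_row \<mu> k T i \<le> j" "Suc (Suc k) \<le> T (i, j)"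
      "bender_knuth \<mu> k T (i, j) = T (i, j)" "row_count \<mu> T k i \<le> j"
proof -
  have "row_count \<mu> T k i \<le> row_count \<mu> T (Suc (Suc k)) i" by (simp add: row_count_mono)
  then show ?thesis
    using that bender_knuth_eq[OF assms] bk_row_between[of i] assms
      less_iff_row_count[OF T assms, of k] less_iff_row_count[OF T assms, of "Suc (Suc k)"]
    by (smt (verit) leI le_trans not_le)
qed

lemma bender_knuth_semistandard: "bender_knuth \<mu> k T \<in> semistandard_tableaux \<mu>"
proof (rule semistandardI[OF \<mu>])
  fix i j j' assume c: "(i, j') \<in> cells \<mu>" "j < j'"
  then have c': "(i, j) \<in> cells \<mu>" by auto
  have "T (i, j) \<le> T (i, j')" using semistandardD_row[OF T c(1)] c(2) by simp
  then show "bender_knuth \<mu> k T (i, j) \<le> bender_knuth \<mu> k T (i, j')"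
    using c(2) by (cases rule: bender_knuth_cases[OF c(1)]; cases rule: bender_knuth_cases[OF c']) auto
next
  fix i j assume c: "(Suc i, j) \<in> cells \<mu>"
  then have c': "(i, j) \<in> cells \<mu>" using partitions_nth_mono[OF \<mu>, of i "Suc i"] by auto
  have "T (i, j) < T (Suc i, j)" using semistandardD_col[OF \<mu> T c] by simp
  then show "bender_knuth \<mu> k T (i, j) < bender_knuth \<mu> k T (Suc i, j)"
    using bk_row_between[of i]
    by (cases rule: bender_knuth_cases[OF c]; cases rule: bender_knuth_cases[OF c']) auto
qed (simp add: bender_knuth_def)

lemma row_count_bender_knuth:
  "row_count \<mu> (bender_knuth \<mu> k T) v i = (if v = Suc k \<and> i < length \<mu> then bk_row \<mu> k T i else row_count \<mu> T v i)"
proof (cases "v = Suc k \<and> i < length \<mu>")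
  case True
  have "j < \<mu> ! i" if "j < bk_row \<mu> k T i" for j
    using that bk_row_between(3)[of i] row_count_le[of \<mu> T "Suc (Suc k)" i] by simp
  moreover have "bender_knuth \<mu> k T (i, j) < Suc k \<longleftrightarrow> j < bk_row \<mu> k T i" if "(i, j) \<in> cells \<mu>" for j
    using bk_row_between(1)[of i] by (cases rule: bender_knuth_cases[OF that]) auto
  ultimately have "{j. (i, j) \<in> cells \<mu> \<and> bender_knuth \<mu> k T (i, j) < Suc k} = {..<bk_row \<mu> k T i}"
    using True by auto
  then show ?thesis using True by (simp add: row_count_def)
next
  case False
  have "bender_knuth \<mu> k T (i, j) < v \<longleftrightarrow> T (i, j) < v" if "(i, j) \<in> cells \<mu>" for j
    using False that by (cases rule: bender_knuth_cases[OF that]) auto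
  then have "{j. (i, j) \<in> cells \<mu> \<and> bender_knuth \<mu> k T (i, j) < v} = {j. (i, j) \<in> cells \<mu> \<and> T (i, j) < v}"
    by blast
  then show ?thesis using False by (auto simp: row_count_def)
qed

end

text \<open>The neighbouring rows of the pattern are unchanged, so \<open>T\<close> and its image
  have the same intervals, and reflecting twice is the identity.\<close>

lemma bender_knuth_involution:
  assumes \<mu>: "\<mu> \<in> partitions" and T: "T \<in> semistandard_tableaux \<mu>"
  shows "bender_knuth \<mu> k (bender_knuth \<mu> k T) = T"
proof -
  let ?U = "bender_knuth \<mu> k T"
  have U: "?U \<in> semistandard_tableaux \<mu>" by (rule bender_knuth_semistandard[OF \<mu> T])
  have "bender_knuth \<mu> k ?U (i, j) = T (i, j)" if c: "(i, j) \<in> cells \<mu>" for i j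
  proof -
    have rc: "row_count \<mu> ?U k i = row_count \<mu> T k i" "row_count \<mu> ?U (Suc (Suc k)) i = row_count \<mu> T (Suc (Suc k)) i" for i
      by (simp_all add: row_count_bender_knuth[OF \<mu> T])
    have "bk_row \<mu> k ?U i = row_count \<mu> T (Suc k) i"
      using c bk_bounds[OF \<mu> T, of k i] unfolding bk_row_def bk_lo_def bk_hi_def rc
      by (simp add: row_count_bender_knuth[OF \<mu> T] bk_row_def bk_lo_def bk_hi_def)
    then show ?thesis
      using less_iff_row_count[OF T c, of "Suc k"] rc[of i]
      by (cases rule: bender_knuth_cases[OF \<mu> U c, of k]; cases rule: bender_knuth_cases[OF \<mu> T c, of k]) auto
  qed
  moreover have "bender_knuth \<mu> k ?U \<in> extensional (cells \<mu>)" "T \<in> extensional (cells \<mu>)"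
    using T by (auto simp: bender_knuth_def semistandard_tableaux_def)
  ultimately show ?thesis by (intro extensionalityI[of _ "cells \<mu>"]) auto
qed

text \<open>The maximum at index \<open>i\<close> and the minimum at index \<open>Suc i\<close>
  involve the same two numbers and add up to their sum. The separate minimum completes the last
  pair.\<close>

lemma sum_max_min_telescope:
  fixes a b :: "nat \<Rightarrow> nat"
  shows "(\<Sum>i<Suc l. max (a i) (b (Suc i)) + (if i = 0 then b 0 else min (b i) (a (i - 1)))) + min (b (Suc l)) (a l)
    = (\<Sum>i<Suc l. a i) + (\<Sum>i<Suc (Suc l). b i)"
proof (induction l)
  case (Suc l)
  have "max x y + min y x = x + y" for x y :: nat by (simp add: max_def min_def)
  from this[of "a (Suc l)" "b (Suc (Suc l))"] Suc show ?case by simp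
qed auto

text \<open>Rearranged, the new number of entries \<open>k\<close> equals the old number of entries
  \<open>Suc k\<close>. This is why the involution exchanges the two exponents.\<close>

lemma sum_bk_row:
  assumes \<mu>: "\<mu> \<in> partitions" and T: "T \<in> semistandard_tableaux \<mu>"
  shows "(\<Sum>i<length \<mu>. bk_row \<mu> k T i) + (\<Sum>i<length \<mu>. row_count \<mu> T (Suc k) i) =
    (\<Sum>i<length \<mu>. row_count \<mu> T k i) + (\<Sum>i<length \<mu>. row_count \<mu> T (Suc (Suc k)) i)"
proof (cases "length \<mu>")
  case (Suc l)
  have "bk_row \<mu> k T i + row_count \<mu> T (Suc k) i = bk_lo \<mu> k T i + bk_hi \<mu> k T i" for i
    using bk_bounds[OF \<mu> T, of k i] by (simp add: bk_row_def)
  \<comment> \<open>The added minimum is 0, since row \<open>Suc l\<close> lies outside the shape.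
    It is there to match the telescoping sum.\<close>
  then have "(\<Sum>i<length \<mu>. bk_row \<mu> k T i) + (\<Sum>i<length \<mu>. row_count \<mu> T (Suc k) i) =
      (\<Sum>i<Suc l. bk_lo \<mu> k T i + bk_hi \<mu> k T i) + min (row_count \<mu> T (Suc (Suc k)) (Suc l)) (row_count \<mu> T k l)"
    using Suc by (simp add: row_count_eq_0 flip: sum.distrib del: sum.lessThan_Suc)
  also have "\<dots> = (\<Sum>i<Suc l. row_count \<mu> T k i) + (\<Sum>i<Suc (Suc l). row_count \<mu> T (Suc (Suc k)) i)"
    unfolding bk_lo_def bk_hi_def by (rule sum_max_min_telescope)
  finally show ?thesis using Suc by (simp add: row_count_eq_0)
qed simp

section \<open>Symmetry of Schur functions\<close>

definition swap_vars :: "nat \<Rightarrow> (nat \<Rightarrow>\<^sub>0 nat) \<Rightarrow> (nat \<Rightarrow>\<^sub>0 nat)" where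
  "swap_vars k m = Poly_Mapping.map_key (Transposition.transpose k (Suc k)) m"

lemma lookup_swap_vars: "Poly_Mapping.lookup (swap_vars k m) i = Poly_Mapping.lookup m (Transposition.transpose k (Suc k) i)"
  by (simp add: swap_vars_def map_key.rep_eq)

lemma swap_vars_swap_vars [simp]: "swap_vars k (swap_vars k m) = m"
  by (rule poly_mapping_eqI) (simp add: lookup_swap_vars)

lemma schur_eq_card_content:
  "schur \<mu> m = of_nat (card {T \<in> semistandard_tableaux \<mu>. content_of (cells \<mu>) (\<lambda>_. 1) T = m})"
  unfolding schur_def
  by (intro arg_cong[where f = of_nat] arg_cong[where f = card] Collect_cong conj_cong refl)
    (auto simp: poly_mapping_eq_iff fun_eq_iff lookup_content[OF finite_cells, simplified])

lemma content_bender_knuth: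
  assumes \<mu>: "\<mu> \<in> partitions" and T: "T \<in> semistandard_tableaux \<mu>"
  shows "content_of (cells \<mu>) (\<lambda>_. 1) (bender_knuth \<mu> k T) = swap_vars k (content_of (cells \<mu>) (\<lambda>_. 1) T)"
proof (rule poly_mapping_eqI)
  fix v
  have "(\<Sum>i<length \<mu>. row_count \<mu> (bender_knuth \<mu> k T) v i) =
      (\<Sum>i<length \<mu>. if v = Suc k then bk_row \<mu> k T i else row_count \<mu> T v i)" for v
    by (intro sum.cong) (auto simp: row_count_bender_knuth[OF \<mu> T])
  moreover have "(\<Sum>i<length \<mu>. row_count \<mu> T v i) \<le> (\<Sum>i<length \<mu>. row_count \<mu> T (Suc v) i)" for v
    by (intro sum_mono row_count_mono) simp
  note this[of k] this[of "Suc k"]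
  ultimately show "Poly_Mapping.lookup (content_of (cells \<mu>) (\<lambda>_. 1) (bender_knuth \<mu> k T)) v =
      Poly_Mapping.lookup (swap_vars k (content_of (cells \<mu>) (\<lambda>_. 1) T)) v"
    using sum_bk_row[OF \<mu> T, of k]
    by (auto simp: lookup_swap_vars lookup_content[OF finite_cells, simplified] card_eq_diff_row_count
        Transposition.transpose_def)
qed

lemma schur_swap_vars:
  assumes "\<mu> \<in> partitions"
  shows "schur \<mu> (swap_vars k m) = schur \<mu> m"
proof -
  have "bij_betw (bender_knuth \<mu> k) {T \<in> semistandard_tableaux \<mu>. content_of (cells \<mu>) (\<lambda>_. 1) T = m}
      {T \<in> semistandard_tableaux \<mu>. content_of (cells \<mu>) (\<lambda>_. 1) T = swap_vars k m}"
    by (rule bij_betw_byWitness[where f' = "bender_knuth \<mu> k"])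
      (use assms in \<open>auto simp: bender_knuth_involution content_bender_knuth[simplified] bender_knuth_semistandard\<close>)
  then show ?thesis by (simp add: schur_eq_card_content bij_betw_same_card)
qed


section \<open>Schur functions as a basis\<close>

definition swap_symmetric :: "series \<Rightarrow> bool" where
  "swap_symmetric f \<longleftrightarrow> (\<forall>k m. f (swap_vars k m) = f m)"

definition homogeneous :: "nat \<Rightarrow> series \<Rightarrow> bool" where
  "homogeneous r f \<longleftrightarrow> (\<forall>m. f m \<noteq> 0 \<longrightarrow> mdeg m = r)"

definition partitions_of :: "nat \<Rightarrow> nat list set" where
  "partitions_of r = {\<mu> \<in> partitions. sum_list \<mu> = r}"

lemma finite_partitions_of: "finite (partitions_of r)"
proof -
  have "length \<mu> \<le> sum_list \<mu>" if "\<forall>k\<in>set \<mu>. k > 0" for \<mu> :: "nat list"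
    using that by (induction \<mu>) auto
  then have "partitions_of r \<subseteq> {\<mu>. set \<mu> \<subseteq> {..r} \<and> length \<mu> \<le> r}"
    by (auto simp: partitions_of_def partitions_def intro: member_le_sum_list)
  then show ?thesis using finite_lists_length_le[of "{..r}" r] finite_subset by blast
qed

lemma homogeneous_schur: "homogeneous (sum_list \<mu>) (schur \<mu>)"
  unfolding homogeneous_def
proof safe
  fix m assume "schur \<mu> m \<noteq> 0"
  then have "{T \<in> semistandard_tableaux \<mu>. content_of (cells \<mu>) (\<lambda>_. 1) T = m} \<noteq> {}"
    unfolding schur_eq_card_content by (rule contrapos_nn) (simp only: card.empty of_nat_0)
  then show "mdeg m = sum_list \<mu>" by (auto simp: mweight_content card_cells)
qed

abbreviation pmono :: "nat list \<Rightarrow> (nat \<Rightarrow>\<^sub>0 nat)" where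
  "pmono \<equiv> Poly_Mapping.nth"

text \<open>\<open>pmono\<close> forgets only trailing zeros, and the parts of a partition are
  positive.\<close>

lemma pmono_inj:
  assumes "\<mu> \<in> partitions" "\<nu> \<in> partitions" "pmono \<mu> = pmono \<nu>"
  shows "\<mu> = \<nu>"
proof -
  have eq: "nth_default 0 \<mu> i = nth_default 0 \<nu> i" for i using assms(3) by (metis lookup_nth)
  have "i < length \<mu> \<longleftrightarrow> i < length \<nu>" for i
    using eq[of i] partitions_nth_pos[OF assms(1), of i] partitions_nth_pos[OF assms(2), of i]
    by (auto simp: nth_default_def split: if_splits)
  then have "length \<mu> = length \<nu>" by (metis nat_neq_iff)
  moreover have "\<mu> ! i = \<nu> ! i" if "i < length \<mu>" for i
    using eq[of i] that \<open>length \<mu> = length \<nu>\<close> by (simp add: nth_default_def)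
  ultimately show ?thesis by (rule nth_equalityI)
qed

lemma ex_partition_of_decreasing:
  assumes "\<And>i. Poly_Mapping.lookup m (Suc i) \<le> Poly_Mapping.lookup m i"
  shows "\<exists>\<mu>\<in>partitions. pmono \<mu> = m"
proof -
  have dec: "Poly_Mapping.lookup m j \<le> Poly_Mapping.lookup m i" if "i \<le> j" for i j
    using lift_Suc_antimono_le[of "Poly_Mapping.lookup m" i j] assms that by blast
  have "finite {i. Poly_Mapping.lookup m i \<noteq> 0}" by simp
  then have "\<exists>n. n \<notin> {i. Poly_Mapping.lookup m i \<noteq> 0}" by (rule ex_new_if_finite[OF infinite_UNIV_nat])
  then have ex: "\<exists>n. Poly_Mapping.lookup m n = 0" by auto
  \<comment> \<open>By monotonicity the first vanishing exponent marks the length of the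
    partition.\<close>
  define N where "N = (LEAST n. Poly_Mapping.lookup m n = 0)"
  have N: "Poly_Mapping.lookup m N = 0" unfolding N_def by (rule LeastI_ex[OF ex])
  have pos: "Poly_Mapping.lookup m i > 0" if "i < N" for i
    using not_less_Least[of i] that unfolding N_def by blast
  have zero: "Poly_Mapping.lookup m i = 0" if "i \<ge> N" for i using dec[OF that] N by simp
  let ?\<mu> = "map (Poly_Mapping.lookup m) [0..<N]"
  have "?\<mu> \<in> partitions"
    unfolding partitions_def by (auto simp: sorted_wrt_iff_nth_less dec pos)
  moreover have "pmono ?\<mu> = m"
    by (rule poly_mapping_eqI) (auto simp: nth_default_def zero)
  ultimately show ?thesis by blast
qed

lemma mdeg_pmono: "mdeg (pmono \<mu>) = sum_list \<mu>"
proof -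
  have "Poly_Mapping.keys (pmono \<mu>) \<subseteq> {..<length \<mu>}"
    by (auto simp: in_keys_iff nth_default_def split: if_splits simp del: keys_nth)
  then have "mdeg (pmono \<mu>) = (\<Sum>i<length \<mu>. 1 * Poly_Mapping.lookup (pmono \<mu>) i)"
    by (intro mweight_superset) auto
  then show ?thesis by (simp add: sum_list_sum_nth atLeast0LessThan nth_default_def)
qed

text \<open>Entries start at 0, so filling row \<open>i\<close> with \<open>i\<close> gives the
  entrywise least semistandard tableau of a partition shape.\<close>

definition superstandard :: "nat list \<Rightarrow> nat \<times> nat \<Rightarrow> nat" where
  "superstandard \<mu> = restrict fst (cells \<mu>)"

lemma superstandard_semistandard: "superstandard \<mu> \<in> semistandard_tableaux \<mu>"
  by (auto simp: semistandard_tableaux_def superstandard_def)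

lemma content_superstandard: "content_of (cells \<mu>) (\<lambda>_. 1) (superstandard \<mu>) = pmono \<mu>"
proof (rule poly_mapping_eqI)
  fix i
  have "{c \<in> cells \<mu>. superstandard \<mu> c = i} = (if i < length \<mu> then {i} \<times> {..<\<mu> ! i} else {})"
    by (auto simp: superstandard_def)
  then show "Poly_Mapping.lookup (content_of (cells \<mu>) (\<lambda>_. 1) (superstandard \<mu>)) i = Poly_Mapping.lookup (pmono \<mu>) i"
    by (simp add: lookup_content[OF finite_cells, simplified] nth_default_def)
qed

lemma semistandard_ge_row:
  assumes "\<mu> \<in> partitions" "T \<in> semistandard_tableaux \<mu>" "(i, j) \<in> cells \<mu>"
  shows "i \<le> T (i, j)"
  using assms(3)
proof (induction i)
  case (Suc i)
  then have "(i, j) \<in> cells \<mu>" using partitions_nth_mono[OF assms(1), of i "Suc i"] by auto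
  then show ?case using Suc semistandardD_col[OF assms(1,2) Suc.prems, of i] by simp
qed simp

text \<open>Unitriangularity of the Kostka matrix, in the order given by the statistic \<open>mwt\<close>.\<close>

lemma mwt_content_ge:
  assumes "\<mu> \<in> partitions" "T \<in> semistandard_tableaux \<mu>"
  shows "mwt (pmono \<mu>) \<le> mwt (content_of (cells \<mu>) (\<lambda>_. 1) T)"
    and "mwt (content_of (cells \<mu>) (\<lambda>_. 1) T) = mwt (pmono \<mu>) \<Longrightarrow> T = superstandard \<mu>"
proof -
  have le: "superstandard \<mu> c \<le> T c" if "c \<in> cells \<mu>" for c
    using semistandard_ge_row[OF assms, of "fst c" "snd c"] that by (auto simp: superstandard_def)
  have m: "mwt (pmono \<mu>) = (\<Sum>c\<in>cells \<mu>. superstandard \<mu> c)"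
    using mweight_content[of "\<lambda>i. i" "cells \<mu>" "\<lambda>_. 1" "superstandard \<mu>"]
    by (simp only: content_superstandard mult_1_right)
  have t: "mwt (content_of (cells \<mu>) (\<lambda>_. 1) T) = (\<Sum>c\<in>cells \<mu>. T c)"
    by (simp add: mweight_content)
  show "mwt (pmono \<mu>) \<le> mwt (content_of (cells \<mu>) (\<lambda>_. 1) T)"
    unfolding m t by (rule sum_mono[OF le])
  assume eq: "mwt (content_of (cells \<mu>) (\<lambda>_. 1) T) = mwt (pmono \<mu>)"
  have "T c = superstandard \<mu> c" if "c \<in> cells \<mu>" for c
  proof (rule ccontr)
    assume "T c \<noteq> superstandard \<mu> c"
    then have "superstandard \<mu> c < T c" using le[OF that] by simp
    then have "(\<Sum>c\<in>cells \<mu>. superstandard \<mu> c) < (\<Sum>c\<in>cells \<mu>. T c)"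
      using that le by (intro sum_strict_mono_ex1) auto
    then show False using eq unfolding m t by simp
  qed
  then show "T = superstandard \<mu>"
    using assms(2) superstandard_semistandard[of \<mu>]
    by (intro extensionalityI[of _ "cells \<mu>"]) (auto simp: semistandard_tableaux_def)
qed

lemma schur_pmono_self:
  assumes "\<mu> \<in> partitions"
  shows "schur \<mu> (pmono \<mu>) = 1"
proof -
  have "{T \<in> semistandard_tableaux \<mu>. content_of (cells \<mu>) (\<lambda>_. 1) T = pmono \<mu>} = {superstandard \<mu>}"
  proof (intro equalityI subsetI)
    fix T assume "T \<in> {T \<in> semistandard_tableaux \<mu>. content_of (cells \<mu>) (\<lambda>_. 1) T = pmono \<mu>}"
    then have "T = superstandard \<mu>" by (intro mwt_content_ge(2)[OF assms]) auto
    then show "T \<in> {superstandard \<mu>}" by simp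
  next
    fix T assume "T \<in> {superstandard \<mu>}"
    then show "T \<in> {T \<in> semistandard_tableaux \<mu>. content_of (cells \<mu>) (\<lambda>_. 1) T = pmono \<mu>}"
      using superstandard_semistandard[of \<mu>] content_superstandard[of \<mu>] by blast
  qed
  then show ?thesis unfolding schur_eq_card_content by simp
qed

lemma schur_nonzeroD:
  assumes "\<mu> \<in> partitions" "\<nu> \<in> partitions" "schur \<mu> (pmono \<nu>) \<noteq> 0"
  shows "mwt (pmono \<mu>) < mwt (pmono \<nu>) \<or> \<mu> = \<nu>"
proof -
  have "{T \<in> semistandard_tableaux \<mu>. content_of (cells \<mu>) (\<lambda>_. 1) T = pmono \<nu>} \<noteq> {}"
    using assms(3) unfolding schur_eq_card_content by (rule contrapos_nn) (simp only: card.empty of_nat_0)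
  then obtain T where T: "T \<in> semistandard_tableaux \<mu>" "content_of (cells \<mu>) (\<lambda>_. 1) T = pmono \<nu>" by blast
  have le: "mwt (pmono \<mu>) \<le> mwt (pmono \<nu>)" using mwt_content_ge(1)[OF assms(1) T(1)] unfolding T(2) .
  have "\<mu> = \<nu>" if "mwt (pmono \<nu>) = mwt (pmono \<mu>)"
  proof -
    have "T = superstandard \<mu>" by (rule mwt_content_ge(2)[OF assms(1) T(1)]) (simp only: T(2) that)
    then have "pmono \<mu> = pmono \<nu>" using T(2) content_superstandard[of \<mu>] by metis
    then show ?thesis by (rule pmono_inj[OF assms(1,2)])
  qed
  with le show ?thesis by linarith
qed

text \<open>For \<open>\<nu>\<close> of least \<open>mwt\<close> in the support, triangularity
  leaves \<open>c \<nu>\<close> as the whole coefficient of \<open>pmono \<nu>\<close> in the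
  sum.\<close>

lemma schur_linear_independent:
  assumes "finite {\<mu>. c \<mu> \<noteq> 0}" "{\<mu>. c \<mu> \<noteq> 0} \<subseteq> partitions"
    and "\<And>m. (\<Sum>\<mu> | c \<mu> \<noteq> 0. c \<mu> * schur \<mu> m) = 0"
  shows "c \<mu> = 0"
proof (rule ccontr)
  assume "c \<mu> \<noteq> 0"
  then obtain \<nu> where \<nu>: "c \<nu> \<noteq> 0" and min: "\<And>\<kappa>. c \<kappa> \<noteq> 0 \<Longrightarrow> mwt (pmono \<nu>) \<le> mwt (pmono \<kappa>)"
    using ex_has_least_nat[of "\<lambda>\<kappa>. c \<kappa> \<noteq> 0" \<mu> "\<lambda>\<kappa>. mwt (pmono \<kappa>)"] by blast
  have z: "c \<kappa> * schur \<kappa> (pmono \<nu>) = 0" if "c \<kappa> \<noteq> 0" "\<kappa> \<noteq> \<nu>" for \<kappa>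
  proof -
    have "\<kappa> \<in> partitions" "\<nu> \<in> partitions" using assms(2) that \<nu> by auto
    then show ?thesis
      using schur_nonzeroD[of \<kappa> \<nu>] min[OF that(1)] that(2) by (metis leD mult_eq_0_iff)
  qed
  have "0 = (\<Sum>\<kappa> | c \<kappa> \<noteq> 0. c \<kappa> * schur \<kappa> (pmono \<nu>))" using assms(3) by simp
  also have "\<dots> = c \<nu> * schur \<nu> (pmono \<nu>) + (\<Sum>\<kappa>\<in>{\<kappa>. c \<kappa> \<noteq> 0} - {\<nu>}. c \<kappa> * schur \<kappa> (pmono \<nu>))"
    by (rule sum.remove) (use assms(1) \<nu> in auto)
  also have "(\<Sum>\<kappa>\<in>{\<kappa>. c \<kappa> \<noteq> 0} - {\<nu>}. c \<kappa> * schur \<kappa> (pmono \<nu>)) = 0"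
    by (rule sum.neutral) (use z in auto)
  also have "schur \<nu> (pmono \<nu>) = 1" using assms(2) \<nu> by (intro schur_pmono_self) auto
  finally show False using \<nu> by simp
qed

text \<open>If exponent \<open>k\<close> is smaller than exponent \<open>Suc k\<close>, the swap
  lowers \<open>mwt\<close>. The difference of the weights can have either sign, hence the additive
  form over the naturals.\<close>

lemma mwt_swap_vars:
  "mwt (swap_vars k m) + Poly_Mapping.lookup m (Suc k) = mwt m + Poly_Mapping.lookup m k"
proof -
  let ?A = "Poly_Mapping.keys m \<union> Poly_Mapping.keys (swap_vars k m) \<union> {k, Suc k}"
  have split: "(\<Sum>i\<in>?A. g i) = g k + g (Suc k) + (\<Sum>i\<in>?A - {k} - {Suc k}. g i)" for g :: "nat \<Rightarrow> nat"
    by (subst sum.remove[of _ k], simp, simp, subst sum.remove[of _ "Suc k"]) auto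
  have rest: "(\<Sum>i\<in>?A - {k} - {Suc k}. i * Poly_Mapping.lookup (swap_vars k m) i) =
      (\<Sum>i\<in>?A - {k} - {Suc k}. i * Poly_Mapping.lookup m i)"
    by (intro sum.cong) (auto simp: lookup_swap_vars)
  have "mwt (swap_vars k m) = (\<Sum>i\<in>?A. i * Poly_Mapping.lookup (swap_vars k m) i)"
    "mwt m = (\<Sum>i\<in>?A. i * Poly_Mapping.lookup m i)"
    by (intro mweight_superset; auto)+
  then show ?thesis unfolding split rest by (simp add: lookup_swap_vars)
qed

text \<open>Swapping adjacent exponents that are out of order lowers \<open>mwt\<close>, so every
  monomial can be sorted into one with weakly decreasing exponents, which is some
  \<open>pmono \<mu>\<close>.\<close>

lemma swap_symmetric_eq_0:
  assumes "swap_symmetric f" and "\<And>\<mu>. \<mu> \<in> partitions \<Longrightarrow> f (pmono \<mu>) = 0"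
  shows "f m = 0"
proof (induction "mwt m" arbitrary: m rule: less_induct)
  case less
  show ?case
  proof (cases "\<forall>i. Poly_Mapping.lookup m (Suc i) \<le> Poly_Mapping.lookup m i")
    case True
    then obtain \<mu> where "\<mu> \<in> partitions" "pmono \<mu> = m" using ex_partition_of_decreasing by blast
    then show ?thesis using assms(2) by blast
  next
    case False
    then obtain k where "Poly_Mapping.lookup m k < Poly_Mapping.lookup m (Suc k)" by (meson not_le)
    then have "mwt (swap_vars k m) < mwt m" using mwt_swap_vars[of k m] by simp
    then have "f (swap_vars k m) = 0" by (rule less)
    then show ?thesis using assms(1) by (simp add: swap_symmetric_def)
  qed
qed


text \<open>Elimination along the levels of \<open>mwt\<close>: at level \<open>W\<close> the
  remaining coefficients are removed by subtracting multiples of Schur functions, and triangularity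
  keeps the lower levels at 0. The leading coefficients are 1, so integrality survives.\<close>

lemma ex_schur_expansion:
  assumes "swap_symmetric f" "homogeneous r f"
    and "\<And>\<mu>. \<mu> \<in> partitions_of r \<Longrightarrow> mwt (pmono \<mu>) < W \<Longrightarrow> f (pmono \<mu>) = 0"
  shows "\<exists>c. (\<forall>\<mu>. c \<mu> \<noteq> 0 \<longrightarrow> \<mu> \<in> partitions_of r) \<and>
    (\<forall>m. f m = (\<Sum>\<mu>\<in>partitions_of r. c \<mu> * schur \<mu> m)) \<and>
    ((\<forall>m. f m \<in> \<int>) \<longrightarrow> (\<forall>\<mu>. c \<mu> \<in> \<int>))"
proof -
  let ?mw = "(\<lambda>\<mu>. mwt (pmono \<mu>)) ` partitions_of r"
  \<comment> \<open>Above the weights of all partitions of \<open>r\<close>; once \<open>W\<close>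
    reaches it, \<open>f\<close> vanishes at every \<open>pmono \<mu>\<close>.\<close>
  let ?B = "Suc (Max (insert 0 ?mw))"
  have B: "mwt (pmono \<mu>) < ?B" if "\<mu> \<in> partitions_of r" for \<mu>
    using that finite_partitions_of[of r] by (simp add: le_imp_less_Suc)
  show ?thesis
    using assms
  proof (induction "?B - W" arbitrary: W f)
    case 0
    have "f (pmono \<mu>) = 0" if "\<mu> \<in> partitions" for \<mu>
    proof (cases "\<mu> \<in> partitions_of r")
      case True
      then show ?thesis using B[OF True] 0 by simp
    next
      case False
      then have "mdeg (pmono \<mu>) \<noteq> r" using that mdeg_pmono[of \<mu>] by (auto simp: partitions_of_def)
      then show ?thesis using 0(3) unfolding homogeneous_def by blast
    qed
    then have "f m = 0" for m using swap_symmetric_eq_0 0(2) by blast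
    then show ?case by (intro exI[of _ "\<lambda>_. 0"]) simp
  next
    case (Suc n)
    \<comment> \<open>Different partitions of the same weight \<open>W\<close> do not interact, as
      triangularity is strict off the diagonal; the coefficient is \<open>f (pmono \<mu>)\<close>
      itself.\<close>
    define d where "d \<mu> = (if \<mu> \<in> partitions_of r \<and> mwt (pmono \<mu>) = W then f (pmono \<mu>) else 0)" for \<mu>
    define g where "g m = f m - (\<Sum>\<mu>\<in>partitions_of r. d \<mu> * schur \<mu> m)" for m
    have "swap_symmetric g"
      using Suc.prems(1) by (auto simp: swap_symmetric_def g_def partitions_of_def schur_swap_vars intro!: sum.cong)
    moreover have "homogeneous r g"
      unfolding homogeneous_def
    proof (intro allI impI, rule ccontr)
      fix m assume m: "g m \<noteq> 0" "mdeg m \<noteq> r"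
      then have "f m = 0" using Suc.prems(2) unfolding homogeneous_def by blast
      moreover have "schur \<mu> m = 0" if "\<mu> \<in> partitions_of r" for \<mu>
        using homogeneous_schur[of \<mu>] that m(2) unfolding homogeneous_def partitions_of_def by auto
      ultimately show False using m(1) by (simp add: g_def)
    qed
    moreover have "g (pmono \<nu>) = 0" if \<nu>: "\<nu> \<in> partitions_of r" "mwt (pmono \<nu>) < Suc W" for \<nu>
    proof -
      have "d \<mu> * schur \<mu> (pmono \<nu>) = (if \<mu> = \<nu> then d \<nu> else 0)" if \<mu>: "\<mu> \<in> partitions_of r" for \<mu>
      proof (cases "\<mu> = \<nu>")
        case True
        then show ?thesis using \<nu> by (simp add: schur_pmono_self partitions_of_def)
      next
        case False
        have "schur \<mu> (pmono \<nu>) = 0" if "mwt (pmono \<mu>) = W"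
          using schur_nonzeroD[of \<mu> \<nu>] \<mu> \<nu> that False unfolding partitions_of_def by auto
        then show ?thesis using False by (auto simp: d_def)
      qed
      then have "g (pmono \<nu>) = f (pmono \<nu>) - d \<nu>"
        using finite_partitions_of[of r] \<nu> by (simp add: g_def)
      also have "\<dots> = 0" using Suc.prems(3)[OF \<nu>(1)] \<nu> by (auto simp: d_def)
      finally show ?thesis .
    qed
    moreover have "n = ?B - Suc W" using Suc.hyps(2) by linarith
    ultimately obtain c where c: "\<forall>\<mu>. c \<mu> \<noteq> 0 \<longrightarrow> \<mu> \<in> partitions_of r"
      "\<forall>m. g m = (\<Sum>\<mu>\<in>partitions_of r. c \<mu> * schur \<mu> m)" "(\<forall>m. g m \<in> \<int>) \<longrightarrow> (\<forall>\<mu>. c \<mu> \<in> \<int>)"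
      using Suc.hyps(1)[of "Suc W" g] by blast
    have "\<forall>\<mu>. c \<mu> + d \<mu> \<in> \<int>" if int: "\<forall>m. f m \<in> \<int>"
    proof -
      have d: "d \<mu> \<in> \<int>" for \<mu> using int by (simp add: d_def)
      have "schur \<mu> m \<in> \<int>" for \<mu> m by (simp add: schur_def)
      then have "g m \<in> \<int>" for m unfolding g_def using int d by (intro Ints_diff Ints_sum Ints_mult) auto
      with c(3) d show ?thesis by simp
    qed
    moreover have "f m = (\<Sum>\<mu>\<in>partitions_of r. (c \<mu> + d \<mu>) * schur \<mu> m)" for m
      using c(2)[rule_format, of m] by (simp add: g_def algebra_simps sum.distrib)
    moreover have "\<mu> \<in> partitions_of r" if "c \<mu> + d \<mu> \<noteq> 0" for \<mu>
      using that c(1) by (auto simp: d_def split: if_splits)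
    ultimately show ?case by (intro exI[of _ "\<lambda>\<mu>. c \<mu> + d \<mu>"]) blast
  qed
qed

text \<open>This resolves the definite description: the difference of two expansions of
  \<open>f\<close> is a vanishing combination of Schur functions with finite support.\<close>

lemma schur_coeffs_eq:
  assumes "\<And>\<mu>. c \<mu> \<noteq> 0 \<Longrightarrow> \<mu> \<in> partitions_of r"
    and "\<And>m. f m = (\<Sum>\<mu>\<in>partitions_of r. c \<mu> * schur \<mu> m)"
  shows "schur_coeffs f = c"
  unfolding schur_coeffs_def
proof (rule the_equality)
  have sub: "{\<mu>. c \<mu> \<noteq> 0} \<subseteq> partitions_of r" using assms(1) by auto
  then have fin: "finite {\<mu>. c \<mu> \<noteq> 0}" using finite_partitions_of finite_subset by blast
  have cf: "f m = (\<Sum>\<mu> | c \<mu> \<noteq> 0. c \<mu> * schur \<mu> m)" for m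
    unfolding assms(2) by (rule sum.mono_neutral_right) (use sub finite_partitions_of in auto)
  have part: "{\<mu>. c \<mu> \<noteq> 0} \<subseteq> partitions" using sub by (auto simp: partitions_of_def)
  show "finite {\<mu>. c \<mu> \<noteq> 0} \<and> {\<mu>. c \<mu> \<noteq> 0} \<subseteq> partitions \<and> (\<forall>m. f m = (\<Sum>\<mu> | c \<mu> \<noteq> 0. c \<mu> * schur \<mu> m))"
    using fin part cf by blast
  fix c' assume c': "finite {\<mu>. c' \<mu> \<noteq> 0} \<and> {\<mu>. c' \<mu> \<noteq> 0} \<subseteq> partitions \<and> (\<forall>m. f m = (\<Sum>\<mu> | c' \<mu> \<noteq> 0. c' \<mu> * schur \<mu> m))"
  let ?d = "\<lambda>\<mu>. c' \<mu> - c \<mu>" and ?U = "{\<mu>. c' \<mu> \<noteq> 0} \<union> {\<mu>. c \<mu> \<noteq> 0}"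
  have U: "finite ?U" "{\<mu>. ?d \<mu> \<noteq> 0} \<subseteq> ?U" using c' fin by auto
  have "?d \<mu> = 0" for \<mu>
  proof (rule schur_linear_independent[of ?d])
    show "finite {\<mu>. ?d \<mu> \<noteq> 0}" using U finite_subset by blast
    show "{\<mu>. ?d \<mu> \<noteq> 0} \<subseteq> partitions" using U(2) c' part by blast
    fix m
    have "(\<Sum>\<mu> | ?d \<mu> \<noteq> 0. ?d \<mu> * schur \<mu> m) = (\<Sum>\<mu>\<in>?U. ?d \<mu> * schur \<mu> m)"
      by (rule sum.mono_neutral_left) (use U in auto)
    also have "\<dots> = (\<Sum>\<mu>\<in>?U. c' \<mu> * schur \<mu> m) - (\<Sum>\<mu>\<in>?U. c \<mu> * schur \<mu> m)"
      by (simp add: algebra_simps sum_subtractf)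
    also have "(\<Sum>\<mu>\<in>?U. c' \<mu> * schur \<mu> m) = (\<Sum>\<mu> | c' \<mu> \<noteq> 0. c' \<mu> * schur \<mu> m)"
      by (rule sum.mono_neutral_right) (use U in auto)
    also have "(\<Sum>\<mu>\<in>?U. c \<mu> * schur \<mu> m) = (\<Sum>\<mu> | c \<mu> \<noteq> 0. c \<mu> * schur \<mu> m)"
      by (rule sum.mono_neutral_right) (use U in auto)
    finally show "(\<Sum>\<mu> | ?d \<mu> \<noteq> 0. ?d \<mu> * schur \<mu> m) = 0" using c' cf by (metis diff_self)
  qed
  then show "c' = c" by (simp add: fun_eq_iff)
qed

lemma schur_coeffs_expansion:
  assumes "swap_symmetric f" "homogeneous r f"
  shows "schur_coeffs f \<mu> \<noteq> 0 \<Longrightarrow> \<mu> \<in> partitions_of r"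
    and "f m = (\<Sum>\<mu>\<in>partitions_of r. schur_coeffs f \<mu> * schur \<mu> m)"
    and "(\<And>m. f m \<in> \<int>) \<Longrightarrow> schur_coeffs f \<mu> \<in> \<int>"
proof -
  obtain c where c: "\<forall>\<mu>. c \<mu> \<noteq> 0 \<longrightarrow> \<mu> \<in> partitions_of r"
      "\<forall>m. f m = (\<Sum>\<mu>\<in>partitions_of r. c \<mu> * schur \<mu> m)" "(\<forall>m. f m \<in> \<int>) \<longrightarrow> (\<forall>\<mu>. c \<mu> \<in> \<int>)"
    using ex_schur_expansion[of f r 0] assms not_less0 by blast
  then have "schur_coeffs f = c" by (intro schur_coeffs_eq) auto
  with c show "schur_coeffs f \<mu> \<noteq> 0 \<Longrightarrow> \<mu> \<in> partitions_of r"
    "f m = (\<Sum>\<mu>\<in>partitions_of r. schur_coeffs f \<mu> * schur \<mu> m)"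
    "(\<And>m. f m \<in> \<int>) \<Longrightarrow> schur_coeffs f \<mu> \<in> \<int>" by auto
qed


section \<open>Standardization\<close>

definition comaj :: "nat list \<Rightarrow> (nat \<times> nat \<Rightarrow> nat) \<Rightarrow> nat" where
  "comaj \<mu> S = (\<Sum>k\<in>tableau_descents \<mu> S. sum_list \<mu> - k)"

lemma standard_bij: "S \<in> standard_tableaux \<mu> \<Longrightarrow> bij_betw S (cells \<mu>) {1..sum_list \<mu>}"
  by (simp add: standard_tableaux_def)

lemma standard_row:
  "S \<in> standard_tableaux \<mu> \<Longrightarrow> (i, j') \<in> cells \<mu> \<Longrightarrow> j < j' \<Longrightarrow> S (i, j) < S (i, j')"
  by (auto simp: standard_tableaux_def)

lemma standard_col:
  assumes "\<mu> \<in> partitions" "S \<in> standard_tableaux \<mu>" "(i', j) \<in> cells \<mu>" "i < i'"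
  shows "S (i, j) < S (i', j)"
proof -
  have "(i, j) \<in> cells \<mu>" using assms partitions_nth_mono[of \<mu> i i'] by auto
  then show ?thesis using assms unfolding standard_tableaux_def by blast
qed

lemma finite_standard: "finite (standard_tableaux \<mu>)"
proof -
  have "standard_tableaux \<mu> \<subseteq> cells \<mu> \<rightarrow>\<^sub>E {1..sum_list \<mu>}"
    by (auto simp: standard_tableaux_def PiE_def bij_betw_def)
  then show ?thesis by (meson finite_PiE finite_cells finite_atLeastAtMost finite_subset)
qed

lemma tableau_descents_subset:
  assumes "S \<in> standard_tableaux \<mu>"
  shows "tableau_descents \<mu> S \<subseteq> {1..<sum_list \<mu>}"
proof
  fix k assume "k \<in> tableau_descents \<mu> S"
  then obtain c c' where "c \<in> cells \<mu>" "c' \<in> cells \<mu>" "S c = k" "S c' = k + 1"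
    unfolding tableau_descents_def by blast
  then have "k \<in> {1..sum_list \<mu>}" "k + 1 \<in> {1..sum_list \<mu>}"
    using standard_bij[OF assms] by (metis bij_betwE)+
  then show "k \<in> {1..<sum_list \<mu>}" by auto
qed

text \<open>The entry to be given to the cell numbered \<open>k\<close>: free increments
  \<open>e l\<close>, and an increment of one forced between numbers \<open>l - 1\<close> and
  \<open>l\<close> when \<open>l - 1\<close> is a descent. For \<open>l = 1\<close> the test is at
  0, which is never a descent of a standard tableau.\<close>

definition climb :: "nat list \<Rightarrow> (nat \<times> nat \<Rightarrow> nat) \<Rightarrow> (nat \<Rightarrow> nat) \<Rightarrow> nat \<Rightarrow> nat" where
  "climb \<mu> S e k = (\<Sum>l=1..k. e l + of_bool (l - 1 \<in> tableau_descents \<mu> S))"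

text \<open>The inverse of standardization: \<open>S\<close> is the numbering of the cells, and
  \<open>e\<close> records by how much consecutive entries grow beyond what the descents
  force.\<close>

definition destandardize :: "nat list \<Rightarrow> (nat \<times> nat \<Rightarrow> nat) \<times> (nat \<Rightarrow> nat) \<Rightarrow> nat \<times> nat \<Rightarrow> nat" where
  "destandardize \<mu> = (\<lambda>(S, e). \<lambda>c\<in>cells \<mu>. climb \<mu> S e (S c))"

lemma climb_0 [simp]: "climb \<mu> S e 0 = 0"
  by (simp add: climb_def)

lemma climb_Suc: "climb \<mu> S e (Suc k) = climb \<mu> S e k + e (Suc k) + of_bool (k \<in> tableau_descents \<mu> S)"
  by (simp add: climb_def)

lemma climb_mono: "k \<le> l \<Longrightarrow> climb \<mu> S e k \<le> climb \<mu> S e l"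
  by (rule lift_Suc_mono_le) (simp_all add: climb_Suc)

lemma climb_strict:
  assumes "k \<le> d" "d < l" "d \<in> tableau_descents \<mu> S"
  shows "climb \<mu> S e k < climb \<mu> S e l"
proof -
  have "climb \<mu> S e k \<le> climb \<mu> S e d" by (rule climb_mono[OF assms(1)])
  also have "\<dots> < climb \<mu> S e (Suc d)" using assms(3) by (simp add: climb_Suc)
  also have "\<dots> \<le> climb \<mu> S e l" by (rule climb_mono) (use assms in simp)
  finally show ?thesis .
qed

text \<open>The order in which standardization numbers the cells.\<close>

definition cell_less :: "(nat \<times> nat \<Rightarrow> nat) \<Rightarrow> nat \<times> nat \<Rightarrow> nat \<times> nat \<Rightarrow> bool" where
  "cell_less T c c' \<longleftrightarrow> T c < T c' \<or> T c = T c' \<and> snd c < snd c'"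

text \<open>Otherwise \<open>c'\<close> lies weakly above and weakly to the left of
  \<open>c\<close>, and comparing both with the corner in the row of \<open>c'\<close> and the
  column of \<open>c\<close> gives \<open>S c' \<le> S c\<close>.\<close>

lemma nondescent_column:
  assumes \<mu>: "\<mu> \<in> partitions" and S: "S \<in> standard_tableaux \<mu>"
    and c: "c \<in> cells \<mu>" "c' \<in> cells \<mu>" "S c' = Suc (S c)" "S c \<notin> tableau_descents \<mu> S"
  shows "snd c < snd c'"
proof (rule ccontr)
  obtain i j i' j' where ij: "c = (i, j)" "c' = (i', j')" by (cases c, cases c')
  assume "\<not> snd c < snd c'"
  then have j: "j' \<le> j" using ij by simp
  have i: "i' \<le> i"
  proof (rule ccontr)
    assume "\<not> i' \<le> i"
    then have "S (i, j) \<in> tableau_descents \<mu> S"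
      unfolding tableau_descents_def using c ij
      by (intro CollectI exI[of _ i] exI[of _ j] exI[of _ i'] exI[of _ j']) auto
    then show False using c ij by simp
  qed
  have cell: "(i', j) \<in> cells \<mu>" using c ij i partitions_nth_mono[OF \<mu> i] by auto
  have "S (i', j') \<le> S (i', j)" using standard_row[OF S cell, of j'] j by (cases "j' = j") auto
  also have "\<dots> \<le> S (i, j)" using standard_col[OF \<mu> S, of i j i'] c ij i by (cases "i' = i") auto
  finally show False using c ij by simp
qed

lemma nondescent_run_column:
  assumes \<mu>: "\<mu> \<in> partitions" and S: "S \<in> standard_tableaux \<mu>"
    and c: "c \<in> cells \<mu>" and "c' \<in> cells \<mu>" "S c < S c'" "{S c..<S c'} \<inter> tableau_descents \<mu> S = {}"
  shows "snd c < snd c'"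
  using assms(4-6)
proof (induction "S c'" arbitrary: c')
  case (Suc n)
  show ?case
  proof (cases "n = S c")
    case True
    moreover have "S c \<notin> tableau_descents \<mu> S" using Suc.prems by (auto simp: disjoint_iff)
    ultimately show ?thesis using nondescent_column[OF \<mu> S c Suc.prems(1)] Suc.hyps(2) by simp
  next
    case False
    then have n: "S c < n" using Suc by simp
    have "Suc n \<le> sum_list \<mu>" using Suc standard_bij[OF S] by (metis atLeastAtMost_iff bij_betwE)
    then have "n \<in> {1..sum_list \<mu>}" using n by auto
    then have "n \<in> S ` cells \<mu>" using standard_bij[OF S] by (simp add: bij_betw_def)
    then obtain c'' where c'': "c'' \<in> cells \<mu>" "S c'' = n" by auto
    have "{S c..<S c''} \<inter> tableau_descents \<mu> S = {}" using Suc.prems c'' Suc.hyps(2) by (force simp: disjoint_iff)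
    then have less: "snd c < snd c''" using Suc.hyps(1)[of c''] c'' n by auto
    have "n \<notin> tableau_descents \<mu> S" using Suc.prems n Suc.hyps(2) by (auto simp: disjoint_iff)
    then have "snd c'' < snd c'"
      using nondescent_column[OF \<mu> S c''(1) Suc.prems(1)] c'' Suc.hyps(2) by simp
    with less show ?thesis by simp
  qed
qed simp

text \<open>Equal entries mean that no descent lies between the two numbers, and then the columns
  increase. Hence the numbering can be recovered from the entries through
  \<open>cell_less\<close>.\<close>

lemma destandardize_less:
  assumes \<mu>: "\<mu> \<in> partitions" and S: "S \<in> standard_tableaux \<mu>"
    and c: "c \<in> cells \<mu>" "c' \<in> cells \<mu>" "S c < S c'"
  shows "cell_less (destandardize \<mu> (S, e)) c c'"
proof (cases "climb \<mu> S e (S c) = climb \<mu> S e (S c')")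
  case True
  then have "{S c..<S c'} \<inter> tableau_descents \<mu> S = {}"
    using climb_strict[of "S c" _ "S c'" \<mu> S e] by auto
  then have "snd c < snd c'" using nondescent_run_column[OF \<mu> S c] by simp
  then show ?thesis using True c by (simp add: cell_less_def destandardize_def)
next
  case False
  then show ?thesis using climb_mono[of "S c" "S c'" \<mu> S e] c
    by (simp add: cell_less_def destandardize_def)
qed

text \<open>Within one column \<open>cell_less\<close> cannot be decided by the column index, so the
  entries there increase strictly.\<close>

lemma destandardize_semistandard:
  assumes \<mu>: "\<mu> \<in> partitions" and S: "S \<in> standard_tableaux \<mu>"
  shows "destandardize \<mu> (S, e) \<in> semistandard_tableaux \<mu>"
  unfolding semistandard_tableaux_def
proof safe
  fix i j j' assume "(i, j) \<in> cells \<mu>" "(i, j') \<in> cells \<mu>" "j < j'"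
  then show "destandardize \<mu> (S, e) (i, j) \<le> destandardize \<mu> (S, e) (i, j')"
    using destandardize_less[OF \<mu> S, of "(i, j)" "(i, j')" e] standard_row[OF S, of i j' j]
    by (auto simp: cell_less_def)
next
  fix i i' j assume "(i, j) \<in> cells \<mu>" "(i', j) \<in> cells \<mu>" "i < i'"
  then show "destandardize \<mu> (S, e) (i, j) < destandardize \<mu> (S, e) (i', j)"
    using destandardize_less[OF \<mu> S, of "(i, j)" "(i', j)" e] standard_col[OF \<mu> S, of i' j i]
    by (auto simp: cell_less_def)
qed (simp add: destandardize_def)

text \<open>A standard tableau is determined by the order that it induces on the cells.\<close>

lemma standard_eq_rank:
  assumes S: "S \<in> standard_tableaux \<mu>" and c: "c \<in> cells \<mu>"
  shows "S c = Suc (card {c' \<in> cells \<mu>. S c' < S c})"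
proof -
  have b: "bij_betw S (cells \<mu>) {1..sum_list \<mu>}" by (rule standard_bij[OF S])
  have Sc: "S c \<in> {1..sum_list \<mu>}" using b c by (metis bij_betwE)
  have "card {c' \<in> cells \<mu>. S c' < S c} = card (S ` {c' \<in> cells \<mu>. S c' < S c})"
    by (rule card_image[symmetric], rule inj_on_subset[of S "cells \<mu>"]) (use b in \<open>auto simp: bij_betw_def\<close>)
  also have "S ` {c' \<in> cells \<mu>. S c' < S c} = {1..<S c}"
  proof (intro equalityI subsetI)
    fix k assume "k \<in> S ` {c' \<in> cells \<mu>. S c' < S c}"
    then show "k \<in> {1..<S c}" using b by (auto simp: bij_betw_def Suc_le_eq intro!: Suc_leI)
  next
    fix k assume k: "k \<in> {1..<S c}"
    then have "k \<in> S ` cells \<mu>" using b Sc by (auto simp: bij_betw_def)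
    then show "k \<in> S ` {c' \<in> cells \<mu>. S c' < S c}" using k by auto
  qed
  finally show ?thesis using Sc by auto
qed

text \<open>The image determines \<open>cell_less\<close>, hence the rank of each cell, which is
  \<open>S\<close>. Then \<open>climb\<close> is known at every number, and \<open>e\<close> is
  obtained from its successive differences.\<close>

lemma destandardize_inj:
  assumes \<mu>: "\<mu> \<in> partitions"
  shows "inj_on (destandardize \<mu>) (standard_tableaux \<mu> \<times> ({1..sum_list \<mu>} \<rightarrow>\<^sub>E UNIV))"
proof (rule inj_onI, clarify)
  fix S e S' e'
  assume S: "S \<in> standard_tableaux \<mu>" and S': "S' \<in> standard_tableaux \<mu>"
    and e: "e \<in> {1..sum_list \<mu>} \<rightarrow>\<^sub>E UNIV" and e': "e' \<in> {1..sum_list \<mu>} \<rightarrow>\<^sub>E UNIV"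
    and eq: "destandardize \<mu> (S, e) = destandardize \<mu> (S', e')"
  have less_iff: "S c < S c' \<longleftrightarrow> cell_less (destandardize \<mu> (S, e)) c c'"
    if "S \<in> standard_tableaux \<mu>" "c \<in> cells \<mu>" "c' \<in> cells \<mu>" for S e c c'
  proof (cases "c = c'")
    case False
    then have "S c \<noteq> S c'" using standard_bij[OF that(1)] that by (metis bij_betw_def inj_onD)
    then consider "S c < S c'" | "S c' < S c" by linarith
    then show ?thesis
      using destandardize_less[OF \<mu> that, of e] destandardize_less[OF \<mu> that(1,3,2), of e]
      by cases (auto simp: cell_less_def)
  qed (simp add: cell_less_def)
  have "S c = S' c" if c: "c \<in> cells \<mu>" for c
  proof -
    have "{c' \<in> cells \<mu>. S c' < S c} = {c' \<in> cells \<mu>. S' c' < S' c}"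
      using less_iff[OF S _ c, of _ e] less_iff[OF S' _ c, of _ e'] eq by auto
    then show ?thesis using standard_eq_rank[OF S c] standard_eq_rank[OF S' c] by simp
  qed
  then have SS: "S = S'" using S S' by (intro extensionalityI[of _ "cells \<mu>"]) (auto simp: standard_tableaux_def)
  have cl: "climb \<mu> S e k = climb \<mu> S e' k" if "k \<le> sum_list \<mu>" for k
  proof (cases "k = 0")
    case False
    then have "k \<in> S ` cells \<mu>" using that standard_bij[OF S] by (auto simp: bij_betw_def)
    then obtain c where "c \<in> cells \<mu>" "S c = k" by auto
    then show ?thesis using fun_cong[OF eq, of c] SS by (simp add: destandardize_def)
  qed simp
  have "e k = e' k" if k: "k \<in> {1..sum_list \<mu>}" for k
  proof -
    obtain l where "k = Suc l" using k by (cases k) auto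
    then show ?thesis using cl[of k] cl[of l] that by (simp add: climb_Suc)
  qed
  then have "e = e'" using e e' by (intro PiE_ext) auto
  with SS show "S = S' \<and> e = e'" by simp
qed

text \<open>Number the cells in the order \<open>cell_less\<close> and let \<open>e\<close> be the
  growth of consecutive entries that exceeds the forced one.\<close>

lemma destandardize_surj:
  assumes \<mu>: "\<mu> \<in> partitions" and T: "T \<in> semistandard_tableaux \<mu>"
  shows "T \<in> destandardize \<mu> ` (standard_tableaux \<mu> \<times> ({1..sum_list \<mu>} \<rightarrow>\<^sub>E UNIV))"
proof -
  let ?r = "sum_list \<mu>"
  define S where "S = (\<lambda>c\<in>cells \<mu>. Suc (card {c' \<in> cells \<mu>. cell_less T c' c}))"
  have trans: "cell_less T a b \<Longrightarrow> cell_less T b c \<Longrightarrow> cell_less T a c" for a b c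
    by (auto simp: cell_less_def)
  \<comment> \<open>Equal entries in equal columns would violate strictness down the column.\<close>
  have total: "cell_less T c c' \<or> cell_less T c' c" if c: "c \<in> cells \<mu>" "c' \<in> cells \<mu>" "c \<noteq> c'" for c c'
  proof (rule ccontr)
    assume a: "\<not> ?thesis"
    obtain i j i' j' where ij: "c = (i, j)" "c' = (i', j')" by (cases c, cases c')
    from a ij have "T (i, j) = T (i', j')" "j = j'" by (auto simp: cell_less_def)
    moreover from this c ij have "i \<noteq> i'" by auto
    ultimately show False
      using semistandardD_col[OF \<mu> T, of i j i'] semistandardD_col[OF \<mu> T, of i' j i] c ij
      by (metis less_irrefl nat_neq_iff)
  qed
  have S_less: "S c < S c'" if c: "c \<in> cells \<mu>" "c' \<in> cells \<mu>" "cell_less T c c'" for c c'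
  proof -
    have "{a \<in> cells \<mu>. cell_less T a c} \<subset> {a \<in> cells \<mu>. cell_less T a c'}"
      using c trans by (auto simp: cell_less_def)
    then have "card {a \<in> cells \<mu>. cell_less T a c} < card {a \<in> cells \<mu>. cell_less T a c'}"
      by (intro psubset_card_mono) auto
    then show ?thesis using c by (simp add: S_def)
  qed
  have less_S: "cell_less T c c'" if c: "c \<in> cells \<mu>" "c' \<in> cells \<mu>" "S c < S c'" for c c'
    using total[of c c'] S_less[of c' c] c by fastforce
  have inj: "inj_on S (cells \<mu>)"
    using total S_less by (intro inj_onI) (metis less_irrefl)
  have "S ` cells \<mu> \<subseteq> {1..?r}"
  proof clarify
    fix c assume c: "c \<in> cells \<mu>"
    have "{a \<in> cells \<mu>. cell_less T a c} \<subset> cells \<mu>" using c by (auto simp: cell_less_def)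
    then have "card {a \<in> cells \<mu>. cell_less T a c} < card (cells \<mu>)" by (intro psubset_card_mono) auto
    then show "S c \<in> {1..?r}" using c by (simp add: S_def card_cells)
  qed
  moreover have "card (S ` cells \<mu>) = ?r" using inj by (simp add: card_image card_cells)
  ultimately have bij: "bij_betw S (cells \<mu>) {1..?r}"
    using inj card_subset_eq[of "{1..?r}" "S ` cells \<mu>"] by (simp add: bij_betw_def)
  have S: "S \<in> standard_tableaux \<mu>"
    unfolding standard_tableaux_def
  proof safe
    fix i j j' assume c: "(i, j) \<in> cells \<mu>" "(i, j') \<in> cells \<mu>" "j < j'"
    show "S (i, j) < S (i, j')"
      by (rule S_less) (use c semistandardD_row[OF T c(2), of j] in \<open>auto simp: cell_less_def\<close>)
  next
    fix i i' j assume c: "(i, j) \<in> cells \<mu>" "(i', j) \<in> cells \<mu>" "i < i'"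
    show "S (i, j) < S (i', j)"
      by (rule S_less) (use c semistandardD_col[OF \<mu> T c(2), of i] in \<open>auto simp: cell_less_def\<close>)
  qed (use bij in \<open>auto simp: S_def\<close>)
  define pos where "pos = the_inv_into (cells \<mu>) S"
  have pos: "pos k \<in> cells \<mu>" "S (pos k) = k" if "k \<in> {1..?r}" for k
    using bij that unfolding pos_def bij_betw_def
    by (auto intro: the_inv_into_into f_the_inv_into_f)
  \<comment> \<open>Number 0 is a virtual start with value 0, so that \<open>e 1\<close> becomes the
    smallest entry.\<close>
  define a where "a k = (if k = 0 then 0 else T (pos k))" for k
  define e where "e = (\<lambda>k\<in>{1..?r}. a k - a (k - 1) - of_bool (k - 1 \<in> tableau_descents \<mu> S))"
  \<comment> \<open>This inequality keeps the natural number subtractions in \<open>e\<close> from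
    being truncated.\<close>
  have step: "a k + of_bool (k \<in> tableau_descents \<mu> S) \<le> a (Suc k)" if k: "Suc k \<le> ?r" for k
  proof (cases "k = 0")
    case True
    then show ?thesis using tableau_descents_subset[OF S] by (auto simp: a_def)
  next
    case False
    let ?c = "pos k" and ?c' = "pos (Suc k)"
    have c: "?c \<in> cells \<mu>" "S ?c = k" "?c' \<in> cells \<mu>" "S ?c' = Suc k" using pos[of k] pos[of "Suc k"] k False by auto
    have less: "cell_less T ?c ?c'" using less_S[of ?c ?c'] c by simp
    have "T ?c < T ?c'" if des: "k \<in> tableau_descents \<mu> S"
    proof (rule ccontr)
      assume n: "\<not> T ?c < T ?c'"
      obtain i j i' j' where ij: "?c = (i, j)" "?c' = (i', j')" by (cases ?c, cases ?c')
      have "i < i'"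
      proof -
        obtain i1 j1 i2 j2 where *: "(i1, j1) \<in> cells \<mu>" "(i2, j2) \<in> cells \<mu>" "S (i1, j1) = k" "S (i2, j2) = k + 1" "i1 < i2"
          using des unfolding tableau_descents_def by blast
        then have "(i1, j1) = ?c" "(i2, j2) = ?c'" using inj c by (metis inj_onD Suc_eq_plus1)+
        with ij * show ?thesis by simp
      qed
      moreover have "j < j'" "T (i, j) = T (i', j')" using n less ij by (auto simp: cell_less_def)
      moreover have "(i, j') \<in> cells \<mu>" using c ij \<open>i < i'\<close> partitions_nth_mono[OF \<mu>, of i i'] by auto
      \<comment> \<open>The corner \<open>(i, j')\<close> would hold an entry at least
        \<open>T (i, j)\<close> and less than \<open>T (i', j')\<close>, although these two are
        equal.\<close>
      ultimately show False
        using semistandardD_row[OF T, of i j' j] semistandardD_col[OF \<mu> T, of i' j' i] c ij by simp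
    qed
    then show ?thesis using less False by (auto simp: a_def cell_less_def)
  qed
  have climb: "climb \<mu> S e k = a k" if "k \<le> ?r" for k
    using that
  proof (induction k)
    case (Suc k)
    then show ?case using step[of k] by (simp add: climb_Suc e_def)
  qed (simp add: a_def)
  have "T = destandardize \<mu> (S, e)"
  proof (rule extensionalityI[of _ "cells \<mu>"])
    fix c assume c: "c \<in> cells \<mu>"
    have Sc: "S c \<in> {1..?r}" using bij c by (metis bij_betwE)
    have "pos (S c) = c" using c inj pos[OF Sc] by (metis inj_onD)
    then show "T c = destandardize \<mu> (S, e) c"
      using c Sc climb[of "S c"] by (auto simp: destandardize_def a_def)
  qed (use T in \<open>auto simp: destandardize_def semistandard_tableaux_def\<close>)
  moreover have "e \<in> {1..?r} \<rightarrow>\<^sub>E UNIV" by (simp add: e_def)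
  ultimately show ?thesis using S by auto
qed

lemma destandardize_bij:
  assumes "\<mu> \<in> partitions"
  shows "bij_betw (destandardize \<mu>) (standard_tableaux \<mu> \<times> ({1..sum_list \<mu>} \<rightarrow>\<^sub>E UNIV)) (semistandard_tableaux \<mu>)"
  using destandardize_inj[OF assms] destandardize_surj[OF assms] destandardize_semistandard[OF assms]
  unfolding bij_betw_def by auto

text \<open>With \<open>r\<close> the number of cells, an increment at position \<open>l\<close> is
  inherited by the \<open>Suc r - l\<close> cells numbered from \<open>l\<close> on. A descent
  \<open>k\<close> acts at position \<open>Suc k\<close> and so counts for \<open>r - k\<close>
  cells, which is why comaj appears and not maj.\<close>

lemma sum_destandardize:
  assumes S: "S \<in> standard_tableaux \<mu>"
  shows "(\<Sum>c\<in>cells \<mu>. destandardize \<mu> (S, e) c) =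
    (\<Sum>l=1..sum_list \<mu>. e l * (Suc (sum_list \<mu>) - l)) + comaj \<mu> S"
proof -
  let ?r = "sum_list \<mu>" and ?D = "tableau_descents \<mu> S"
  have partial_sums: "(\<Sum>k=1..r. \<Sum>l=1..k. g l) = (\<Sum>l=1..r. g l * (Suc r - l))" for r and g :: "nat \<Rightarrow> nat"
  proof (induction r)
    case (Suc r)
    have "(\<Sum>l=1..r. g l * (Suc (Suc r) - l)) = (\<Sum>l=1..r. g l * (Suc r - l) + g l)"
      by (intro sum.cong) (auto simp: Suc_diff_le)
    then show ?case using Suc by (simp add: sum.distrib)
  qed simp
  have "(\<Sum>c\<in>cells \<mu>. destandardize \<mu> (S, e) c) = (\<Sum>c\<in>cells \<mu>. climb \<mu> S e (S c))"
    by (simp add: destandardize_def)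
  also have "\<dots> = (\<Sum>k=1..?r. climb \<mu> S e k)"
    by (rule sum.reindex_bij_betw[OF standard_bij[OF S]])
  also have "\<dots> = (\<Sum>l=1..?r. (e l + of_bool (l - 1 \<in> ?D)) * (Suc ?r - l))"
    unfolding climb_def by (rule partial_sums)
  also have "\<dots> = (\<Sum>l=1..?r. e l * (Suc ?r - l)) + (\<Sum>l=1..?r. of_bool (l - 1 \<in> ?D) * (Suc ?r - l))"
    by (simp only: distrib_right sum.distrib)
  also have "(\<Sum>l=1..?r. of_bool (l - 1 \<in> ?D) * (Suc ?r - l)) = (\<Sum>l\<in>Suc ` ?D. Suc ?r - l)"
  proof (rule sum.mono_neutral_cong_right)
    show "Suc ` ?D \<subseteq> {1..?r}" using tableau_descents_subset[OF S] by auto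
    have "l - 1 \<notin> ?D" if "l \<in> {1..?r} - Suc ` ?D" for l
      using that by (cases l) auto
    then show "\<forall>l\<in>{1..?r} - Suc ` ?D. of_bool (l - 1 \<in> ?D) * (Suc ?r - l) = 0" by simp
  qed auto
  also have "\<dots> = comaj \<mu> S" by (simp add: sum.reindex comaj_def)
  finally show ?thesis .
qed

abbreviation q_factorial_fps :: "nat \<Rightarrow> rat fps" where
  "q_factorial_fps r \<equiv> (\<Prod>k=1..r. 1 - fps_X ^ k)"

lemma finite_semistandard_content:
  "finite {T \<in> semistandard_tableaux \<mu>. content_of (cells \<mu>) (\<lambda>_. 1) T = m}"
  by (rule finite_subset[OF _ finite_words[of "cells \<mu>" "\<lambda>_. 1" m]])
    (auto simp: words_def semistandard_tableaux_def PiE_def)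

text \<open>By \<open>destandardize_bij\<close> a semistandard tableau is a standard one together
  with free increments. These have weights \<open>r\<close>, ..., 1, so their generating function is
  inverse to \<open>q_factorial_fps r\<close>; what remains is the shift by comaj.\<close>

lemma principal_spec_schur:
  assumes \<mu>: "\<mu> \<in> partitions_of r"
  shows "principal_spec r (schur \<mu>) * q_factorial_fps r = (\<Sum>S\<in>standard_tableaux \<mu>. fps_X ^ comaj \<mu> S)"
proof -
  have r: "sum_list \<mu> = r" and p: "\<mu> \<in> partitions" using \<mu> by (auto simp: partitions_of_def)
  let ?k = "\<lambda>l. Suc r - l"
  let ?F = "Abs_fps (\<lambda>n. of_nat (card (sum_words {1..r} ?k n))) :: rat fps"
  have coeff: "(\<Sum>m\<in>graded r n. schur \<mu> m) =
      (\<Sum>S\<in>standard_tableaux \<mu>. if n < comaj \<mu> S then 0 else of_nat (card (sum_words {1..r} ?k (n - comaj \<mu> S))))" for n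
  proof -
    have "(\<Sum>m\<in>graded r n. card {T \<in> semistandard_tableaux \<mu>. content_of (cells \<mu>) (\<lambda>_. 1) T = m}) =
        card {T \<in> semistandard_tableaux \<mu>. content_of (cells \<mu>) (\<lambda>_. 1) T \<in> graded r n}"
      by (rule sum_card_fibres[OF finite_graded finite_semistandard_content])
    also have "{T \<in> semistandard_tableaux \<mu>. content_of (cells \<mu>) (\<lambda>_. 1) T \<in> graded r n} =
        {T \<in> semistandard_tableaux \<mu>. (\<Sum>c\<in>cells \<mu>. T c) = n}"
      by (simp add: graded_def mweight_content card_cells r)
    also have "card \<dots> = card {x \<in> standard_tableaux \<mu> \<times> ({1..r} \<rightarrow>\<^sub>E UNIV). (\<Sum>c\<in>cells \<mu>. destandardize \<mu> x c) = n}"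
    proof (rule bij_betw_same_card[symmetric])
      show "bij_betw (destandardize \<mu>) {x \<in> standard_tableaux \<mu> \<times> ({1..r} \<rightarrow>\<^sub>E UNIV). (\<Sum>c\<in>cells \<mu>. destandardize \<mu> x c) = n}
          {T \<in> semistandard_tableaux \<mu>. (\<Sum>c\<in>cells \<mu>. T c) = n}"
        using destandardize_bij[OF p] unfolding r bij_betw_def inj_on_def by auto
    qed
    also have "{x \<in> standard_tableaux \<mu> \<times> ({1..r} \<rightarrow>\<^sub>E UNIV). (\<Sum>c\<in>cells \<mu>. destandardize \<mu> x c) = n} =
        (SIGMA S:standard_tableaux \<mu>. if n < comaj \<mu> S then {} else sum_words {1..r} ?k (n - comaj \<mu> S))"
      by (auto simp: sum_destandardize[unfolded r] r sum_words_def PiE_iff extensional_def split: if_splits)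
    also have "card \<dots> = (\<Sum>S\<in>standard_tableaux \<mu>. card (if n < comaj \<mu> S then {} else sum_words {1..r} ?k (n - comaj \<mu> S)))"
      by (rule card_SigmaI[OF finite_standard]) (auto intro: finite_sum_words)
    finally have "(\<Sum>m\<in>graded r n. card {T \<in> semistandard_tableaux \<mu>. content_of (cells \<mu>) (\<lambda>_. 1) T = m}) =
        (\<Sum>S\<in>standard_tableaux \<mu>. if n < comaj \<mu> S then 0 else card (sum_words {1..r} ?k (n - comaj \<mu> S)))"
      by (simp add: if_distrib cong: if_cong)
    then have "of_nat (\<Sum>m\<in>graded r n. card {T \<in> semistandard_tableaux \<mu>. content_of (cells \<mu>) (\<lambda>_. 1) T = m}) =
        (of_nat (\<Sum>S\<in>standard_tableaux \<mu>. if n < comaj \<mu> S then 0 else card (sum_words {1..r} ?k (n - comaj \<mu> S))) :: rat)"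
      by (rule arg_cong)
    then show ?thesis by (simp add: schur_eq_card_content if_distrib cong: if_cong)
  qed
  have "principal_spec r (schur \<mu>) = (\<Sum>S\<in>standard_tableaux \<mu>. fps_X ^ comaj \<mu> S) * ?F"
    by (simp add: fps_eq_iff principal_spec_def coeff sum_distrib_right fps_sum_nth fps_X_power_mult_nth cong: if_cong)
  \<comment> \<open>The factors in reverse order, to match the weight \<open>Suc r - l\<close> of
    the increment at \<open>l\<close>.\<close>
  moreover have "q_factorial_fps r = (\<Prod>l=1..r. 1 - fps_X ^ ?k l)"
    by (rule prod.reindex_bij_witness[of _ ?k ?k]) auto
  moreover have "?F * (\<Prod>l=1..r. 1 - fps_X ^ ?k l) = 1"
    by (rule fps_sum_words) auto
  ultimately show ?thesis by (simp add: mult.assoc)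
qed


section \<open>Burnside's lemma and the Frobenius character\<close>

text \<open>Pairs of a permutation and a fixed point are counted orbit by orbit: over one orbit the
  stabilizers add up to the whole group. The laws are assumed on \<open>Y\<close> only, because
  \<open>act_word r id\<close> fixes only extensional functions.\<close>

lemma burnside_permutes:
  fixes act :: "('a \<Rightarrow> 'a) \<Rightarrow> 'y \<Rightarrow> 'y"
  assumes S: "finite S" and Y: "finite Y"
    and closed: "\<And>\<sigma> y. \<sigma> permutes S \<Longrightarrow> y \<in> Y \<Longrightarrow> act \<sigma> y \<in> Y"
    and act_id: "\<And>y. y \<in> Y \<Longrightarrow> act id y = y"
    and act_comp: "\<And>\<sigma> \<tau> y. \<sigma> permutes S \<Longrightarrow> \<tau> permutes S \<Longrightarrow> y \<in> Y \<Longrightarrow> act (\<sigma> \<circ> \<tau>) y = act \<sigma> (act \<tau> y)"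
  shows "(\<Sum>\<sigma> | \<sigma> permutes S. card {y \<in> Y. act \<sigma> y = y}) =
    fact (card S) * card ((\<lambda>y. (\<lambda>\<sigma>. act \<sigma> y) ` {\<sigma>. \<sigma> permutes S}) ` Y)"
proof -
  let ?G = "{\<sigma>. \<sigma> permutes S}"
  let ?orb = "\<lambda>y. (\<lambda>\<sigma>. act \<sigma> y) ` ?G"
  have finG: "finite ?G" using S by (rule finite_permutations)
  have cardG: "card ?G = fact (card S)" using S by (simp add: card_permutations)
  have orb_self: "y \<in> ?orb y" if "y \<in> Y" for y
    using act_id[OF that] permutes_id[of S] by (metis (mono_tags) CollectI imageI)
  have orb_sub: "?orb y \<subseteq> Y" if "y \<in> Y" for y using closed that by auto
  have act_inv: "act (inv \<sigma>) (act \<sigma> y) = y" if "\<sigma> permutes S" "y \<in> Y" for \<sigma> y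
    using act_comp[of "inv \<sigma>" \<sigma> y] that act_id[of y] by (simp add: permutes_inv permutes_inv_o)
  have orb_le: "?orb z \<subseteq> ?orb y" if y: "y \<in> Y" and z: "z \<in> ?orb y" for y z
  proof
    fix x assume "x \<in> ?orb z"
    then obtain \<sigma> \<tau> where "\<sigma> permutes S" "x = act \<sigma> z" "\<tau> permutes S" "z = act \<tau> y" using z by auto
    then show "x \<in> ?orb y"
      using act_comp[of \<sigma> \<tau> y] y permutes_compose[of \<tau> S \<sigma>] by (auto intro!: image_eqI[of _ _ "\<sigma> \<circ> \<tau>"])
  qed
  have orb_sym: "y \<in> ?orb z" if y: "y \<in> Y" and z: "z \<in> ?orb y" for y z
  proof -
    obtain \<sigma> where "\<sigma> permutes S" "z = act \<sigma> y" using z by auto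
    then show ?thesis using act_inv[of \<sigma> y] y by (intro image_eqI[of _ _ "inv \<sigma>"]) (auto simp: permutes_inv)
  qed
  have orb_eq: "?orb z = ?orb y" if "y \<in> Y" "z \<in> ?orb y" for y z
    using orb_le[OF that] orb_le[of z y] orb_sym[OF that] orb_sub[OF that(1)] that by blast
  have fibre: "{z \<in> Y. ?orb z = ?orb y} = ?orb y" if y: "y \<in> Y" for y
  proof (intro equalityI subsetI)
    fix z assume "z \<in> {z \<in> Y. ?orb z = ?orb y}"
    then have "z \<in> Y" "?orb z = ?orb y" by auto
    with orb_self[of z] show "z \<in> ?orb y" by simp
  next
    fix z assume z: "z \<in> ?orb y"
    have "z \<in> Y" using orb_sub[OF y] z by (rule subsetD)
    with orb_eq[OF y z] show "z \<in> {z \<in> Y. ?orb z = ?orb y}" by simp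
  qed
  \<comment> \<open>Composing with one \<open>\<tau>\<close> that takes \<open>y\<close> to
    \<open>z\<close> turns the stabilizer of \<open>z\<close> into the set of permutations taking
    \<open>y\<close> to \<open>z\<close>. As \<open>z\<close> runs over the orbit, these sets
    partition the group.\<close>
  have stab: "card {\<sigma> \<in> ?G. act \<sigma> z = z} = card {\<sigma> \<in> ?G. act \<sigma> y = z}" if y: "y \<in> Y" and z: "z \<in> ?orb y" for y z
  proof -
    obtain \<tau> where \<tau>: "\<tau> permutes S" "z = act \<tau> y" using z by auto
    have "bij_betw (\<lambda>\<sigma>. \<sigma> \<circ> \<tau>) {\<sigma> \<in> ?G. act \<sigma> z = z} {\<sigma> \<in> ?G. act \<sigma> y = z}"
    proof (rule bij_betw_byWitness[where f' = "\<lambda>\<sigma>. \<sigma> \<circ> inv \<tau>"])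
      show "\<forall>a\<in>{\<sigma> \<in> ?G. act \<sigma> z = z}. (a \<circ> \<tau>) \<circ> inv \<tau> = a"
        using \<tau> by (simp add: comp_assoc permutes_inv_o)
      show "\<forall>a\<in>{\<sigma> \<in> ?G. act \<sigma> y = z}. (a \<circ> inv \<tau>) \<circ> \<tau> = a"
        using \<tau> by (simp add: comp_assoc permutes_inv_o)
      show "(\<lambda>\<sigma>. \<sigma> \<circ> \<tau>) ` {\<sigma> \<in> ?G. act \<sigma> z = z} \<subseteq> {\<sigma> \<in> ?G. act \<sigma> y = z}"
        using \<tau> y act_comp permutes_compose by auto
      show "(\<lambda>\<sigma>. \<sigma> \<circ> inv \<tau>) ` {\<sigma> \<in> ?G. act \<sigma> y = z} \<subseteq> {\<sigma> \<in> ?G. act \<sigma> z = z}"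
      proof (rule image_subsetI)
        fix \<sigma> assume "\<sigma> \<in> {\<sigma> \<in> ?G. act \<sigma> y = z}"
        then have \<sigma>: "\<sigma> permutes S" "z = act \<sigma> y" by auto
        have "act (\<sigma> \<circ> inv \<tau>) z = act \<sigma> (act (inv \<tau>) z)"
          using \<sigma> \<tau> closed y by (intro act_comp) (auto simp: permutes_inv)
        also have "act (inv \<tau>) z = y" using \<tau> act_inv y by simp
        finally have "act (\<sigma> \<circ> inv \<tau>) z = z" unfolding \<sigma>(2)[symmetric] .
        then show "\<sigma> \<circ> inv \<tau> \<in> {\<sigma> \<in> ?G. act \<sigma> z = z}"
          using permutes_compose[OF permutes_inv[OF \<tau>(1)] \<sigma>(1)] by blast
      qed
    qed
    then show ?thesis by (rule bij_betw_same_card)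
  qed
  have orbit_sum: "(\<Sum>z\<in>?orb y. card {\<sigma> \<in> ?G. act \<sigma> z = z}) = card ?G" if "y \<in> Y" for y
  proof -
    have "(\<Sum>z\<in>?orb y. card {\<sigma> \<in> ?G. act \<sigma> z = z}) = (\<Sum>z\<in>?orb y. card {\<sigma> \<in> ?G. act \<sigma> y = z})"
      using stab[OF that] by (rule sum.cong[OF refl])
    also have "\<dots> = card {\<sigma> \<in> ?G. act \<sigma> y \<in> ?orb y}"
      by (rule sum_card_fibres) (use finG in auto)
    also have "{\<sigma> \<in> ?G. act \<sigma> y \<in> ?orb y} = ?G" by auto
    finally show ?thesis .
  qed
  have "(\<Sum>\<sigma>\<in>?G. card {y \<in> Y. act \<sigma> y = y}) = (\<Sum>\<sigma>\<in>?G. \<Sum>y\<in>Y. of_bool (act \<sigma> y = y))"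
    using Y by (intro sum.cong refl) (simp add: Int_def)
  also have "\<dots> = (\<Sum>y\<in>Y. \<Sum>\<sigma>\<in>?G. of_bool (act \<sigma> y = y))" by (rule sum.swap)
  also have "\<dots> = (\<Sum>y\<in>Y. card {\<sigma> \<in> ?G. act \<sigma> y = y})"
    using finG by (intro sum.cong refl) (simp add: Int_def)
  also have "\<dots> = (\<Sum>B\<in>?orb ` Y. \<Sum>z\<in>{z \<in> Y. ?orb z = B}. card {\<sigma> \<in> ?G. act \<sigma> z = z})"
    by (rule sum.group[symmetric]) (use Y in auto)
  also have "\<dots> = (\<Sum>B\<in>?orb ` Y. card ?G)"
    by (rule sum.cong) (use fibre orbit_sum in auto)
  finally show ?thesis by (simp add: cardG mult.commute)
qed

lemma swap_vars_content: "swap_vars k (content_of A \<kappa> w) = content_of A \<kappa> (\<lambda>a. Transposition.transpose k (Suc k) (w a))"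
  by (rule poly_mapping_eqI)
    (auto simp: lookup_swap_vars content_of_def lookup_sum lookup_single when_def transpose_eq_iff intro!: sum.cong)

lemma swap_symmetric_words: "swap_symmetric (\<lambda>m. of_nat (card (words A \<kappa> m)))"
  unfolding swap_symmetric_def
proof (intro allI)
  fix k m
  let ?t = "Transposition.transpose k (Suc k)"
  have "bij_betw (\<lambda>w. \<lambda>a\<in>A. ?t (w a)) (words A \<kappa> (swap_vars k m)) (words A \<kappa> m)"
  proof (rule bij_betw_byWitness[where f' = "\<lambda>w. \<lambda>a\<in>A. ?t (w a)"])
    have c: "content_of A \<kappa> (\<lambda>a\<in>A. ?t (w a)) = swap_vars k (content_of A \<kappa> w)" for w
      unfolding swap_vars_content by (rule content_cong) auto
    show "(\<lambda>w. \<lambda>a\<in>A. ?t (w a)) ` words A \<kappa> (swap_vars k m) \<subseteq> words A \<kappa> m"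
      "(\<lambda>w. \<lambda>a\<in>A. ?t (w a)) ` words A \<kappa> m \<subseteq> words A \<kappa> (swap_vars k m)"
      by (auto simp: words_def c)
  qed (auto simp: words_def fun_eq_iff PiE_iff extensional_def)
  then show "rat_of_nat (card (words A \<kappa> (swap_vars k m))) = rat_of_nat (card (words A \<kappa> m))"
    by (simp add: bij_betw_same_card)
qed

lemma homogeneous_words: "homogeneous (\<Sum>a\<in>A. \<kappa> a) (\<lambda>m. of_nat (card (words A \<kappa> m)))"
  unfolding homogeneous_def
proof (intro allI impI)
  fix m assume "rat_of_nat (card (words A \<kappa> m)) \<noteq> 0"
  then have "words A \<kappa> m \<noteq> {}" by auto
  then show "mdeg m = (\<Sum>a\<in>A. \<kappa> a)" by (auto simp: words_def mweight_content)
qed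

section \<open>Cycles of a permutation and the power sum of its cycle type\<close>

context
  fixes r :: nat and \<sigma> :: "nat \<Rightarrow> nat"
  assumes \<sigma>: "\<sigma> permutes {1..r}"
begin

lemma orbit_subset_range: "i \<in> {1..r} \<Longrightarrow> orbit \<sigma> i \<subseteq> {1..r}"
  by (rule permutes_orbit_subset[OF \<sigma>])

text \<open>\<open>orbit \<sigma> i\<close> is generated from \<open>\<sigma> i\<close>, so that
  \<open>i\<close> itself is reached depends on the finiteness of the cycle.\<close>

lemma self_in_orbit: "i \<in> orbit \<sigma> i"
  using \<sigma> permutation_permutes by (intro permutation_self_in_orbit) blast

lemma orbit_eq: "j \<in> orbit \<sigma> i \<Longrightarrow> orbit \<sigma> j = orbit \<sigma> i"
  using cyclic_on_orbit[OF \<sigma>] by (intro orbit_cyclic_eq3) auto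

lemma orbit_fibre:
  assumes "B \<in> orbit \<sigma> ` {1..r}"
  shows "{i \<in> {1..r}. orbit \<sigma> i = B} = B"
  using assms orbit_eq self_in_orbit orbit_subset_range by blast

lemma card_orbit_pos:
  assumes "B \<in> orbit \<sigma> ` {1..r}"
  shows "card B > 0"
  using assms finite_orbit[OF self_in_orbit] orbit_nonempty[of \<sigma>] by (auto simp: card_gt_0_iff)

lemma sum_over_orbits:
  "(\<Sum>B\<in>orbit \<sigma> ` {1..r}. \<Sum>i\<in>B. g i) = (\<Sum>i\<in>{1..r}. g i)"
proof -
  have "(\<Sum>i\<in>{1..r}. g i) = (\<Sum>B\<in>orbit \<sigma> ` {1..r}. \<Sum>i\<in>{i \<in> {1..r}. orbit \<sigma> i = B}. g i)"
    by (rule sum.group[symmetric]) auto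
  also have "\<dots> = (\<Sum>B\<in>orbit \<sigma> ` {1..r}. \<Sum>i\<in>B. g i)"
    by (rule sum.cong) (simp_all only: orbit_fibre)
  finally show ?thesis by simp
qed

lemma sum_card_orbits: "(\<Sum>B\<in>orbit \<sigma> ` {1..r}. card B) = r"
  using sum_over_orbits[of "\<lambda>_. 1 :: nat"] by simp

text \<open>The orbits are distinct labels for the parts of the cycle type, which may repeat.
  Sorting them by \<open>card\<close> reproduces the order of the parts in
  \<open>cycle_type\<close>.\<close>

lemma cycle_type_as_list:
  "\<exists>xs. distinct xs \<and> set xs = orbit \<sigma> ` {1..r} \<and> map card xs = cycle_type r \<sigma>"
proof -
  obtain ys where ys: "set ys = orbit \<sigma> ` {1..r}" "distinct ys"
    using finite_distinct_list[of "orbit \<sigma> ` {1..r}"] by auto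
  have "mset (map card (sort_key card ys)) = image_mset card (mset_set (orbit \<sigma> ` {1..r}))"
    using ys by (simp add: mset_set_set[symmetric])
  then have "sorted_list_of_multiset (image_mset card (mset_set (orbit \<sigma> ` {1..r}))) = map card (sort_key card ys)"
    by (metis sorted_list_of_multiset_mset sorted_sort_id sorted_sort_key)
  then show ?thesis
    using ys by (intro exI[of _ "rev (sort_key card ys)"]) (simp add: cycle_type_def rev_map)
qed

lemma power_sum_cycle_type:
  "power_sum_partition (cycle_type r \<sigma>) m = of_nat (card (words (orbit \<sigma> ` {1..r}) card m))"
proof -
  obtain xs where "distinct xs" "set xs = orbit \<sigma> ` {1..r}" "map card xs = cycle_type r \<sigma>"
    using cycle_type_as_list by blast
  then show ?thesis
    using power_sum_partition_eq_card_words[of xs card m] card_orbit_pos by auto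
qed

text \<open>One letter per cycle is the same as a word that is constant on the cycles, and such
  words are the fixed points of the action on positions. Coefficients of power sums thus become
  values of a permutation character.\<close>

lemma card_words_orbits:
  "card (words (orbit \<sigma> ` {1..r}) card m) = card {w \<in> words {1..r} (\<lambda>_. 1) m. \<forall>i\<in>{1..r}. w (\<sigma> i) = w i}"
proof (rule bij_betw_same_card)
  let ?O = "orbit \<sigma> ` {1..r}" and ?S = "{1..r}"
  have const: "w j = w i" if w: "\<forall>i\<in>?S. w (\<sigma> i) = w i" and i: "i \<in> ?S" and j: "j \<in> orbit \<sigma> i" for w :: "nat \<Rightarrow> nat" and i j
    using j
  proof induction
    case (step y)
    then have "y \<in> ?S" using orbit_subset_range[OF i] by auto
    then show ?case using step w by simp
  qed (use w i in simp)
  have some: "(SOME i. i \<in> B) \<in> B" if "B \<in> ?O" for B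
    using that self_in_orbit by (metis imageE someI_ex)
  have content_of: "content_of ?S (\<lambda>_. 1) (\<lambda>i\<in>?S. c (orbit \<sigma> i)) = content_of ?O card c" for c :: "nat set \<Rightarrow> nat"
  proof -
    have sc: "(\<Sum>i\<in>B. Poly_Mapping.single (x::nat) (1::nat)) = Poly_Mapping.single x (card B)" for x and B :: "nat set"
      by (rule poly_mapping_eqI, simp only: lookup_sum lookup_single) (simp add: when_def)
    have "content_of ?S (\<lambda>_. 1) (\<lambda>i\<in>?S. c (orbit \<sigma> i)) = (\<Sum>i\<in>?S. Poly_Mapping.single (c (orbit \<sigma> i)) 1)"
      by (simp add: content_of_def)
    also have "\<dots> = (\<Sum>B\<in>?O. \<Sum>i\<in>B. Poly_Mapping.single (c (orbit \<sigma> i)) 1)"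
      by (rule sum_over_orbits[symmetric])
    also have "\<dots> = (\<Sum>B\<in>?O. \<Sum>i\<in>B. Poly_Mapping.single (c B) 1)"
      using orbit_eq by (intro sum.cong) auto
    also have "\<dots> = content_of ?O card c" by (simp only: sc content_of_def)
    finally show ?thesis .
  qed
  show "bij_betw (\<lambda>c. \<lambda>i\<in>?S. c (orbit \<sigma> i)) (words ?O card m) {w \<in> words ?S (\<lambda>_. 1) m. \<forall>i\<in>?S. w (\<sigma> i) = w i}"
  \<comment> \<open>Any element of the cycle may represent it, since the words are constant
    there.\<close>
  proof (rule bij_betw_byWitness[where f' = "\<lambda>w. \<lambda>B\<in>?O. w (SOME i. i \<in> B)"])
    show "\<forall>c\<in>words ?O card m. (\<lambda>B\<in>?O. (\<lambda>i\<in>?S. c (orbit \<sigma> i)) (SOME i. i \<in> B)) = c"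
    proof
      fix c assume c: "c \<in> words ?O card m"
      have "(\<lambda>i\<in>?S. c (orbit \<sigma> i)) (SOME i. i \<in> B) = c B" if B: "B \<in> ?O" for B
      proof -
        have "(SOME i. i \<in> B) \<in> {i \<in> ?S. orbit \<sigma> i = B}" using some[OF B] orbit_fibre[OF B] by simp
        then show ?thesis by simp
      qed
      then show "(\<lambda>B\<in>?O. (\<lambda>i\<in>?S. c (orbit \<sigma> i)) (SOME i. i \<in> B)) = c"
        using c by (intro extensionalityI[of _ ?O]) (auto simp: words_def PiE_def)
    qed
    have inverse: "(\<lambda>i\<in>?S. (\<lambda>B\<in>?O. w (SOME i. i \<in> B)) (orbit \<sigma> i)) = w"
      if w: "w \<in> words ?S (\<lambda>_. 1) m" "\<forall>i\<in>?S. w (\<sigma> i) = w i" for w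
    proof (rule extensionalityI[of _ ?S])
      fix i assume i: "i \<in> ?S"
      then show "(\<lambda>i\<in>?S. (\<lambda>B\<in>?O. w (SOME i. i \<in> B)) (orbit \<sigma> i)) i = w i"
        using const[OF w(2) i some[of "orbit \<sigma> i"]] by simp
    qed (use w in \<open>auto simp: words_def PiE_def\<close>)
    then show "\<forall>w\<in>{w \<in> words ?S (\<lambda>_. 1) m. \<forall>i\<in>?S. w (\<sigma> i) = w i}. (\<lambda>i\<in>?S. (\<lambda>B\<in>?O. w (SOME i. i \<in> B)) (orbit \<sigma> i)) = w"
      by blast
    show "(\<lambda>c. \<lambda>i\<in>?S. c (orbit \<sigma> i)) ` words ?O card m \<subseteq> {w \<in> words ?S (\<lambda>_. 1) m. \<forall>i\<in>?S. w (\<sigma> i) = w i}"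
    proof clarify
      fix c assume c: "c \<in> words ?O card m"
      have "orbit \<sigma> (\<sigma> i) = orbit \<sigma> i" "\<sigma> i \<in> ?S" if "i \<in> ?S" for i
        using orbit_eq[OF orbit.base] permutes_in_image[OF \<sigma>] that by auto
      then show "(\<lambda>i\<in>?S. c (orbit \<sigma> i)) \<in> words ?S (\<lambda>_. 1) m \<and>
          (\<forall>i\<in>?S. (\<lambda>i\<in>?S. c (orbit \<sigma> i)) (\<sigma> i) = (\<lambda>i\<in>?S. c (orbit \<sigma> i)) i)"
        using c content_of[of c] by (simp add: words_def)
    qed
    show "(\<lambda>w. \<lambda>B\<in>?O. w (SOME i. i \<in> B)) ` {w \<in> words ?S (\<lambda>_. 1) m. \<forall>i\<in>?S. w (\<sigma> i) = w i} \<subseteq> words ?O card m"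
    proof (rule image_subsetI)
      fix w assume w: "w \<in> {w \<in> words ?S (\<lambda>_. 1) m. \<forall>i\<in>?S. w (\<sigma> i) = w i}"
      then have "content_of ?O card (\<lambda>B\<in>?O. w (SOME i. i \<in> B)) = content_of ?S (\<lambda>_. 1) w"
        using content_of[of "\<lambda>B\<in>?O. w (SOME i. i \<in> B)"] inverse[of w] by simp
      then show "(\<lambda>B\<in>?O. w (SOME i. i \<in> B)) \<in> words ?O card m"
        using w by (simp add: words_def)
    qed
  qed
qed

lemma swap_symmetric_power_sum: "swap_symmetric (power_sum_partition (cycle_type r \<sigma>))"
  using swap_symmetric_words[of "orbit \<sigma> ` {1..r}" card] by (simp add: swap_symmetric_def power_sum_cycle_type)

lemma homogeneous_power_sum: "homogeneous r (power_sum_partition (cycle_type r \<sigma>))"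
  using homogeneous_words[of card "orbit \<sigma> ` {1..r}"] unfolding sum_card_orbits
  by (simp add: homogeneous_def power_sum_cycle_type)

lemma principal_spec_power_sum:
  "principal_spec r (power_sum_partition (cycle_type r \<sigma>)) * (\<Prod>B\<in>orbit \<sigma> ` {1..r}. 1 - fps_X ^ card B) = 1"
proof -
  have "power_sum_partition (cycle_type r \<sigma>) = (\<lambda>m. of_nat (card (words (orbit \<sigma> ` {1..r}) card m)))"
    by (rule ext) (rule power_sum_cycle_type)
  then show ?thesis using principal_spec_words[OF _ card_orbit_pos sum_card_orbits] by simp
qed

end

section \<open>The symmetric group acting on the positions of words\<close>

definition act_word :: "nat \<Rightarrow> (nat \<Rightarrow> nat) \<Rightarrow> (nat \<Rightarrow> nat) \<Rightarrow> nat \<Rightarrow> nat" where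
  "act_word r \<sigma> w = (\<lambda>i\<in>{1..r}. w (inv \<sigma> i))"

lemma act_word_closed:
  assumes "\<sigma> permutes {1..r}" "w \<in> words {1..r} (\<lambda>_. 1) m"
  shows "act_word r \<sigma> w \<in> words {1..r} (\<lambda>_. 1) m"
proof -
  have "content_of {1..r} (\<lambda>_. 1) (act_word r \<sigma> w) = (\<Sum>i\<in>{1..r}. Poly_Mapping.single (w (inv \<sigma> i)) 1)"
    by (simp add: content_of_def act_word_def)
  also have "\<dots> = (\<Sum>i\<in>{1..r}. Poly_Mapping.single (w i) 1)"
    using sum.permute[OF permutes_inv[OF assms(1)], of "\<lambda>i. Poly_Mapping.single (w i) (1::nat)"] by (simp only: comp_def)
  finally show ?thesis using assms(2) by (simp add: words_def act_word_def content_of_def)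
qed

lemma act_word_id: "w \<in> words {1..r} (\<lambda>_. 1) m \<Longrightarrow> act_word r id w = w"
  by (auto simp: act_word_def words_def fun_eq_iff PiE_iff extensional_def)

text \<open>The inverse in \<open>act_word\<close> serves this law: without it products would be
  reversed.\<close>

lemma act_word_comp:
  assumes "\<sigma> permutes {1..r}" "\<tau> permutes {1..r}"
  shows "act_word r (\<sigma> \<circ> \<tau>) w = act_word r \<sigma> (act_word r \<tau> w)"
proof -
  have "inv (\<sigma> \<circ> \<tau>) = inv \<tau> \<circ> inv \<sigma>"
    using assms by (intro o_inv_distrib) (auto simp: permutes_bij)
  moreover have "inv \<sigma> i \<in> {1..r} \<longleftrightarrow> i \<in> {1..r}" for i
    using permutes_in_image[OF permutes_inv[OF assms(1)]] .
  ultimately show ?thesis by (auto simp: act_word_def fun_eq_iff)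
qed

lemma act_word_fixed_iff:
  assumes \<sigma>: "\<sigma> permutes {1..r}" and w: "w \<in> words {1..r} (\<lambda>_. 1) m"
  shows "act_word r \<sigma> w = w \<longleftrightarrow> (\<forall>i\<in>{1..r}. w (\<sigma> i) = w i)"
proof
  assume eq: "act_word r \<sigma> w = w"
  show "\<forall>i\<in>{1..r}. w (\<sigma> i) = w i"
  proof
    fix i assume "i \<in> {1..r}"
    then have "\<sigma> i \<in> {1..r}" using permutes_in_image[OF \<sigma>] by blast
    then have "w (\<sigma> i) = w (inv \<sigma> (\<sigma> i))" using fun_cong[OF eq, of "\<sigma> i"] by (simp add: act_word_def)
    then show "w (\<sigma> i) = w i" by (simp add: permutes_inverses[OF \<sigma>])
  qed
next
  assume *: "\<forall>i\<in>{1..r}. w (\<sigma> i) = w i"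
  show "act_word r \<sigma> w = w"
  proof (rule extensionalityI[of _ "{1..r}"])
    fix i assume i: "i \<in> {1..r}"
    then have "inv \<sigma> i \<in> {1..r}" using permutes_in_image[OF permutes_inv[OF \<sigma>]] by blast
    then have "w (\<sigma> (inv \<sigma> i)) = w (inv \<sigma> i)" using * by blast
    then show "act_word r \<sigma> w i = w i" using i by (simp add: act_word_def permutes_inverses[OF \<sigma>])
  qed (use w in \<open>auto simp: act_word_def words_def PiE_def\<close>)
qed

lemma power_sum_eq_card_fixed_words:
  assumes "\<sigma> permutes {1..r}"
  shows "power_sum_partition (cycle_type r \<sigma>) m =
    of_nat (card {w \<in> words {1..r} (\<lambda>_. 1) m. act_word r \<sigma> w = w})"
proof -
  have "{w \<in> words {1..r} (\<lambda>_. 1) m. act_word r \<sigma> w = w} =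
      {w \<in> words {1..r} (\<lambda>_. 1) m. \<forall>i\<in>{1..r}. w (\<sigma> i) = w i}"
    using act_word_fixed_iff[OF assms] by blast
  then show ?thesis unfolding power_sum_cycle_type[OF assms] card_words_orbits[OF assms] by simp
qed


lemma ex_sorted_list_of_content:
  assumes "mdeg m = r"
  shows "\<exists>xs. sorted xs \<and> length xs = r \<and> (\<forall>v. count (mset xs) v = Poly_Mapping.lookup m v)"
proof -
  define M where "M = (\<Sum>i\<in>Poly_Mapping.keys m. replicate_mset (Poly_Mapping.lookup m i) i)"
  have "count M v = Poly_Mapping.lookup m v" for v
    by (simp add: M_def count_sum in_keys_iff)
  moreover have "size M = r" using assms by (simp add: M_def mweight_def)
  ultimately show ?thesis
    by (intro exI[of _ "sorted_list_of_multiset M"]) (simp flip: size_mset)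
qed

lemma card_nth_eq_count: "card {i. i < length xs \<and> xs ! i = v} = count (mset xs) v"
  by (simp add: count_mset count_list_eq_length_filter length_filter_conv_card eq_commute)

lemma words_nonempty:
  assumes "mdeg m = r"
  shows "words {1..r} (\<lambda>_. 1) m \<noteq> {}"
proof -
  obtain xs where xs: "length xs = r" "\<forall>v. count (mset xs) v = Poly_Mapping.lookup m v"
    using ex_sorted_list_of_content[OF assms] by blast
  let ?w = "\<lambda>i\<in>{1..r}. xs ! (i - 1)"
  have "content_of {1..r} (\<lambda>_. 1) ?w = m"
  proof (rule poly_mapping_eqI)
    fix v
    have "card {a \<in> {1..r}. ?w a = v} = card {i. i < length xs \<and> xs ! i = v}"
      by (rule bij_betw_same_card[of "\<lambda>i. i - 1"], rule bij_betw_byWitness[where f' = Suc])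
        (use xs(1) in auto)
    then show "Poly_Mapping.lookup (content_of {1..r} (\<lambda>_. 1) ?w) v = Poly_Mapping.lookup m v"
      unfolding lookup_content[OF finite_atLeastAtMost] card_nth_eq_count using xs(2) by simp
  qed
  then have "?w \<in> words {1..r} (\<lambda>_. 1) m" by (simp add: words_def)
  then show ?thesis by blast
qed

lemma act_word_transitive:
  assumes "w \<in> words {1..r} (\<lambda>_. 1) m" "w' \<in> words {1..r} (\<lambda>_. 1) m"
  shows "\<exists>\<sigma>. \<sigma> permutes {1..r} \<and> act_word r \<sigma> w = w'"
proof -
  have c: "card {a \<in> {1..r}. v a = x} = Poly_Mapping.lookup m x" if "v \<in> words {1..r} (\<lambda>_. 1) m" for v x
    using that lookup_content[OF finite_atLeastAtMost, of 1 r v x] by (simp add: words_def)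
  have "image_mset w' (mset_set {1..r}) = image_mset w (mset_set {1..r})"
    by (rule multiset_eqI)
      (simp only: count_image_mset_eq_card_vimage[OF finite_atLeastAtMost] c[OF assms(1)] c[OF assms(2)])
  then obtain p where p: "p permutes {1..r}" "\<forall>x\<in>{1..r}. w' x = w (p x)"
    by (rule image_mset_eq_implies_permutes[OF finite_atLeastAtMost])
  have "act_word r (inv p) w = w'"
    using p assms(2)
    by (intro extensionalityI[of _ "{1..r}"]) (auto simp: act_word_def permutes_inv_inv words_def PiE_def)
  with permutes_inv[OF p(1)] show ?thesis by blast
qed

text \<open>The words of a given content form a single orbit, so Burnside's lemma counts 1. After
  division by \<open>fact r\<close> this is the power sum expansion of the complete homogeneous
  function, the Frobenius character of the trivial representation.\<close>

lemma sum_power_sums: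
  "(\<Sum>\<sigma> | \<sigma> permutes {1..r}. power_sum_partition (cycle_type r \<sigma>) m) = (if mdeg m = r then fact r else 0)"
proof (cases "mdeg m = r")
  case True
  let ?W = "words {1..r} (\<lambda>_. 1) m"
  let ?orb = "\<lambda>w. (\<lambda>\<sigma>. act_word r \<sigma> w) ` {\<sigma>. \<sigma> permutes {1..r}}"
  have fin: "finite ?W" by (rule finite_words) auto
  have "?orb w = ?W" if "w \<in> ?W" for w
    using act_word_transitive[OF that] act_word_closed[OF _ that] by blast
  then have "?orb ` ?W = {?W}" using words_nonempty[OF True] by (auto simp: image_iff)
  then have "card (?orb ` ?W) = 1" by simp
  then have "(\<Sum>\<sigma> | \<sigma> permutes {1..r}. card {w \<in> ?W. act_word r \<sigma> w = w}) = fact r"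
    using burnside_permutes[of "{1..r}" ?W "act_word r"] fin act_word_closed act_word_id act_word_comp by simp
  then have "(\<Sum>\<sigma> | \<sigma> permutes {1..r}. of_nat (card {w \<in> ?W. act_word r \<sigma> w = w})) = (fact r :: rat)"
    by (simp only: of_nat_sum[symmetric] of_nat_fact)
  with True show ?thesis by (simp add: power_sum_eq_card_fixed_words)
next
  case False
  have "power_sum_partition (cycle_type r \<sigma>) m = 0" if "\<sigma> permutes {1..r}" for \<sigma>
    using homogeneous_power_sum[OF that] False unfolding homogeneous_def by blast
  with False show ?thesis by simp
qed

section \<open>The one-row Schur function\<close>

lemma cells_single_row: "cells [r] = {0} \<times> {..<r}"
  by (auto simp: cells_def)

lemma single_row_partition: "r \<ge> 1 \<Longrightarrow> [r] \<in> partitions_of r"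
  by (simp add: partitions_of_def partitions_def)

text \<open>A row is a weakly increasing sequence, determined by its content; so
  \<open>schur [r]\<close> is the complete homogeneous function of degree \<open>r\<close>.\<close>

lemma schur_single_row:
  assumes "r \<ge> 1"
  shows "schur [r] m = (if mdeg m = r then 1 else 0)"
proof (cases "mdeg m = r")
  case True
  obtain xs where xs: "sorted xs" "length xs = r" "\<forall>v. count (mset xs) v = Poly_Mapping.lookup m v"
    using ex_sorted_list_of_content[OF True] by blast
  let ?T = "\<lambda>c\<in>cells [r]. xs ! snd c"
  have row_content: "Poly_Mapping.lookup (content_of (cells [r]) (\<lambda>_. 1) T) v = count (mset (map (\<lambda>j. T (0, j)) [0..<r])) v" for T v
  proof -
    have "card {c \<in> cells [r]. T c = v} = card {j. j < r \<and> T (0, j) = v}"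
      by (rule bij_betw_same_card[of snd], rule bij_betw_byWitness[where f' = "\<lambda>j. (0, j)"])
        (auto simp: cells_single_row)
    also have "\<dots> = count (mset (map (\<lambda>j. T (0, j)) [0..<r])) v"
      unfolding card_nth_eq_count[symmetric] by (intro arg_cong[where f = card]) auto
    finally show ?thesis by (simp only: lookup_content[OF finite_cells])
  qed
  have "{T \<in> semistandard_tableaux [r]. content_of (cells [r]) (\<lambda>_. 1) T = m} = {?T}"
  proof (intro equalityI subsetI)
    fix T assume "T \<in> {T \<in> semistandard_tableaux [r]. content_of (cells [r]) (\<lambda>_. 1) T = m}"
    then have T: "T \<in> semistandard_tableaux [r]" "content_of (cells [r]) (\<lambda>_. 1) T = m" by blast+
    let ?ys = "map (\<lambda>j. T (0, j)) [0..<r]"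
    have "sorted ?ys"
      using semistandardD_row[OF T(1), of 0] by (auto simp: sorted_iff_nth_mono)
    moreover have "mset ?ys = mset xs"
      by (rule multiset_eqI) (metis row_content T(2) xs(3))
    ultimately have ys: "?ys = xs" using xs(1) by (metis sorted_sort_id properties_for_sort)
    have "T = ?T"
    proof (rule extensionalityI[of _ "cells [r]"])
      fix c assume "c \<in> cells [r]"
      then obtain j where "c = (0, j)" "j < r" by (auto simp: cells_single_row)
      then show "T c = ?T c" using arg_cong[OF ys, of "\<lambda>zs. zs ! j"] by (simp add: cells_single_row)
    qed (use T in \<open>auto simp: semistandard_tableaux_def\<close>)
    then show "T \<in> {?T}" by simp
  next
    fix T assume "T \<in> {?T}"
    then have T: "T = ?T" by simp
    have "map (\<lambda>j. ?T (0, j)) [0..<r] = xs"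
      using xs(2) by (intro nth_equalityI) (auto simp: cells_single_row)
    then have "content_of (cells [r]) (\<lambda>_. 1) ?T = m"
      by (intro poly_mapping_eqI) (simp only: row_content xs(3))
    moreover have "?T \<in> semistandard_tableaux [r]"
      using xs(1,2) by (auto simp: semistandard_tableaux_def sorted_iff_nth_mono)
    ultimately show "T \<in> {T \<in> semistandard_tableaux [r]. content_of (cells [r]) (\<lambda>_. 1) T = m}"
      unfolding T by blast
  qed
  then show ?thesis unfolding schur_eq_card_content using True by simp
next
  case False
  then show ?thesis using homogeneous_schur[of "[r]"] by (auto simp: homogeneous_def)
qed

lemma standard_single_row:
  assumes "S \<in> standard_tableaux [r]"
  shows "S = (\<lambda>c\<in>cells [r]. Suc (snd c))"
proof (rule extensionalityI[of _ "cells [r]"])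
  fix c assume c: "c \<in> cells [r]"
  have less: "S c' < S c \<longleftrightarrow> snd c' < snd c" if "c' \<in> cells [r]" for c'
  proof -
    have "S (0, j) < S (0, j')" if "j < j'" "j' < r" for j j'
      using standard_row[OF assms, of 0 j' j] that by simp
    then show ?thesis using c that by (auto simp: cells_single_row) (metis less_asym nat_neq_iff)
  qed
  have "card {c' \<in> cells [r]. S c' < S c} = card {c' \<in> cells [r]. snd c' < snd c}"
    using less by (intro arg_cong[where f = card]) blast
  also have "{c' \<in> cells [r]. snd c' < snd c} = {0} \<times> {..<snd c}"
    using c by (auto simp: cells_single_row)
  also have "card \<dots> = snd c" by (simp add: card_cartesian_product)
  finally show "S c = (\<lambda>c\<in>cells [r]. Suc (snd c)) c"
    using standard_eq_rank[OF assms c] c by simp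
qed (use assms in \<open>auto simp: standard_tableaux_def\<close>)

lemma standard_tableaux_single_row: "standard_tableaux [r] = {\<lambda>c\<in>cells [r]. Suc (snd c)}"
proof -
  have "(\<lambda>c\<in>cells [r]. Suc (snd c)) \<in> standard_tableaux [r]"
  proof -
    have "bij_betw (\<lambda>c. Suc (snd c)) (cells [r]) {1..r}"
      by (rule bij_betw_byWitness[where f' = "\<lambda>k. (0, k - 1)"]) (auto simp: cells_single_row)
    then have "bij_betw (\<lambda>c\<in>cells [r]. Suc (snd c)) (cells [r]) {1..r}"
      by (subst bij_betw_cong[where g = "\<lambda>c. Suc (snd c)"]) auto
    then show ?thesis by (auto simp: standard_tableaux_def)
  qed
  then show ?thesis using standard_single_row by blast
qed

lemma comaj_single_row: "comaj [r] S = 0"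
proof -
  have "tableau_descents [r] S = {}" by (auto simp: tableau_descents_def)
  then show ?thesis by (simp add: comaj_def)
qed

text \<open>A set species has at most one structure on a set, namely the set itself, so a structure
  of the composite is determined by its underlying partition.\<close>

lemma structures_partitions:
  "structures (species_comp (sets_le n) sets_nonempty) {1..r} = (\<lambda>\<pi>. (\<pi>, \<pi>, \<lambda>B\<in>\<pi>. B)) ` set_partitions r n"
proof -
  have fin: "finite \<pi>" if "partition_on {1..r} \<pi>" for \<pi> :: "nat set set"
    using that by (rule finite_elements[OF finite_atLeastAtMost])
  have blocks: "g = (\<lambda>B\<in>\<pi>. B)" if "g \<in> (\<Pi>\<^sub>E B\<in>\<pi>. structures sets_nonempty B)" for g and \<pi> :: "nat set set"
    using that by (intro extensionalityI[of _ \<pi>]) (auto simp: sets_nonempty_def set_species_def PiE_iff split: if_splits)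
  have ne: "finite B \<and> card B \<ge> 1" if "partition_on {1..r} \<pi>" "B \<in> \<pi>" for \<pi> and B :: "nat set"
  proof -
    have "B \<subseteq> {1..r}" "B \<noteq> {}" using that partition_onD1 partition_onD3 by blast+
    then show ?thesis using finite_subset by (auto simp: Suc_le_eq card_gt_0_iff)
  qed
  show ?thesis
  proof (intro equalityI subsetI)
    fix x assume "x \<in> structures (species_comp (sets_le n) sets_nonempty) {1..r}"
    then obtain \<pi> s g where x: "x = (\<pi>, s, g)" "partition_on {1..r} \<pi>" "s \<in> structures (sets_le n) \<pi>"
      "g \<in> (\<Pi>\<^sub>E B\<in>\<pi>. structures sets_nonempty B)" by (auto simp: species_comp_def)
    have "s = \<pi>" "card \<pi> \<le> n" using x(3) by (auto simp: sets_le_def set_species_def split: if_splits)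
    then show "x \<in> (\<lambda>\<pi>. (\<pi>, \<pi>, \<lambda>B\<in>\<pi>. B)) ` set_partitions r n"
      using x(1,2) blocks[OF x(4)] by (auto simp: set_partitions_def)
  next
    fix x assume "x \<in> (\<lambda>\<pi>. (\<pi>, \<pi>, \<lambda>B\<in>\<pi>. B)) ` set_partitions r n"
    then obtain \<pi> where x: "x = (\<pi>, \<pi>, \<lambda>B\<in>\<pi>. B)" "partition_on {1..r} \<pi>" "card \<pi> \<le> n"
      by (auto simp: set_partitions_def)
    have "\<pi> \<in> structures (sets_le n) \<pi>" using fin[OF x(2)] x(3) by (simp add: sets_le_def set_species_def)
    moreover have "B \<in> structures sets_nonempty B" if "B \<in> \<pi>" for B
      using ne[OF x(2) that] by (simp add: sets_nonempty_def set_species_def)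
    then have "(\<lambda>B\<in>\<pi>. B) \<in> (\<Pi>\<^sub>E B\<in>\<pi>. structures sets_nonempty B)" by simp
    ultimately show "x \<in> structures (species_comp (sets_le n) sets_nonempty) {1..r}"
      using x(1,2) by (simp add: species_comp_def)
  qed
qed

lemma transport_partition:
  assumes "\<sigma> permutes {1..r}" "partition_on {1..r} \<pi>"
  shows "transport (species_comp (sets_le n) sets_nonempty) {1..r} \<sigma> (\<pi>, \<pi>, \<lambda>B\<in>\<pi>. B) =
    ((`) \<sigma> ` \<pi>, (`) \<sigma> ` \<pi>, \<lambda>C\<in>(`) \<sigma> ` \<pi>. C)"
proof -
  \<comment> \<open>By injectivity the preimage in \<open>transport\<close> recovers the block that
    was moved.\<close>
  have "\<sigma> -` (\<sigma> ` B) \<inter> {1..r} = B" if "B \<in> \<pi>" for B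
    using that partition_onD1[OF assms(2)] permutes_inj[OF assms(1)] by (auto simp: inj_vimage_image_eq)
  then have "(\<lambda>C\<in>(`) \<sigma> ` \<pi>. \<sigma> ` ((\<lambda>B\<in>\<pi>. B) (\<sigma> -` C \<inter> {1..r}))) = (\<lambda>C\<in>(`) \<sigma> ` \<pi>. C)"
    by (auto simp: fun_eq_iff)
  then show ?thesis
    by (simp add: species_comp_def sets_le_def set_species_def sets_nonempty_def Let_def)
qed

lemma species_character_partitions:
  assumes "\<sigma> permutes {1..r}"
  shows "species_character r (species_comp (sets_le n) sets_nonempty) \<sigma> =
    card {\<pi> \<in> set_partitions r n. (`) \<sigma> ` \<pi> = \<pi>}"
proof -
  let ?e = "\<lambda>\<pi> :: nat set set. (\<pi>, \<pi>, \<lambda>B\<in>\<pi>. B)"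
  let ?t = "transport (species_comp (sets_le n) sets_nonempty) {1..r} \<sigma>"
  have "{s \<in> ?e ` set_partitions r n. ?t s = s} = ?e ` {\<pi> \<in> set_partitions r n. ?t (?e \<pi>) = ?e \<pi>}"
    by blast
  also have "{\<pi> \<in> set_partitions r n. ?t (?e \<pi>) = ?e \<pi>} = {\<pi> \<in> set_partitions r n. (`) \<sigma> ` \<pi> = \<pi>}"
  proof (intro Collect_cong conj_cong refl)
    fix \<pi> assume "\<pi> \<in> set_partitions r n"
    then have "?t (?e \<pi>) = ?e ((`) \<sigma> ` \<pi>)"
      using transport_partition[OF assms] by (simp add: set_partitions_def)
    then show "?t (?e \<pi>) = ?e \<pi> \<longleftrightarrow> (`) \<sigma> ` \<pi> = \<pi>" by (metis prod.inject)
  qed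
  finally have "{s \<in> ?e ` set_partitions r n. ?t s = s} = ?e ` {\<pi> \<in> set_partitions r n. (`) \<sigma> ` \<pi> = \<pi>}" .
  moreover have "inj_on ?e A" for A by (auto intro: inj_onI)
  ultimately show ?thesis by (simp only: species_character_def structures_partitions card_image)
qed

lemma set_partitions_closed:
  assumes "\<sigma> permutes {1..r}" "\<pi> \<in> set_partitions r n"
  shows "(`) \<sigma> ` \<pi> \<in> set_partitions r n"
proof -
  have p: "partition_on {1..r} \<pi>" "card \<pi> \<le> n" using assms(2) by (auto simp: set_partitions_def)
  have "partition_on (\<sigma> ` {1..r}) ((`) \<sigma> ` \<pi> - {{}})"
    using p(1) permutes_inj_on[OF assms(1)] by (rule partition_on_inj_image)
  moreover have "{} \<notin> (`) \<sigma> ` \<pi>" using partition_onD3[OF p(1)] by auto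
  ultimately have "partition_on {1..r} ((`) \<sigma> ` \<pi>)" using permutes_image[OF assms(1)] by simp
  moreover have "card ((`) \<sigma> ` \<pi>) \<le> n"
    using card_image_le[OF finite_elements[OF finite_atLeastAtMost p(1)], of "(`) \<sigma>"] p(2) by simp
  ultimately show ?thesis by (simp add: set_partitions_def)
qed

lemma finite_set_partitions: "finite (set_partitions r n)"
  by (rule finite_subset[OF _ finitely_many_partition_on[of "{1..r}"]]) (auto simp: set_partitions_def)

section \<open>The Frobenius character of set partitions\<close>

abbreviation chi :: "nat \<Rightarrow> nat \<Rightarrow> (nat \<Rightarrow> nat) \<Rightarrow> nat" where
  "chi r n \<sigma> \<equiv> card {\<pi> \<in> set_partitions r n. (`) \<sigma> ` \<pi> = \<pi>}"

abbreviation frob :: "nat \<Rightarrow> nat \<Rightarrow> series" where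
  "frob r n \<equiv> frobenius_character r (species_comp (sets_le n) sets_nonempty)"

lemma frob_eq:
  "frob r n m = (1 / fact r) * (\<Sum>\<sigma> | \<sigma> permutes {1..r}. of_nat (chi r n \<sigma>) * power_sum_partition (cycle_type r \<sigma>) m)"
  unfolding frobenius_character_def
  by (intro arg_cong2[where f = "(*)"] sum.cong refl) (simp add: species_character_partitions)

text \<open>Burnside's lemma for the simultaneous action on pairs of a set partition and a word of
  content \<open>m\<close>. Fixed point counts multiply, so the coefficient is the number of orbits
  of such pairs.\<close>

lemma frob_Ints: "frob r n m \<in> \<int>"
proof -
  let ?W = "words {1..r} (\<lambda>_. 1) m" and ?X = "set_partitions r n"
  let ?act = "\<lambda>\<sigma> (\<pi>, w). ((`) \<sigma> ` \<pi>, act_word r \<sigma> w)"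
  have fin: "finite (?X \<times> ?W)" using finite_set_partitions finite_words[of "{1..r}" "\<lambda>_. 1" m] by simp
  have "(\<Sum>\<sigma> | \<sigma> permutes {1..r}. card {y \<in> ?X \<times> ?W. ?act \<sigma> y = y}) =
      fact (card {1..r}) * card ((\<lambda>y. (\<lambda>\<sigma>. ?act \<sigma> y) ` {\<sigma>. \<sigma> permutes {1..r}}) ` (?X \<times> ?W))"
    by (rule burnside_permutes[OF finite_atLeastAtMost fin])
      (auto simp: set_partitions_closed[simplified] act_word_closed[simplified] act_word_id[simplified]
        act_word_comp[simplified] image_image image_comp)
  moreover have "card {y \<in> ?X \<times> ?W. ?act \<sigma> y = y} = chi r n \<sigma> * card {w \<in> ?W. act_word r \<sigma> w = w}" for \<sigma>
  proof -
    have "{y \<in> ?X \<times> ?W. ?act \<sigma> y = y} = {\<pi> \<in> ?X. (`) \<sigma> ` \<pi> = \<pi>} \<times> {w \<in> ?W. act_word r \<sigma> w = w}"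
      by auto
    then show ?thesis by (simp add: card_cartesian_product)
  qed
  ultimately obtain N where
    N: "(\<Sum>\<sigma> | \<sigma> permutes {1..r}. chi r n \<sigma> * card {w \<in> ?W. act_word r \<sigma> w = w}) = fact r * N"
    by simp
  have "(\<Sum>\<sigma> | \<sigma> permutes {1..r}. of_nat (chi r n \<sigma>) * power_sum_partition (cycle_type r \<sigma>) m) =
      of_nat (\<Sum>\<sigma> | \<sigma> permutes {1..r}. chi r n \<sigma> * card {w \<in> ?W. act_word r \<sigma> w = w})"
    by (simp add: power_sum_eq_card_fixed_words)
  also have "\<dots> = fact r * of_nat N" unfolding N by simp
  finally have "frob r n m = of_nat N" unfolding frob_eq by simp
  then show ?thesis by simp
qed

lemma swap_symmetric_frob: "swap_symmetric (frob r n)"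
  using swap_symmetric_power_sum unfolding swap_symmetric_def frob_eq by simp

lemma homogeneous_frob: "homogeneous r (frob r n)"
  unfolding homogeneous_def
proof (intro allI impI, rule ccontr)
  fix m assume m: "frob r n m \<noteq> 0" "mdeg m \<noteq> r"
  have "power_sum_partition (cycle_type r \<sigma>) m = 0" if "\<sigma> permutes {1..r}" for \<sigma>
    using homogeneous_power_sum[OF that] m(2) unfolding homogeneous_def by blast
  then have "frob r n m = 0" unfolding frob_eq by simp
  with m(1) show False by simp
qed


section \<open>Rotation\<close>

lemma
  fixes \<sigma> :: "nat \<Rightarrow> nat"
  assumes "\<sigma> permutes {1..r}"
  shows funpow_card_orbit: "(\<sigma> ^^ card (orbit \<sigma> x)) x = x"
    and inj_on_funpow_orbit: "inj_on (\<lambda>n. (\<sigma> ^^ n) x) {0..<card (orbit \<sigma> x)}"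
    and orbit_eq_funpow_image: "orbit \<sigma> x = (\<lambda>n. (\<sigma> ^^ n) x) ` {0..<card (orbit \<sigma> x)}"
proof -
  have self: "x \<in> orbit \<sigma> x" by (rule self_in_orbit[OF assms])
  let ?n = "funpow_dist1 \<sigma> x x"
  have orb: "orbit \<sigma> x = (\<lambda>n. (\<sigma> ^^ n) x) ` {0..<?n}" by (rule orbit_conv_funpow_dist1[OF self])
  have inj: "inj_on (\<lambda>n. (\<sigma> ^^ n) x) {0..<?n}" by (rule inj_on_funpow_dist1[OF self])
  have n: "card (orbit \<sigma> x) = ?n" by (subst orb) (simp only: card_image[OF inj] card_atLeastLessThan diff_zero)
  show "(\<sigma> ^^ card (orbit \<sigma> x)) x = x" unfolding n by (rule funpow_dist1_prop[OF self])
  show "inj_on (\<lambda>n. (\<sigma> ^^ n) x) {0..<card (orbit \<sigma> x)}" unfolding n by (rule inj)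
  show "orbit \<sigma> x = (\<lambda>n. (\<sigma> ^^ n) x) ` {0..<card (orbit \<sigma> x)}" unfolding n by (rule orb)
qed

text \<open>The cycle \<open>a\<close>, and the position \<open>b\<close> on it counted from a
  chosen base point, are coordinates in which \<open>\<sigma>\<close> shifts \<open>b\<close> modulo
  \<open>d\<close>.\<close>

lemma uniform_cycles_coordinates:
  fixes \<sigma> :: "nat \<Rightarrow> nat"
  assumes \<sigma>: "\<sigma> permutes {1..r}" and d: "d > 0" "\<And>i. i \<in> {1..r} \<Longrightarrow> card (orbit \<sigma> i) = d"
  shows "\<exists>\<phi>. bij_betw \<phi> ({0..<r div d} \<times> {0..<d}) {1..r} \<and>
    (\<forall>a b. a < r div d \<and> b < d \<longrightarrow> \<sigma> (\<phi> (a, b)) = \<phi> (a, Suc b mod d))"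
proof -
  let ?O = "orbit \<sigma> ` {1..r}"
  have "(\<Sum>B\<in>?O. card B) = (\<Sum>B\<in>?O. d)" using d(2) by (intro sum.cong) auto
  then have "card ?O * d = r" using sum_card_orbits[OF \<sigma>] by simp
  then have cardO: "card ?O = r div d" using div_mult_self_is_m[OF d(1)] by metis
  obtain f where f: "bij_betw f {0..<r div d} ?O"
    using ex_bij_betw_nat_finite[of ?O] unfolding cardO by auto
  define rep where "rep a = (SOME x. x \<in> {1..r} \<and> orbit \<sigma> x = f a)" for a
  have rep: "rep a \<in> {1..r}" "orbit \<sigma> (rep a) = f a" if "a < r div d" for a
  proof -
    have "f a \<in> ?O" using f that by (meson atLeastLessThan_iff bij_betwE zero_le)
    then have "\<exists>x. x \<in> {1..r} \<and> orbit \<sigma> x = f a" by auto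
    then have "rep a \<in> {1..r} \<and> orbit \<sigma> (rep a) = f a" unfolding rep_def by (rule someI_ex)
    then show "rep a \<in> {1..r}" "orbit \<sigma> (rep a) = f a" by auto
  qed
  define \<phi> where "\<phi> = (\<lambda>(a, b). (\<sigma> ^^ b) (rep a))"
  have orbit_\<phi>: "\<phi> (a, b) \<in> f a" if "a < r div d" for a b
    using funpow_in_orbit[OF self_in_orbit[OF \<sigma>], of b "rep a"] rep[OF that] by (simp add: \<phi>_def)
  have f_disj: "a = a'" if "a < r div d" "a' < r div d" "x \<in> f a" "x \<in> f a'" for a a' x
  proof -
    have "f a = f a'" using orbit_eq[OF \<sigma>] rep that by metis
    then show ?thesis using f that by (auto simp: bij_betw_def inj_on_def)
  qed
  have "inj_on \<phi> ({0..<r div d} \<times> {0..<d})"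
  proof (rule inj_onI, clarify)
    fix a b a' b' assume ab: "a \<in> {0..<r div d}" "b \<in> {0..<d}" "a' \<in> {0..<r div d}" "b' \<in> {0..<d}"
      "\<phi> (a, b) = \<phi> (a', b')"
    have "a = a'" using ab orbit_\<phi>[of a b] orbit_\<phi>[of a' b'] by (intro f_disj) auto
    moreover have "b = b'"
      using inj_on_funpow_orbit[OF \<sigma>, of "rep a"] d(2)[of "rep a"] rep[of a] ab \<open>a = a'\<close>
      by (auto simp: \<phi>_def inj_on_def)
    ultimately show "a = a' \<and> b = b'" by simp
  qed
  moreover have "\<phi> ` ({0..<r div d} \<times> {0..<d}) = {1..r}"
  proof (intro equalityI subsetI)
    fix x assume "x \<in> \<phi> ` ({0..<r div d} \<times> {0..<d})"
    then obtain a b where "a < r div d" "x = \<phi> (a, b)" by auto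
    then show "x \<in> {1..r}" using orbit_\<phi>[of a b] rep[of a] orbit_subset_range[OF \<sigma>, of "rep a"] by auto
  next
    fix x assume x: "x \<in> {1..r}"
    then have "orbit \<sigma> x \<in> f ` {0..<r div d}" using f by (simp add: bij_betw_def)
    then obtain a where a: "a < r div d" "orbit \<sigma> x = f a" by auto
    have "x \<in> orbit \<sigma> (rep a)" using self_in_orbit[OF \<sigma>, of x] a rep by simp
    then have "x \<in> (\<lambda>n. (\<sigma> ^^ n) (rep a)) ` {0..<d}"
      using orbit_eq_funpow_image[OF \<sigma>, of "rep a"] d(2)[of "rep a"] rep[OF a(1)] by simp
    then obtain b where "b < d" "x = \<phi> (a, b)" by (auto simp: \<phi>_def)
    then show "x \<in> \<phi> ` ({0..<r div d} \<times> {0..<d})" using a(1) by auto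
  qed
  moreover have "\<sigma> (\<phi> (a, b)) = \<phi> (a, Suc b mod d)" if "a < r div d" "b < d" for a b
  proof (cases "Suc b = d")
    case True
    have "\<sigma> ((\<sigma> ^^ b) (rep a)) = rep a"
      using funpow_card_orbit[OF \<sigma>, of "rep a"] d(2)[of "rep a"] rep[OF that(1)] True[symmetric] by simp
    then show ?thesis using True by (simp add: \<phi>_def)
  next
    case False
    then show ?thesis using that by (simp add: \<phi>_def)
  qed
  ultimately show ?thesis by (intro exI[of _ \<phi>]) (auto simp: bij_betw_def)
qed

text \<open>Matching the two coordinate systems conjugates one shift into the other. Equal cycle
  lengths are the case that arises, as the terms of all other permutations vanish at the root of
  unity.\<close>

lemma uniform_cycles_conjugate:
  fixes \<sigma> \<tau> :: "nat \<Rightarrow> nat"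
  assumes \<sigma>: "\<sigma> permutes {1..r}" "\<And>i. i \<in> {1..r} \<Longrightarrow> card (orbit \<sigma> i) = d"
    and \<tau>: "\<tau> permutes {1..r}" "\<And>i. i \<in> {1..r} \<Longrightarrow> card (orbit \<tau> i) = d"
    and d: "d > 0"
  shows "\<exists>g. g permutes {1..r} \<and> g \<circ> \<sigma> = \<tau> \<circ> g"
proof -
  let ?I = "{0..<r div d} \<times> {0..<d}"
  obtain \<phi> where \<phi>: "bij_betw \<phi> ?I {1..r}"
    "\<And>a b. a < r div d \<Longrightarrow> b < d \<Longrightarrow> \<sigma> (\<phi> (a, b)) = \<phi> (a, Suc b mod d)"
    using uniform_cycles_coordinates[OF \<sigma>(1) d \<sigma>(2)] by blast
  obtain \<psi> where \<psi>: "bij_betw \<psi> ?I {1..r}"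
    "\<And>a b. a < r div d \<Longrightarrow> b < d \<Longrightarrow> \<tau> (\<psi> (a, b)) = \<psi> (a, Suc b mod d)"
    using uniform_cycles_coordinates[OF \<tau>(1) d \<tau>(2)] by blast
  define g where "g i = (if i \<in> {1..r} then \<psi> (the_inv_into ?I \<phi> i) else i)" for i
  have g_\<phi>: "g (\<phi> x) = \<psi> x" if "x \<in> ?I" for x
  proof -
    have "\<phi> x \<in> {1..r}" using \<phi>(1) that by (rule bij_betwE[THEN bspec])
    moreover have "the_inv_into ?I \<phi> (\<phi> x) = x" using \<phi>(1) that by (simp only: bij_betw_def the_inv_into_f_f)
    ultimately show ?thesis unfolding g_def by simp
  qed
  have "bij_betw (\<psi> \<circ> the_inv_into ?I \<phi>) {1..r} {1..r}"
    using bij_betw_the_inv_into[OF \<phi>(1)] \<psi>(1) by (rule bij_betw_trans)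
  then have "bij_betw g {1..r} {1..r}"
    by (subst bij_betw_cong[of _ g "\<psi> \<circ> the_inv_into ?I \<phi>"]) (auto simp: g_def)
  then have g: "g permutes {1..r}" by (rule bij_imp_permutes) (auto simp: g_def)
  have "g (\<sigma> i) = \<tau> (g i)" for i
  proof (cases "i \<in> {1..r}")
    case True
    then have "i \<in> \<phi> ` ?I" using \<phi>(1) by (simp only: bij_betw_def)
    then obtain a b where ab: "i = \<phi> (a, b)" "a < r div d" "b < d" by auto
    then have "g (\<sigma> i) = g (\<phi> (a, Suc b mod d))" using \<phi>(2) by simp
    also have "\<dots> = \<psi> (a, Suc b mod d)" using ab d by (intro g_\<phi>) auto
    also have "\<dots> = \<tau> (g i)" using \<psi>(2) ab g_\<phi>[of "(a, b)"] by simp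
    finally show ?thesis .
  next
    case False
    then show ?thesis using permutes_not_in[OF \<sigma>(1)] permutes_not_in[OF \<tau>(1)] permutes_not_in[OF g] by metis
  qed
  with g show ?thesis by (intro exI[of _ g]) auto
qed

text \<open>Relabelling by \<open>g\<close> carries the partitions fixed by \<open>\<sigma>\<close>
  to those fixed by \<open>\<tau>\<close>.\<close>

lemma chi_conjugate:
  assumes g: "g permutes {1..r}" "g \<circ> \<sigma> = \<tau> \<circ> g"
  shows "chi r n \<sigma> = chi r n \<tau>"
proof (rule bij_betw_same_card)
  have "inv g ` g ` B = B" "g ` inv g ` B = B" for B :: "nat set"
    by (simp_all only: image_comp permutes_inv_o[OF g(1)] image_id id_apply)
  then have cancel: "(`) (inv g) ` (`) g ` \<pi> = \<pi>" "(`) g ` (`) (inv g) ` \<pi> = \<pi>" for \<pi> :: "nat set set"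
    by (force simp: image_iff)+
  have comm: "(`) \<tau> ` (`) g ` \<pi> = (`) g ` (`) \<sigma> ` \<pi>" for \<pi> :: "nat set set"
  proof -
    have "g (\<sigma> x) = \<tau> (g x)" for x using fun_cong[OF g(2)] by simp
    then show ?thesis by (simp add: image_image)
  qed
  show "bij_betw (\<lambda>\<pi>. (`) g ` \<pi>) {\<pi> \<in> set_partitions r n. (`) \<sigma> ` \<pi> = \<pi>} {\<pi> \<in> set_partitions r n. (`) \<tau> ` \<pi> = \<pi>}"
  proof (rule bij_betw_byWitness[where f' = "\<lambda>\<pi>. (`) (inv g) ` \<pi>"])
    show "(\<lambda>\<pi>. (`) g ` \<pi>) ` {\<pi> \<in> set_partitions r n. (`) \<sigma> ` \<pi> = \<pi>} \<subseteq> {\<pi> \<in> set_partitions r n. (`) \<tau> ` \<pi> = \<pi>}"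
    proof (rule image_subsetI)
      fix \<pi> assume \<pi>: "\<pi> \<in> {\<pi> \<in> set_partitions r n. (`) \<sigma> ` \<pi> = \<pi>}"
      then have "(`) \<tau> ` (`) g ` \<pi> = (`) g ` \<pi>" by (simp only: comm mem_Collect_eq)
      then show "(`) g ` \<pi> \<in> {\<pi> \<in> set_partitions r n. (`) \<tau> ` \<pi> = \<pi>}"
        using set_partitions_closed[OF g(1), of \<pi> n] \<pi> by simp
    qed
    show "(\<lambda>\<pi>. (`) (inv g) ` \<pi>) ` {\<pi> \<in> set_partitions r n. (`) \<tau> ` \<pi> = \<pi>} \<subseteq> {\<pi> \<in> set_partitions r n. (`) \<sigma> ` \<pi> = \<pi>}"
    proof (rule image_subsetI)
      fix \<pi> assume \<pi>: "\<pi> \<in> {\<pi> \<in> set_partitions r n. (`) \<tau> ` \<pi> = \<pi>}"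
      have "(`) \<sigma> ` (`) (inv g) ` \<pi> = (`) (inv g) ` (`) g ` (`) \<sigma> ` (`) (inv g) ` \<pi>" by (simp only: cancel)
      also have "\<dots> = (`) (inv g) ` (`) \<tau> ` (`) g ` (`) (inv g) ` \<pi>" by (simp only: comm)
      also have "\<dots> = (`) (inv g) ` \<pi>" using \<pi> by (simp only: cancel mem_Collect_eq)
      finally show "(`) (inv g) ` \<pi> \<in> {\<pi> \<in> set_partitions r n. (`) \<sigma> ` \<pi> = \<pi>}"
        using set_partitions_closed[OF permutes_inv[OF g(1)], of \<pi> n] \<pi> by simp
    qed
  qed (auto simp: cancel)
qed

text \<open>The map \<open>i mod r + 1\<close> moves points outside \<open>{1..r}\<close>; fixing
  those points gives a permutation in the sense of \<open>permutes\<close>, with the same effect on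
  blocks.\<close>

definition rot :: "nat \<Rightarrow> nat \<Rightarrow> nat" where
  "rot r i = (if i \<in> {1..r} then i mod r + 1 else i)"

lemma funpow_rot:
  assumes "i \<in> {1..r}"
  shows "(rot r ^^ k) i = (i - 1 + k) mod r + 1"
proof (induction k)
  case 0
  then show ?case using assms by auto
next
  case (Suc k)
  have "r > 0" using assms by auto
  then have "(i - 1 + k) mod r + 1 \<in> {1..r}" by (simp add: Suc_le_eq)
  then have "rot r ((i - 1 + k) mod r + 1) = ((i - 1 + k) mod r + 1) mod r + 1" by (simp only: rot_def if_True)
  then have "(rot r ^^ Suc k) i = ((i - 1 + k) mod r + 1) mod r + 1" using Suc by simp
  also have "\<dots> = (i - 1 + Suc k) mod r + 1" by (simp add: mod_Suc_eq)
  finally show ?case .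
qed

lemma rot_permutes:
  assumes "r \<ge> 1"
  shows "rot r permutes {1..r}"
proof (rule bij_imp_permutes)
  have "(rot r ^^ r) i = i" if "i \<in> {1..r}" for i
    using funpow_rot[OF that, of r] that by auto
  then have "rot r ((rot r ^^ (r - 1)) i) = i" "(rot r ^^ (r - 1)) (rot r i) = i" if "i \<in> {1..r}" for i
    using that assms funpow_Suc_right[of "r - 1" "rot r"] by (cases r; force)+
  moreover have "(rot r ^^ k) i \<in> {1..r}" if "i \<in> {1..r}" for i k
    using funpow_rot[OF that, of k] assms by (simp add: Suc_le_eq)
  from this[of _ 1] this[of _ "r - 1"] have "rot r ` {1..r} \<subseteq> {1..r}" "(rot r ^^ (r - 1)) ` {1..r} \<subseteq> {1..r}"
    by auto
  ultimately show "bij_betw (rot r) {1..r} {1..r}"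
    by (intro bij_betw_byWitness[where f' = "rot r ^^ (r - 1)"]) auto
qed (auto simp: rot_def)

text \<open>The hypothesis makes \<open>d\<close> the order of \<open>j\<close> modulo
  \<open>r\<close>, that is, \<open>r div gcd r j\<close>. The \<open>k\<close>-th iterate of
  \<open>rot r ^^ j\<close> shifts residues by \<open>j * k\<close>, so it fixes \<open>i\<close>
  exactly when \<open>d\<close> divides \<open>k\<close>.\<close>

lemma card_orbit_rot_power:
  assumes r: "r \<ge> 1" and d: "\<And>k. r dvd j * k \<longleftrightarrow> d dvd k" and i: "i \<in> {1..r}"
  shows "card (orbit (rot r ^^ j) i) = d"
proof -
  let ?\<sigma> = "rot r ^^ j"
  have \<sigma>: "?\<sigma> permutes {1..r}" by (rule permutes_funpow[OF rot_permutes[OF r]])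
  have fix_iff: "(?\<sigma> ^^ k) i = i \<longleftrightarrow> d dvd k" for k
  proof -
    have "(?\<sigma> ^^ k) i = (i - 1 + j * k) mod r + 1"
      unfolding funpow_mult using funpow_rot[OF i, of "j * k"] by (simp add: mult.commute)
    also have "\<dots> = i \<longleftrightarrow> (i - 1 + j * k) mod r = (i - 1 + 0) mod r" using i by auto
    also have "\<dots> \<longleftrightarrow> r dvd j * k"
      by (metis add_diff_cancel_left' le_add1 mod_eq_dvd_iff_nat add.right_neutral)
    finally show ?thesis using d by simp
  qed
  let ?c = "card (orbit ?\<sigma> i)"
  have dc: "d dvd ?c" using fix_iff funpow_card_orbit[OF \<sigma>] by blast
  have c: "?c > 0" using card_orbit_pos[OF \<sigma>] i by blast
  have "d > 0" using dc c by (metis dvd_0_left_iff neq0_conv)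
  moreover have "\<not> d < ?c"
  proof
    assume "d < ?c"
    moreover have "(?\<sigma> ^^ d) i = (?\<sigma> ^^ 0) i" using fix_iff by simp
    ultimately have "d = 0" using inj_on_funpow_orbit[OF \<sigma>, of i] c unfolding inj_on_def by force
    with \<open>d > 0\<close> show False by simp
  qed
  ultimately show ?thesis using dc c by (meson dvd_imp_le le_antisym not_le)
qed

lemma funpow_rotation:
  assumes "\<pi> \<in> set_partitions r n" "r \<ge> 1"
  shows "(rotation r ^^ j) \<pi> = (`) (rot r ^^ j) ` \<pi>"
proof (induction j)
  case (Suc j)
  let ?\<pi> = "(`) (rot r ^^ j) ` \<pi>"
  have "?\<pi> \<in> set_partitions r n"
    using assms rot_permutes by (intro set_partitions_closed permutes_funpow)
  then have sub: "B \<subseteq> {1..r}" if "B \<in> ?\<pi>" for B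
    using that partition_onD1 by (fastforce simp: set_partitions_def)
  have "(rotation r ^^ Suc j) \<pi> = rotation r ?\<pi>" using Suc by simp
  also have "\<dots> = (`) (rot r) ` ?\<pi>"
    unfolding rotation_def
  proof (rule image_cong[OF refl])
    fix B assume "B \<in> ?\<pi>"
    then have "B \<subseteq> {1..r}" by (rule sub)
    then show "(\<lambda>i. i mod r + 1) ` B = rot r ` B"
      by (intro image_cong refl) (auto simp: rot_def)
  qed
  also have "\<dots> = (`) (rot r ^^ Suc j) ` \<pi>" by (simp add: image_image image_comp)
  finally show ?case .
qed simp


section \<open>Evaluation at roots of unity\<close>

text \<open>Built from the Schur expansion, this is a polynomial by construction and can be
  evaluated at a root of unity, unlike the power series \<open>principal_spec\<close>.\<close>

definition co_fake_degree :: "series \<Rightarrow> nat \<Rightarrow> rat poly" where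
  "co_fake_degree f r = (\<Sum>\<mu>\<in>partitions_of r. smult (schur_coeffs f \<mu>) (\<Sum>S\<in>standard_tableaux \<mu>. monom 1 (comaj \<mu> S)))"

lemma principal_spec_sum:
  "principal_spec r (\<lambda>m. \<Sum>i\<in>A. c i * f i m) = (\<Sum>i\<in>A. fps_const (c i) * principal_spec r (f i))"
  by (simp add: fps_eq_iff principal_spec_def fps_sum_nth sum_distrib_left sum.swap[of _ "graded _ _"])

text \<open>The right-hand side is linear in \<open>f\<close> and free of
  \<open>schur_coeffs\<close>. Identities for \<open>co_fake_degree\<close> are proved on that side
  and pulled back along the injective \<open>fps_of_poly\<close>.\<close>

lemma fps_co_fake_degree:
  assumes "swap_symmetric f" "homogeneous r f"
  shows "fps_of_poly (co_fake_degree f r) = principal_spec r f * q_factorial_fps r"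
proof -
  have "principal_spec r f = principal_spec r (\<lambda>m. \<Sum>\<mu>\<in>partitions_of r. schur_coeffs f \<mu> * schur \<mu> m)"
    by (rule arg_cong[where f = "principal_spec r"]) (rule ext, rule schur_coeffs_expansion(2)[OF assms])
  also have "\<dots> = (\<Sum>\<mu>\<in>partitions_of r. fps_const (schur_coeffs f \<mu>) * principal_spec r (schur \<mu>))"
    by (rule principal_spec_sum)
  finally have "principal_spec r f * q_factorial_fps r =
      (\<Sum>\<mu>\<in>partitions_of r. fps_const (schur_coeffs f \<mu>) * (principal_spec r (schur \<mu>) * q_factorial_fps r))"
    by (simp add: sum_distrib_right mult.assoc)
  also have "\<dots> = fps_of_poly (co_fake_degree f r)"
    unfolding co_fake_degree_def fps_of_poly_sum fps_of_poly_smult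
    by (intro sum.cong refl) (simp only: principal_spec_schur fps_of_poly_sum fps_of_poly_monom')
  finally show ?thesis by simp
qed

text \<open>The only standard tableau of one row has no descents. The constant 1 is the
  normalization supplied by the trivial representation.\<close>

lemma co_fake_degree_single_row:
  assumes "r \<ge> 1"
  shows "co_fake_degree (schur [r]) r = 1"
proof -
  have r: "[r] \<in> partitions_of r" using assms by (rule single_row_partition)
  then have "swap_symmetric (schur [r])" by (simp add: swap_symmetric_def schur_swap_vars partitions_of_def)
  moreover have "homogeneous r (schur [r])" using homogeneous_schur[of "[r]"] by simp
  ultimately have "fps_of_poly (co_fake_degree (schur [r]) r) = principal_spec r (schur [r]) * q_factorial_fps r"
    by (rule fps_co_fake_degree)
  also have "\<dots> = 1"
    unfolding principal_spec_schur[OF r] by (simp add: standard_tableaux_single_row comaj_single_row)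
  finally show ?thesis by (metis fps_of_poly_1 fps_of_poly_eq_iff)
qed

lemma co_fake_degree_combination:
  assumes "\<And>i. i \<in> A \<Longrightarrow> swap_symmetric (f i)" "\<And>i. i \<in> A \<Longrightarrow> homogeneous r (f i)"
    and "swap_symmetric g" "homogeneous r g" "\<And>m. g m = (\<Sum>i\<in>A. c i * f i m)"
  shows "co_fake_degree g r = (\<Sum>i\<in>A. smult (c i) (co_fake_degree (f i) r))"
proof -
  have "g = (\<lambda>m. \<Sum>i\<in>A. c i * f i m)" using assms(5) by (rule ext)
  then have "principal_spec r g = (\<Sum>i\<in>A. fps_const (c i) * principal_spec r (f i))"
    by (simp only: principal_spec_sum)
  then have "fps_of_poly (co_fake_degree g r) =
      (\<Sum>i\<in>A. fps_const (c i) * (principal_spec r (f i) * q_factorial_fps r))"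
    using fps_co_fake_degree[OF assms(3,4)] by (simp add: sum_distrib_right mult.assoc)
  also have "\<dots> = fps_of_poly (\<Sum>i\<in>A. smult (c i) (co_fake_degree (f i) r))"
    unfolding fps_of_poly_sum fps_of_poly_smult
    using assms(1,2) by (intro sum.cong refl) (simp add: fps_co_fake_degree)
  finally show ?thesis by (simp add: fps_of_poly_eq_iff)
qed

text \<open>The product form stays meaningful where both products vanish, which is where the
  multiplicities are compared.\<close>

lemma co_fake_degree_power_sum:
  assumes "\<sigma> permutes {1..r}"
  shows "co_fake_degree (power_sum_partition (cycle_type r \<sigma>)) r * (\<Prod>B\<in>orbit \<sigma> ` {1..r}. 1 - monom 1 (card B)) =
    (\<Prod>k=1..r. 1 - monom 1 k)"
proof -
  have "fps_of_poly (co_fake_degree (power_sum_partition (cycle_type r \<sigma>)) r * (\<Prod>B\<in>orbit \<sigma> ` {1..r}. 1 - monom 1 (card B))) =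
      (principal_spec r (power_sum_partition (cycle_type r \<sigma>)) * (\<Prod>B\<in>orbit \<sigma> ` {1..r}. 1 - fps_X ^ card B)) * q_factorial_fps r"
    using fps_co_fake_degree[OF swap_symmetric_power_sum[OF assms] homogeneous_power_sum[OF assms]]
    by (simp add: fps_of_poly_mult fps_of_poly_prod fps_of_poly_diff fps_of_poly_monom' algebra_simps)
  also have "\<dots> = fps_of_poly (\<Prod>k=1..r. 1 - monom 1 k)"
    unfolding principal_spec_power_sum[OF assms] by (simp add: fps_of_poly_prod fps_of_poly_diff fps_of_poly_monom')
  finally show ?thesis by (simp add: fps_of_poly_eq_iff)
qed

section \<open>Complex roots and their multiplicities\<close>

abbreviation cpoly :: "rat poly \<Rightarrow> complex poly" where
  "cpoly \<equiv> map_poly of_rat"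

lemma cpoly_add: "cpoly (p + q) = cpoly p + cpoly q"
  by (rule poly_eqI) (simp add: coeff_map_poly of_rat_add)

lemma cpoly_diff: "cpoly (p - q) = cpoly p - cpoly q"
  by (rule poly_eqI) (simp add: coeff_map_poly of_rat_diff)

lemma cpoly_mult: "cpoly (p * q) = cpoly p * cpoly q"
  by (rule poly_eqI) (simp add: coeff_map_poly coeff_mult of_rat_sum of_rat_mult)

lemma cpoly_smult: "cpoly (smult c p) = smult (of_rat c) (cpoly p)"
  by (rule poly_eqI) (simp add: coeff_map_poly of_rat_mult)

lemma cpoly_sum: "cpoly (\<Sum>i\<in>A. f i) = (\<Sum>i\<in>A. cpoly (f i))"
  by (induction A rule: infinite_finite_induct) (simp_all add: cpoly_add)

lemma cpoly_prod: "cpoly (\<Prod>i\<in>A. f i) = (\<Prod>i\<in>A. cpoly (f i))"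
  by (induction A rule: infinite_finite_induct) (simp_all add: cpoly_mult)

lemma cpoly_monom: "cpoly (monom 1 k) = monom 1 k"
  by (simp add: map_poly_monom)

text \<open>The derivative is a scalar multiple of a monomial and does not vanish away from 0, so
  every root is simple.\<close>

lemma order_one_minus_monom:
  fixes z :: complex
  assumes "k \<ge> 1" "z \<noteq> 0"
  shows "1 - monom 1 k \<noteq> (0 :: complex poly)"
    and "order z (1 - monom 1 k) = (if z ^ k = 1 then 1 else 0)"
proof -
  have "coeff (1 - monom 1 k :: complex poly) 0 = 1" using assms by simp
  then show ne: "1 - monom 1 k \<noteq> (0 :: complex poly)" by (metis coeff_0 one_neq_zero)
  have d: "pderiv (1 - monom 1 k :: complex poly) = - monom (of_nat k) (k - 1)"
    by (simp add: pderiv_diff pderiv_monom)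
  have "order z (pderiv (1 - monom 1 k)) = 0"
    unfolding d using assms by (intro order_0I) (simp add: poly_monom)
  then show "order z (1 - monom 1 k) = (if z ^ k = 1 then 1 else 0)"
    using order_pderiv[OF ne, of z] order_0I[of "1 - monom 1 k" z] by (auto simp: poly_monom)
qed

lemma order_prod_one_minus_monom:
  fixes z :: complex
  assumes "finite A" "\<And>a. a \<in> A \<Longrightarrow> \<kappa> a \<ge> 1" "z \<noteq> 0"
  shows "(\<Prod>a\<in>A. 1 - monom 1 (\<kappa> a)) \<noteq> (0 :: complex poly)"
    and "order z (\<Prod>a\<in>A. 1 - monom 1 (\<kappa> a)) = card {a \<in> A. z ^ \<kappa> a = 1}"
proof -
  show ne: "(\<Prod>a\<in>A. 1 - monom 1 (\<kappa> a)) \<noteq> (0 :: complex poly)"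
    using assms order_one_minus_monom(1) by (simp add: prod_zero_iff)
  have "order z (\<Prod>a\<in>A. 1 - monom 1 (\<kappa> a)) = (\<Sum>a\<in>A. if z ^ \<kappa> a = 1 then 1 else 0)"
    using assms(1,2)
  proof (induction A rule: finite_induct)
    case (insert x F)
    have "(\<Prod>a\<in>insert x F. 1 - monom 1 (\<kappa> a)) \<noteq> (0 :: complex poly)"
      using insert assms(3) order_one_minus_monom(1) by (simp add: prod_zero_iff)
    then show ?case using insert order_one_minus_monom(2)[of "\<kappa> x" z] assms(3) by (simp add: order_mult)
  qed simp
  also have "\<dots> = card {a \<in> A. z ^ \<kappa> a = 1}" using assms(1) by (simp add: sum.If_cases Int_def)
  finally show "order z (\<Prod>a\<in>A. 1 - monom 1 (\<kappa> a)) = card {a \<in> A. z ^ \<kappa> a = 1}" .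
qed

lemma card_multiples: "d > 0 \<Longrightarrow> card {k \<in> {1..r}. d dvd k} = r div d"
proof -
  assume d: "d > (0::nat)"
  have "bij_betw (\<lambda>i. d * i) {1..r div d} {k \<in> {1..r}. d dvd k}"
    using d by (intro bij_betw_byWitness[where f' = "\<lambda>k. k div d"])
      (auto simp: less_eq_div_iff_mult_less_eq div_le_mono mult.commute elim!: dvdE)
  then show ?thesis by (metis bij_betw_same_card card_atLeastAtMost diff_Suc_1)
qed

text \<open>
  Comparing the multiplicity of \<open>z\<close> on both sides of \<open>co_fake_degree_power_sum\<close>: on the right it
  is \<open>r div d\<close>, and the product on the left reaches it only if all cycles have length \<open>d\<close>.
\<close>

lemma uniform_cycles_if_nonzero:
  fixes z :: complex
  assumes \<sigma>: "\<sigma> permutes {1..r}" and d: "d > 0" "d dvd r" and z: "\<And>k. z ^ k = 1 \<longleftrightarrow> d dvd k"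
    and nz: "poly (cpoly (co_fake_degree (power_sum_partition (cycle_type r \<sigma>)) r)) z \<noteq> 0"
    and i: "i \<in> {1..r}"
  shows "card (orbit \<sigma> i) = d"
proof -
  let ?O = "orbit \<sigma> ` {1..r}" and ?L = "cpoly (co_fake_degree (power_sum_partition (cycle_type r \<sigma>)) r)"
  let ?M = "{B \<in> ?O. d dvd card B}"
  have z0: "z \<noteq> 0" using z[of d] d(1) by (metis dvd_refl power_0_left zero_neq_one less_irrefl)
  have pos: "card B \<ge> 1" if "B \<in> ?O" for B using card_orbit_pos[OF \<sigma> that] by simp
  have "?L * (\<Prod>B\<in>?O. 1 - monom 1 (card B)) = (\<Prod>k=1..r. 1 - monom 1 k)"
    using arg_cong[OF co_fake_degree_power_sum[OF \<sigma>], of cpoly]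
    by (simp add: cpoly_mult cpoly_prod cpoly_diff cpoly_monom)
  moreover have "order z (\<Prod>k=1..r. 1 - monom 1 k) = r div d" "(\<Prod>k=1..r. 1 - monom 1 k) \<noteq> (0 :: complex poly)"
    using order_prod_one_minus_monom[of "{1..r}" "\<lambda>k. k" z] z0 card_multiples[OF d(1)] by (simp_all add: z)
  moreover have "order z (\<Prod>B\<in>?O. 1 - monom 1 (card B)) = card ?M"
    using order_prod_one_minus_monom(2)[of ?O card z] pos z0 by (simp add: z)
  moreover have "order z ?L = 0" using nz by (rule order_0I)
  ultimately have M: "card ?M = r div d" by (metis add_0 order_mult)
  \<comment> \<open>The \<open>r div d\<close> cycles in \<open>?M\<close> have length at least
    \<open>d\<close> each, so they already fill all of \<open>r\<close>; a longer cycle, or one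
    outside \<open>?M\<close>, would exceed the total.\<close>
  have "card B = d \<and> B \<in> ?M" if B: "B \<in> ?O" for B
  proof (rule ccontr)
    assume n: "\<not> (card B = d \<and> B \<in> ?M)"
    have ge: "(if B \<in> ?M then d else 0) \<le> card B" if "B \<in> ?O" for B
      using that pos[OF that] by (auto dest: dvd_imp_le)
    have "(\<Sum>B\<in>?O. if B \<in> ?M then d else 0) < (\<Sum>B\<in>?O. card B)"
    proof (rule sum_strict_mono_ex1)
      show "\<exists>B\<in>?O. (if B \<in> ?M then d else 0) < card B"
        using B n ge[OF B] pos[OF B] by (intro bexI[of _ B]) (auto split: if_splits)
    qed (use ge in auto)
    also have "\<dots> = r" by (rule sum_card_orbits[OF \<sigma>])
    also have "(\<Sum>B\<in>?O. if B \<in> ?M then d else 0) = card ?M * d"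
      by (simp add: sum.If_cases Int_def conj_commute)
    also have "card ?M * d = r" unfolding M using d(2) by simp
    finally show False by simp
  qed
  then show ?thesis using i by blast
qed

lemma poly_co_fake_degree_frob:
  fixes z :: complex
  assumes r: "r \<ge> 1" and d: "d > 0" "d dvd r" "\<And>k. r dvd j * k \<longleftrightarrow> d dvd k"
    and z: "\<And>k. z ^ k = 1 \<longleftrightarrow> d dvd k"
  shows "poly (cpoly (co_fake_degree (frob r n) r)) z = of_nat (chi r n (rot r ^^ j))"
proof -
  let ?G = "{\<sigma>. \<sigma> permutes {1..r}}"
  let ?p = "\<lambda>\<sigma>. power_sum_partition (cycle_type r \<sigma>)"
  let ?L = "\<lambda>\<sigma>. poly (cpoly (co_fake_degree (?p \<sigma>) r)) z"
  have p: "swap_symmetric (?p \<sigma>)" "homogeneous r (?p \<sigma>)" if "\<sigma> \<in> ?G" for \<sigma>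
    using that swap_symmetric_power_sum homogeneous_power_sum by auto
  have ev: "poly (cpoly (\<Sum>\<sigma>\<in>?G. smult (c \<sigma>) (co_fake_degree (?p \<sigma>) r))) z = (\<Sum>\<sigma>\<in>?G. of_rat (c \<sigma>) * ?L \<sigma>)" for c
    by (simp add: cpoly_sum cpoly_smult poly_sum)
  \<comment> \<open>The trivial representation gives the same sum as \<open>frob\<close> with all
    character values equal to 1.\<close>
  have trivial: "co_fake_degree (schur [r]) r = (\<Sum>\<sigma>\<in>?G. smult (1 / fact r) (co_fake_degree (?p \<sigma>) r))"
  proof (rule co_fake_degree_combination[OF p])
    show "swap_symmetric (schur [r])"
      using single_row_partition[OF r] by (simp add: swap_symmetric_def schur_swap_vars partitions_of_def)
    show "homogeneous r (schur [r])" using homogeneous_schur[of "[r]"] by simp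
    show "schur [r] m = (\<Sum>\<sigma>\<in>?G. 1 / fact r * ?p \<sigma> m)" for m
      unfolding schur_single_row[OF r] sum_distrib_left[symmetric] sum_power_sums by simp
  qed
  have "poly (cpoly (co_fake_degree (schur [r]) r)) z = (\<Sum>\<sigma>\<in>?G. of_rat (1 / fact r) * ?L \<sigma>)"
    unfolding trivial by (rule ev)
  moreover have "poly (cpoly (co_fake_degree (schur [r]) r)) z = 1"
    by (simp add: co_fake_degree_single_row[OF r])
  ultimately have one: "1 = (\<Sum>\<sigma>\<in>?G. of_rat (1 / fact r) * ?L \<sigma>)" by (simp only:)
  have "co_fake_degree (frob r n) r = (\<Sum>\<sigma>\<in>?G. smult (of_nat (chi r n \<sigma>) / fact r) (co_fake_degree (?p \<sigma>) r))"
    by (rule co_fake_degree_combination[OF p swap_symmetric_frob homogeneous_frob])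
      (simp_all add: frob_eq sum_distrib_left)
  then have "poly (cpoly (co_fake_degree (frob r n) r)) z = (\<Sum>\<sigma>\<in>?G. of_rat (of_nat (chi r n \<sigma>) / fact r) * ?L \<sigma>)"
    by (simp only: ev)
  also have "\<dots> = (\<Sum>\<sigma>\<in>?G. of_nat (chi r n (rot r ^^ j)) * (of_rat (1 / fact r) * ?L \<sigma>))"
  proof (rule sum.cong[OF refl])
    fix \<sigma> assume \<sigma>: "\<sigma> \<in> ?G"
    show "of_rat (of_nat (chi r n \<sigma>) / fact r) * ?L \<sigma> = of_nat (chi r n (rot r ^^ j)) * (of_rat (1 / fact r) * ?L \<sigma>)"
    \<comment> \<open>Either the term vanishes on both sides, or \<open>\<sigma>\<close> is
      conjugate to \<open>rot r ^^ j\<close> and the class function \<open>chi\<close> has the same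
      value at both.\<close>
    proof (cases "?L \<sigma> = 0")
      case False
      have "card (orbit \<sigma> i) = d" if "i \<in> {1..r}" for i
        using uniform_cycles_if_nonzero[OF _ d(1,2) z False that] \<sigma> by blast
      moreover have "card (orbit (rot r ^^ j) i) = d" if "i \<in> {1..r}" for i
        by (rule card_orbit_rot_power[OF r d(3) that])
      ultimately obtain g where "g permutes {1..r}" "g \<circ> \<sigma> = (rot r ^^ j) \<circ> g"
        using uniform_cycles_conjugate[of \<sigma> r d "rot r ^^ j"] \<sigma> d(1) permutes_funpow[OF rot_permutes[OF r]] by blast
      then have "chi r n \<sigma> = chi r n (rot r ^^ j)" by (rule chi_conjugate)
      then show ?thesis by (simp add: of_rat_divide)
    qed simp
  qed
  also have "\<dots> = of_nat (chi r n (rot r ^^ j)) * (\<Sum>\<sigma>\<in>?G. of_rat (1 / fact r) * ?L \<sigma>)"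
    by (rule sum_distrib_left[symmetric])
  also have "\<dots> = of_nat (chi r n (rot r ^^ j))" by (simp only: one[symmetric] mult_1_right)
  finally show ?thesis .
qed

section \<open>Return from comaj to the fake degree\<close>

lemma fake_degree_frob:
  "fake_degree (frob r n) = (\<Sum>\<mu>\<in>partitions_of r. smult (schur_coeffs (frob r n) \<mu>) (fake_degree_schur \<mu>))"
  unfolding fake_degree_def
  by (rule sum.mono_neutral_left[OF finite_partitions_of])
    (use schur_coeffs_expansion(1)[OF swap_symmetric_frob homogeneous_frob] in auto)

text \<open>Since \<open>z ^ r = 1\<close>, the exponent \<open>r - k\<close> acts as
  \<open>- k\<close>, and on the unit circle the inverse is the conjugate.\<close>

lemma power_comaj:
  fixes z :: complex
  assumes "z ^ r = 1" "\<mu> \<in> partitions_of r" "S \<in> standard_tableaux \<mu>"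
  shows "z ^ comaj \<mu> S = cnj (z ^ maj \<mu> S)"
proof -
  have r: "sum_list \<mu> = r" using assms(2) by (simp add: partitions_of_def)
  have "z ^ (r - k) = cnj z ^ k" if "k \<in> tableau_descents \<mu> S" for k
  proof -
    have k: "k \<in> {1..<r}" using that tableau_descents_subset[OF assms(3)] r by auto
    \<comment> \<open>The exponent \<open>r\<close> is positive because a descent \<open>k\<close>
      lies in \<open>{1..<r}\<close>.\<close>
    have "norm z = 1" using power_eq_1_iff[OF assms(1)] k by auto
    then have "z * cnj z = 1" by (simp add: complex_norm_square[symmetric])
    have "z ^ (r - k) = z ^ (r - k) * (z * cnj z) ^ k" using \<open>z * cnj z = 1\<close> by simp
    also have "\<dots> = z ^ (r - k + k) * cnj z ^ k" by (simp add: power_mult_distrib power_add)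
    also have "\<dots> = cnj z ^ k" using assms(1) k by simp
    finally show ?thesis .
  qed
  then show ?thesis by (simp add: comaj_def maj_def r power_sum)
qed

text \<open>The coefficients are rational, hence real, so conjugation acts only on the powers of
  \<open>z\<close>.\<close>

lemma poly_fake_degree_frob:
  fixes z :: complex
  assumes "z ^ r = 1"
  shows "poly (cpoly (fake_degree (frob r n))) z = cnj (poly (cpoly (co_fake_degree (frob r n) r)) z)"
proof -
  have c: "cnj (of_rat x) = of_rat x" for x :: rat by (cases x) (simp add: of_rat_rat)
  show ?thesis
    unfolding fake_degree_frob co_fake_degree_def fake_degree_schur_def
    using power_comaj[OF assms] by (simp add: cpoly_sum cpoly_smult cpoly_monom poly_sum poly_monom c)
qed

theorem theorem8p6p1:
  fixes n r :: nat
  assumes "n \<ge> 1" and "r \<ge> 1"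
  shows "cyclic_sieving (set_partitions r n) (rotation r) r
           (fake_degree (frobenius_character r (species_comp (sets_le n) sets_nonempty)))"
  unfolding cyclic_sieving_def
proof (intro conjI allI ballI impI)
  let ?X = "set_partitions r n"
  show "finite ?X" by (rule finite_set_partitions)
  have rot: "(rotation r ^^ j) \<pi> \<in> ?X" if "\<pi> \<in> ?X" for j \<pi>
    unfolding funpow_rotation[OF that assms(2)]
    by (rule set_partitions_closed[OF permutes_funpow[OF rot_permutes[OF assms(2)]] that])
  have "rot r ^^ r = id"
  proof
    fix i
    show "(rot r ^^ r) i = id i"
    proof (cases "i \<in> {1..r}")
      case True
      then have "(i - 1 + r) mod r = i - 1" by (subst mod_add_self2) auto
      then show ?thesis using funpow_rot[OF True, of r] True by simp
    next
      case False
      then show ?thesis using permutes_not_in[OF permutes_funpow[OF rot_permutes[OF assms(2)]]] by simp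
    qed
  qed
  then show fixed: "(rotation r ^^ r) \<pi> = \<pi>" if "\<pi> \<in> ?X" for \<pi>
    unfolding funpow_rotation[OF that assms(2)] by simp
  show "bij_betw (rotation r) ?X ?X"
  proof (rule bij_betw_byWitness[where f' = "rotation r ^^ (r - 1)"])
    obtain s where s: "r = Suc s" using assms(2) by (cases r) auto
    show "\<forall>\<pi>\<in>?X. (rotation r ^^ (r - 1)) (rotation r \<pi>) = \<pi>"
      using fixed s by (metis comp_apply diff_Suc_1 funpow_Suc_right)
    show "\<forall>\<pi>\<in>?X. rotation r ((rotation r ^^ (r - 1)) \<pi>) = \<pi>"
      using fixed s by (metis comp_apply diff_Suc_1 funpow.simps(2))
    show "rotation r ` ?X \<subseteq> ?X" "(rotation r ^^ (r - 1)) ` ?X \<subseteq> ?X"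
      using rot[of _ 1] rot[of _ "r - 1"] by auto
  qed
  \<comment> \<open>Integrality passes from the monomial coefficients to the Schur coefficients by
    unitriangularity.\<close>
  show "coeff (fake_degree (frob r n)) i \<in> \<int>" for i
    unfolding fake_degree_frob fake_degree_schur_def coeff_sum coeff_smult
    using schur_coeffs_expansion(3)[OF swap_symmetric_frob homogeneous_frob frob_Ints]
    by (intro Ints_sum Ints_mult) auto
  fix j assume "j < r"
  let ?z = "exp (2 * of_real pi * \<i> / of_nat r) ^ j :: complex"
  \<comment> \<open>\<open>d\<close> is the common order of the root of unity \<open>?z\<close> and
    of \<open>rot r ^^ j\<close>; the witness is \<open>r div gcd r j\<close>, which is 1 for
    \<open>j = 0\<close>.\<close>
  obtain d where d: "d > 0" "d dvd r" "\<And>k. r dvd j * k \<longleftrightarrow> d dvd k"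
  proof
    let ?g = "gcd r j"
    have g: "?g > 0" using assms(2) by simp
    show "r div ?g > 0" using assms(2) by (simp add: div_greater_zero_iff)
    show "r div ?g dvd r" using dvd_div_mult_self[OF gcd_dvd1[of r j]] by (metis dvd_triv_left)
    fix k
    have "r dvd j * k \<longleftrightarrow> ?g * (r div ?g) dvd ?g * ((j div ?g) * k)" by (simp add: mult.assoc[symmetric])
    also have "\<dots> \<longleftrightarrow> r div ?g dvd (j div ?g) * k" by (rule nat_mult_dvd_cancel1[OF g])
    also have "\<dots> \<longleftrightarrow> r div ?g dvd k"
      using assms(2) by (intro coprime_dvd_mult_right_iff div_gcd_coprime) auto
    finally show "r dvd j * k \<longleftrightarrow> r div ?g dvd k" .
  qed
  have z: "?z ^ k = 1 \<longleftrightarrow> d dvd k" for k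
  proof -
    have "?z ^ k = exp (2 * of_real pi * \<i> * of_nat (j * k) / of_nat r)"
      by (simp add: power_mult[symmetric] exp_of_nat_mult[symmetric] mult_ac)
    also have "\<dots> = 1 \<longleftrightarrow> r dvd j * k"
      using complex_root_unity_eq_1[OF assms(2), of "j * k"] by simp
    finally show ?thesis using d(3) by simp
  qed
  \<comment> \<open>The value is a natural number, so the conjugation between comaj and maj
    disappears.\<close>
  have "poly (cpoly (fake_degree (frob r n))) ?z = cnj (of_nat (chi r n (rot r ^^ j)))"
    using poly_fake_degree_frob[of ?z r n] poly_co_fake_degree_frob[OF assms(2) d z] z[of r] d(2) by simp
  also have "chi r n (rot r ^^ j) = card {\<pi> \<in> ?X. (rotation r ^^ j) \<pi> = \<pi>}"
    using funpow_rotation[OF _ assms(2)] by (intro arg_cong[where f = card]) auto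
  finally show "poly (cpoly (fake_degree (frob r n))) ?z = of_nat (card {\<pi> \<in> ?X. (rotation r ^^ j) \<pi> = \<pi>})"
    by simp
qed

end
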